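(* Let $R$ be a non-local finite commutative ring with unity. Then the crosscap of the upper ideal relation graph $\Gamma_U(R)$ is $2$ if and only if $R$ is isomorphic to $\mathbb{Z}_5 \times \mathbb{Z}_5$.
   Context: Rings have a unity. A ring is local if it has a unique maximal ideal; a non-local finite commutative ring is (up to isomorphism) a direct product $R_1\times\cdots\times R_n$ of finite commutative local rings with $n\ge 2$. For $x\in R$, $(x)$ is the ideal generated by $x$. The upper ideal relation graph $\Gamma_U(R)$ is the simple undirected graph whose vertex set is the set of all non-unit elements of $R$ (including $0$), where two distinct vertices $x,y$ are adjacent if and only if there exists a non-unit $z\in R$ with $(x)\subseteq (z)$ and $(y)\subseteq (z)$. Let $\mathbb{N}_k$ be the non-orientable surface formed by the connected sum of $k$ projective planes. The crosscap of a graph is the minimum non-negative integer $k$ such that the graph can be embedded (drawn without edge crossings) in $\mathbb{N}_k$; planar graphs have crosscap $0$. *)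

theory Defs
  imports
    "HOL-Analysis.Analysis"
    "HOL-Library.Extended_Nat"
    "HOL-Algebra.IntRing" "HOL-Algebra.Chinese_Remainder"
begin

section \<open>The surfaces \<open>N\<^sub>k\<close>\<close>

text \<open>
  The connected sum with a projective plane replaces an open disc by a Moebius band, i.e. it
  removes the open disc and identifies antipodal points of the boundary circle (a crosscap).
  Hence the connected sum of \<open>k\<close> projective planes is the 2-sphere with \<open>k\<close> crosscaps. The discs
  are the open spherical caps of angular radius \<open>\<pi> / (2 * k)\<close> around \<open>k\<close> equally
  spaced points of the equator; these caps have pairwise disjoint closures. For \<open>k = 0\<close> this is
  the sphere, and for \<open>k = 1\<close> it is a closed hemisphere with antipodal boundary points identified,
  i.e. the projective plane.
\<close>

definition cap_centre :: "nat \<Rightarrow> nat \<Rightarrow> complex \<times> real" where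
  "cap_centre k j = (cis (2 * pi * real j / real k), 0)"

definition open_cap :: "nat \<Rightarrow> nat \<Rightarrow> (complex \<times> real) set" where
  "open_cap k j = {p \<in> sphere 0 1. p \<bullet> cap_centre k j > cos (pi / (2 * real k))}"

definition cap_circle :: "nat \<Rightarrow> nat \<Rightarrow> (complex \<times> real) set" where
  "cap_circle k j = {p \<in> sphere 0 1. p \<bullet> cap_centre k j = cos (pi / (2 * real k))}"

definition holed_sphere :: "nat \<Rightarrow> (complex \<times> real) set" where
  "holed_sphere k = sphere 0 1 - (\<Union>j<k. open_cap k j)"

text \<open>
  The half-turn about the axis through the centre of a cap; on the boundary circle of the cap it
  is the antipodal map of that circle.
\<close>

definition half_turn :: "nat \<Rightarrow> nat \<Rightarrow> complex \<times> real \<Rightarrow> complex \<times> real" where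
  "half_turn k j p = (2 * (p \<bullet> cap_centre k j)) *\<^sub>R cap_centre k j - p"

definition crosscap_class :: "nat \<Rightarrow> complex \<times> real \<Rightarrow> (complex \<times> real) set" where
  "crosscap_class k p = insert p {half_turn k j p | j. j < k \<and> p \<in> cap_circle k j}"

definition nonorientable_surface :: "nat \<Rightarrow> (complex \<times> real) set topology" where
  "nonorientable_surface k = topology (\<lambda>U.
     U \<subseteq> crosscap_class k ` holed_sphere k \<and>
     openin (top_of_set (holed_sphere k)) {p \<in> holed_sphere k. crosscap_class k p \<in> U})"

lemma openin_nonorientable_surface:
  "openin (nonorientable_surface k) U \<longleftrightarrow>
     U \<subseteq> crosscap_class k ` holed_sphere k \<and>
     openin (top_of_set (holed_sphere k)) {p \<in> holed_sphere k. crosscap_class k p \<in> U}"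
proof -
  let ?q = "crosscap_class k" and ?S = "holed_sphere k"
  have "istopology (\<lambda>U. U \<subseteq> ?q ` ?S \<and> openin (top_of_set ?S) {p \<in> ?S. ?q p \<in> U})"
    unfolding istopology_def
  proof (intro conjI allI impI; (elim conjE)?)
    fix U V
    assume "openin (top_of_set ?S) {p \<in> ?S. ?q p \<in> U}" "openin (top_of_set ?S) {p \<in> ?S. ?q p \<in> V}"
    then have "openin (top_of_set ?S) ({p \<in> ?S. ?q p \<in> U} \<inter> {p \<in> ?S. ?q p \<in> V})"
      by (rule openin_Int)
    moreover have "{p \<in> ?S. ?q p \<in> U} \<inter> {p \<in> ?S. ?q p \<in> V} = {p \<in> ?S. ?q p \<in> U \<inter> V}"
      by blast
    ultimately show "openin (top_of_set ?S) {p \<in> ?S. ?q p \<in> U \<inter> V}"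
      by simp
  next
    fix K
    assume K: "\<forall>U\<in>K. U \<subseteq> ?q ` ?S \<and> openin (top_of_set ?S) {p \<in> ?S. ?q p \<in> U}"
    then have "openin (top_of_set ?S) (\<Union>U\<in>K. {p \<in> ?S. ?q p \<in> U})"
      by (intro openin_Union) blast
    moreover have "(\<Union>U\<in>K. {p \<in> ?S. ?q p \<in> U}) = {p \<in> ?S. ?q p \<in> \<Union>K}"
      by blast
    ultimately show "openin (top_of_set ?S) {p \<in> ?S. ?q p \<in> \<Union>K}"
      by simp
  qed blast+
  then show ?thesis
    unfolding nonorientable_surface_def by (simp add: topology_inverse')
qed

lemma topspace_nonorientable_surface:
  "topspace (nonorientable_surface k) = crosscap_class k ` holed_sphere k"
proof (rule antisym)
  show "topspace (nonorientable_surface k) \<subseteq> crosscap_class k ` holed_sphere k"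
    by (metis openin_topspace openin_nonorientable_surface)
  have "{p \<in> holed_sphere k. crosscap_class k p \<in> crosscap_class k ` holed_sphere k}
      = holed_sphere k"
    by blast
  then have "openin (nonorientable_surface k) (crosscap_class k ` holed_sphere k)"
    unfolding openin_nonorientable_surface by simp
  then show "crosscap_class k ` holed_sphere k \<subseteq> topspace (nonorientable_surface k)"
    by (rule openin_subset)
qed

lemma quotient_map_crosscap_class:
  "quotient_map (top_of_set (holed_sphere k)) (nonorientable_surface k) (crosscap_class k)"
  unfolding quotient_map_def topspace_nonorientable_surface openin_nonorientable_surface
  by simp


section \<open>Embeddings of graphs and the crosscap\<close>

text \<open>
  A simple undirected graph is given by its vertex set \<open>V\<close> and its set \<open>E\<close> of edges, which are
  two-element subsets of \<open>V\<close>.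
\<close>

definition graph_embeds_in :: "'a set \<Rightarrow> 'a set set \<Rightarrow> 'b topology \<Rightarrow> bool" where
  "graph_embeds_in V E X \<longleftrightarrow>
     (\<exists>(\<phi> :: 'a \<Rightarrow> 'b) (\<gamma> :: 'a set \<Rightarrow> real \<Rightarrow> 'b).
        inj_on \<phi> V \<and> \<phi> ` V \<subseteq> topspace X \<and>
        (\<forall>e\<in>E. pathin X (\<gamma> e) \<and> inj_on (\<gamma> e) {0..1} \<and> {\<gamma> e 0, \<gamma> e 1} = \<phi> ` e \<and>
               \<gamma> e ` {0<..<1} \<inter> \<phi> ` V = {}) \<and>
        (\<forall>e\<in>E. \<forall>e'\<in>E. e \<noteq> e' \<longrightarrow> \<gamma> e ` {0<..<1} \<inter> \<gamma> e' ` {0<..<1} = {}))"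

text \<open>The infimum is a minimum; it is \<open>\<infinity>\<close> for a graph that embeds in no \<open>N\<^sub>k\<close>.\<close>

definition crosscap :: "'a set \<Rightarrow> 'a set set \<Rightarrow> enat" where
  "crosscap V E = Inf {enat k | k. graph_embeds_in V E (nonorientable_surface k)}"


section \<open>Local rings and the upper ideal relation graph\<close>

definition local_ring :: "('a, 'm) ring_scheme \<Rightarrow> bool" where
  "local_ring R \<longleftrightarrow> ring R \<and> (\<exists>!M. maximalideal M R)"

definition uir_vertices :: "('a, 'm) ring_scheme \<Rightarrow> 'a set" where
  "uir_vertices R = carrier R - Units R"

definition uir_edges :: "('a, 'm) ring_scheme \<Rightarrow> 'a set set" where
  "uir_edges R = {{x, y} | x y.
     x \<in> uir_vertices R \<and> y \<in> uir_vertices R \<and> x \<noteq> y \<and>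
     (\<exists>z \<in> carrier R - Units R.
        Idl\<^bsub>R\<^esub> {x} \<subseteq> Idl\<^bsub>R\<^esub> {z} \<and> Idl\<^bsub>R\<^esub> {y} \<subseteq> Idl\<^bsub>R\<^esub> {z})}"

end

theory Submission
  imports Defs "HOL-Library.Z2" "HOL-Algebra.Multiplicative_Group"
begin

text \<open>
  Deleting a point embeds a graph drawn in the projective plane in a Moebius band, and hence in
  the Klein bottle, which is the quotient of the punctured complex plane by the map
  \<open>z \<mapsto> e * cnj z\<close>. Lift the edges of a drawing to paths \<open>p\<close>. If two edges do not meet and
  \<open>g\<close> is a deck transformation, then \<open>p s - g (q t)\<close> has no zero, so its argument has total change
  \<open>0\<close> along the boundary of the square of pairs \<open>(s, t)\<close>. Summed over many \<open>g\<close>, this gives a relation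
  modulo 2 between the windings of edges about vertices and the homology classes of edges; it is a van
  Kampen obstruction, and it needs no regularity of the drawing. It excludes the complete graph on seven
  vertices and two complete graphs on six vertices that share a triangle (with one more edge) from the
  Klein bottle, and two complete graphs on five vertices that share a vertex from the projective plane.

  A ring that is not local has an idempotent \<open>e\<close> other than \<open>0\<close> and \<open>1\<close>. If \<open>e\<close> or \<open>1 - e\<close> splits
  further, or if one of the two factors is not a field with five elements, then the graph contains
  one of the first two graphs above or is a subgraph of one graph on eight vertices, which has a drawing
  with straight edges in the projective plane. Otherwise the graph consists of two cliques on five
  vertices that share the vertex \<open>0\<close>, and each of them can be drawn on one half of the Klein bottle.
\<close>

section \<open>The change of argument along a path\<close>

text \<open>The edges of a drawing are arbitrary continuous arcs. Euler's formula would first need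
  faces, and a count of crossings would need general position; changes of argument exist for all
  paths that avoid a point, and this is what the relation is built from. The deck group is infinite,
  so the sum over it is cut off to a finite window of indices. Translates below the window are so
  close to the puncture that they contribute nothing, and above it they contribute only their
  winding about the puncture. The terms of the relation use windows that are shifted against each
  other, and the errors at the ends of the windows are exactly the products of homology classes. The
  number five has a geometric source: a complete graph on five vertices fits into a Moebius band
  with one vertex on the boundary, so two of them fit into the Klein bottle. For the complete graph
  on seven vertices no count of edges suffices, because its 21 edges meet the bound of three edges
  per vertex on the Klein bottle with equality.\<close>

definition arg_change :: "(real \<Rightarrow> complex) \<Rightarrow> real" where
  "arg_change c = (THE d. \<exists>g. continuous_on {0..1} g \<and> (\<forall>t\<in>{0..1}. c t = exp (g t)) \<and>
                              d = Im (g 1) - Im (g 0))"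

text \<open>Two continuous logarithms of \<open>c\<close> differ by an integer multiple of 2 pi i,
  and a continuous function on an interval with values in a discrete set is constant. So the
  description in the definition determines \<open>d\<close>.\<close>

lemma arg_change_eq:
  assumes g: "continuous_on {0..1} g" "\<And>t. t \<in> {0..1} \<Longrightarrow> c t = exp (g t)"
  shows "arg_change c = Im (g 1) - Im (g 0)"
  unfolding arg_change_def
proof (rule the_equality)
  show "\<exists>h. continuous_on {0..1} h \<and> (\<forall>t\<in>{0..1}. c t = exp (h t)) \<and>
      Im (g 1) - Im (g 0) = Im (h 1) - Im (h 0)"
    using g by blast
next
  fix d assume "\<exists>h. continuous_on {0..1} h \<and> (\<forall>t\<in>{0..1}. c t = exp (h t)) \<and>
      d = Im (h 1) - Im (h 0)"
  then obtain h where h: "continuous_on {0..1} h" "\<And>t. t \<in> {0..1} \<Longrightarrow> c t = exp (h t)"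
      "d = Im (h 1) - Im (h 0)" by blast
  let ?k = "\<lambda>t. (g t - h t) / (2 * of_real pi * \<i>)"
  have k: "\<exists>n::int. ?k t = of_int n" if "t \<in> {0..1}" for t
  proof -
    have "exp (g t) = exp (h t)" using g(2) h(2) that by metis
    then obtain n::int where "g t = h t + of_int (2 * n) * of_real pi * \<i>"
      unfolding exp_eq by (auto simp: mult_ac)
    then have "?k t = of_int n" by (simp add: field_simps)
    then show ?thesis ..
  qed
  have "(\<lambda>t. ?k t) constant_on {0..1::real}"
  proof (rule continuous_discrete_range_constant)
    show "connected {0..1::real}" by simp
    show "continuous_on {0..1} ?k"
      using g(1) h(1) by (intro continuous_intros) auto
    fix x :: real assume x: "x \<in> {0..1}"
    show "\<exists>e>0. \<forall>y. y \<in> {0..1} \<and> ?k y \<noteq> ?k x \<longrightarrow> e \<le> norm (?k y - ?k x)"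
    proof (intro exI[of _ 1] conjI allI impI)
      fix y assume y: "y \<in> {0..1} \<and> ?k y \<noteq> ?k x"
      obtain n l :: int where "?k x = of_int n" "?k y = of_int l" using k x y by meson
      moreover from this y have "l \<noteq> n" by auto
      ultimately show "1 \<le> norm (?k y - ?k x)"
        by (simp flip: of_int_diff add: norm_of_int)
    qed simp
  qed
  then have "?k 0 = ?k 1" unfolding constant_on_def by force
  then have "g 0 - h 0 = g 1 - h 1" by simp
  then have "Im (g 0) - Im (h 0) = Im (g 1) - Im (h 1)" by (metis minus_complex.sel(2))
  then show "d = Im (g 1) - Im (g 0)" using h(3) by simp
qed

lemma path_log:
  fixes c :: "real \<Rightarrow> complex"
  assumes "continuous_on {0..1} c" "\<And>t. t \<in> {0..1} \<Longrightarrow> c t \<noteq> 0"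
  obtains g where "continuous_on {0..1} g" "\<And>t. t \<in> {0..1} \<Longrightarrow> c t = exp (g t)"
  by (rule continuous_logarithm_on_contractible[of "{0..1}" c]) (use assms in \<open>auto intro: convex_imp_contractible\<close>)

lemma arg_change_cnj:
  assumes "continuous_on {0..1} c" "\<And>t. t \<in> {0..1} \<Longrightarrow> c t \<noteq> 0"
  shows "arg_change (\<lambda>t. cnj (c t)) = - arg_change c"
proof -
  obtain g where g: "continuous_on {0..1} g" "\<And>t. t \<in> {0..1} \<Longrightarrow> c t = exp (g t)"
    using path_log assms by metis
  have "arg_change (\<lambda>t. cnj (c t)) = Im (cnj (g 1)) - Im (cnj (g 0))"
    by (rule arg_change_eq[of "\<lambda>t. cnj (g t)"]) (use g in \<open>auto intro: continuous_intros simp: exp_cnj\<close>)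
  moreover have "arg_change c = Im (g 1) - Im (g 0)"
    by (rule arg_change_eq) (use g in auto)
  ultimately show ?thesis by simp
qed

text \<open>A factor with positive real part stays in the domain of the principal logarithm, so its
  contribution can be read off from the end points.\<close>

lemma arg_change_mult:
  assumes "continuous_on {0..1} c" "\<And>t. t \<in> {0..1} \<Longrightarrow> c t \<noteq> 0"
    and "continuous_on {0..1} u" "\<And>t. t \<in> {0..1} \<Longrightarrow> Re (u t) > 0"
  shows "arg_change (\<lambda>t. c t * u t) = arg_change c + Arg (u 1) - Arg (u 0)"
proof -
  obtain g where g: "continuous_on {0..1} g" "\<And>t. t \<in> {0..1} \<Longrightarrow> c t = exp (g t)"
    using path_log assms by metis
  have u: "u t \<noteq> 0" "u t \<notin> \<real>\<^sub>\<le>\<^sub>0" if "t \<in> {0..1}" for t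
    using assms(4)[OF that] by (auto simp: complex_nonpos_Reals_iff)
  have "arg_change (\<lambda>t. c t * u t) = Im (g 1 + Ln (u 1)) - Im (g 0 + Ln (u 0))"
    by (rule arg_change_eq[of "\<lambda>t. g t + Ln (u t)"])
      (use g u assms(3) in \<open>auto intro!: continuous_intros simp: exp_add\<close>)
  moreover have "arg_change c = Im (g 1) - Im (g 0)"
    by (rule arg_change_eq) (use g in auto)
  ultimately show ?thesis using u by (simp add: Arg_eq_Im_Ln)
qed

lemma arg_change_scale:
  assumes "continuous_on {0..1} c" "\<And>t. t \<in> {0..1} \<Longrightarrow> c t \<noteq> 0" and "k \<noteq> 0"
  shows "arg_change (\<lambda>t. k * c t) = arg_change c"
proof -
  obtain g where g: "continuous_on {0..1} g" "\<And>t. t \<in> {0..1} \<Longrightarrow> c t = exp (g t)"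
    using path_log assms by metis
  have "arg_change (\<lambda>t. k * c t) = Im (Ln k + g 1) - Im (Ln k + g 0)"
    by (rule arg_change_eq[of "\<lambda>t. Ln k + g t"])
      (use g assms(3) in \<open>auto intro!: continuous_intros simp: exp_add\<close>)
  moreover have "arg_change c = Im (g 1) - Im (g 0)"
    by (rule arg_change_eq) (use g in auto)
  ultimately show ?thesis by simp
qed

lemma arg_change_of_Re_pos:
  assumes "continuous_on {0..1} u" "\<And>t. t \<in> {0..1} \<Longrightarrow> Re (u t) > 0"
  shows "arg_change u = Arg (u 1) - Arg (u 0)"
proof -
  have "arg_change (\<lambda>t. 1) = 0"
    using arg_change_eq[of "\<lambda>t. 0" "\<lambda>t. 1"] by simp
  then show ?thesis
    using arg_change_mult[of "\<lambda>t. 1" u] assms by auto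
qed

lemma arg_change_int:
  assumes "continuous_on {0..1} c" "\<And>t. t \<in> {0..1} \<Longrightarrow> c t \<noteq> 0"
    and "c 0 = of_real r0 * cis a0" "c 1 = of_real r1 * cis a1" "r0 > 0" "r1 > 0"
  obtains n :: int where "arg_change c = a1 - a0 + 2 * pi * n"
proof -
  obtain g where g: "continuous_on {0..1} g" "\<And>t. t \<in> {0..1} \<Longrightarrow> c t = exp (g t)"
    using path_log assms by metis
  have *: "\<exists>n::int. Im z = a + 2 * pi * n" if "exp z = of_real r * cis a" "r > 0" for z r a
  proof -
    have "exp z = exp (of_real (ln r) + \<i> * of_real a)"
      using that by (simp add: exp_add cis_conv_exp exp_of_real mult_ac)
    then obtain n :: int where n: "z = of_real (ln r) + \<i> * of_real a + of_real (of_int (2 * n) * pi) * \<i>"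
      unfolding exp_eq by blast
    show ?thesis by (rule exI[of _ n], subst n) simp
  qed
  obtain n0 n1 :: int where "Im (g 0) = a0 + 2 * pi * n0" "Im (g 1) = a1 + 2 * pi * n1"
    using *[of "g 0" r0 a0] *[of "g 1" r1 a1] g(2)[of 0] g(2)[of 1] assms by auto
  then have "arg_change c = a1 - a0 + 2 * pi * of_int (n1 - n0)"
    using arg_change_eq[of g c] g by (simp add: algebra_simps)
  then show thesis by (rule that)
qed

text \<open>The square is contractible, so \<open>q t - p s\<close> has a continuous logarithm on
  all of it, and the changes along the four sides add up to zero. Reversing the sign of the
  difference shifts the logarithm by a constant and does not affect the changes.\<close>

lemma arg_change_square:
  assumes p: "continuous_on {0..1} p" and q: "continuous_on {0..1} q"
    and disj: "\<And>s t. s \<in> {0..1} \<Longrightarrow> t \<in> {0..1} \<Longrightarrow> p s \<noteq> q t"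
  shows "arg_change (\<lambda>t. q t - p 0) + arg_change (\<lambda>s. p s - q 1) =
         arg_change (\<lambda>t. q t - p 1) + arg_change (\<lambda>s. p s - q 0)"
proof -
  let ?S = "{0..1} \<times> {0..1} :: (real \<times> real) set"
  have "continuous_on ?S (\<lambda>z. q (snd z))"
    by (rule continuous_on_compose2[OF q]) (auto intro: continuous_on_snd continuous_on_id)
  moreover have "continuous_on ?S (\<lambda>z. p (fst z))"
    by (rule continuous_on_compose2[OF p]) (auto intro: continuous_on_fst continuous_on_id)
  ultimately have cont: "continuous_on ?S (\<lambda>z. q (snd z) - p (fst z))"
    by (rule continuous_on_diff)
  have contr: "contractible ?S" by (intro convex_imp_contractible convex_Times) auto
  have nz: "q (snd z) - p (fst z) \<noteq> 0" if "z \<in> ?S" for z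
    using disj[of "fst z" "snd z"] that by (auto simp: mem_Times_iff)
  obtain g where g: "continuous_on ?S g"
      "\<And>z. z \<in> ?S \<Longrightarrow> q (snd z) - p (fst z) = exp (g z)"
    by (rule continuous_logarithm_on_contractible[OF cont contr nz]) auto
  have gs: "continuous_on {0..1} (\<lambda>t. g (s, t))" if "s \<in> {0..1}" for s
    by (rule continuous_on_compose2[OF g(1)]) (use that in \<open>auto intro: continuous_intros\<close>)
  have gt: "continuous_on {0..1} (\<lambda>s. g (s, t))" if "t \<in> {0..1}" for t
    by (rule continuous_on_compose2[OF g(1)]) (use that in \<open>auto intro: continuous_intros\<close>)
  have 1: "arg_change (\<lambda>t. q t - p s) = Im (g (s, 1)) - Im (g (s, 0))" if "s \<in> {0..1}" for s
    by (rule arg_change_eq[of "\<lambda>t. g (s, t)"])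
      (use that gs g(2)[of "(s, _)"] in auto)
  have 2: "arg_change (\<lambda>s. p s - q t) = Im (g (1, t)) - Im (g (0, t))" if t: "t \<in> {0..1}" for t
  proof -
    have "arg_change (\<lambda>s. p s - q t) = Im (g (1, t) + \<i> * pi) - Im (g (0, t) + \<i> * pi)"
    proof (rule arg_change_eq[of "\<lambda>s. g (s, t) + \<i> * pi"])
      show "continuous_on {0..1} (\<lambda>s. g (s, t) + \<i> * complex_of_real pi)"
        using gt[OF t] by (intro continuous_intros)
      fix s :: real assume "s \<in> {0..1}"
      then have "exp (g (s, t)) = q t - p s" using g(2)[of "(s, t)"] t by auto
      then show "p s - q t = exp (g (s, t) + \<i> * complex_of_real pi)" by (simp add: exp_add)
    qed
    then show ?thesis by simp
  qed
  show ?thesis using 1[of 0] 1[of 1] 2[of 0] 2[of 1] by simp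
qed

section \<open>The parity relation for graphs drawn on the Klein bottle\<close>

text \<open>The iterate of index \<open>m\<close> of the generator of the deck group. Odd indices
  reverse the orientation, which is the source of the signs \<open>sg\<close>.\<close>

definition lift_act :: "int \<Rightarrow> complex \<Rightarrow> complex" where
  "lift_act m z = of_real (exp (of_int m)) * (if even m then z else cnj z)"

lemma lift_act_0 [simp]: "lift_act 0 z = z"
  by (simp add: lift_act_def)

lemma lift_act_add: "lift_act (m + n) z = lift_act m (lift_act n z)"
  by (simp add: lift_act_def exp_add)

lemma lift_act_eq_0 [simp]: "lift_act m z = 0 \<longleftrightarrow> z = 0"
  by (simp add: lift_act_def)

lemma lift_act_diff: "lift_act m (z - w) = lift_act m z - lift_act m w"
  by (simp add: lift_act_def algebra_simps)

lemma lift_act_inj [simp]: "lift_act m z = lift_act m w \<longleftrightarrow> z = w"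
  by (simp add: lift_act_def)

lemma norm_lift_act: "norm (lift_act m z) = exp (of_int m) * norm z"
  by (simp add: lift_act_def norm_mult)

lemma continuous_on_lift_act [continuous_intros]:
  "continuous_on S f \<Longrightarrow> continuous_on S (\<lambda>x. lift_act m (f x))"
  unfolding lift_act_def by (cases "even m") (auto intro!: continuous_intros)

definition sg :: "int \<Rightarrow> real" where "sg m = (if even m then 1 else - 1)"

lemma sg_add: "sg (m + n) = sg m * sg n" and sg_sq [simp]: "sg m * sg m = 1" and
  sg_0 [simp]: "sg 0 = 1" and sg_minus [simp]: "sg (- m) = sg m"
  by (auto simp: sg_def)

lemma lift_act_cis: "lift_act m (of_real r * cis a) = of_real (exp (of_int m) * r) * cis (sg m * a)"
  by (simp add: lift_act_def sg_def cis_cnj)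

lemma arg_change_lift_act:
  assumes "continuous_on {0..1} c" "\<And>t. t \<in> {0..1} \<Longrightarrow> c t \<noteq> 0"
  shows "arg_change (\<lambda>t. lift_act m (c t)) = sg m * arg_change c"
proof -
  have "arg_change (\<lambda>t. of_real (exp (of_int m)) * cnj (c t)) = - arg_change c"
    using arg_change_scale[of "\<lambda>t. cnj (c t)" "of_real (exp (of_int m))"] arg_change_cnj[of c] assms
    by (auto intro!: continuous_intros)
  then show ?thesis
    using arg_change_scale[OF assms, of "of_real (exp (of_int m))"]
    by (auto simp: lift_act_def sg_def)
qed

text \<open>Factor out the dominant term. The remaining factor \<open>1 - z / c t\<close> has
  positive real part, so moving the base point from 0 to \<open>z\<close> costs only two end terms.
  The same end terms are built into \<open>angle\<close>, which makes them cancel in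
  \<open>turn_far\<close>.\<close>

lemma arg_change_minus_small:
  assumes c: "continuous_on {0..1} c" and z: "\<And>t. t \<in> {0..1} \<Longrightarrow> norm z < norm (c t)"
  shows "arg_change (\<lambda>t. c t - z) = arg_change c + Arg (1 - z / c 1) - Arg (1 - z / c 0)"
proof -
  have nz: "c t \<noteq> 0" if "t \<in> {0..1}" for t using z[OF that] by auto
  have "Re (1 - z / c t) > 0" if "t \<in> {0..1}" for t
  proof -
    have "norm (z / c t) < 1" using z[OF that] by (simp add: norm_divide divide_less_eq)
    then show ?thesis using complex_Re_le_cmod[of "z / c t"] by simp
  qed
  moreover have "continuous_on {0..1} (\<lambda>t. 1 - z / c t)"
    using c nz by (intro continuous_intros) auto
  ultimately have "arg_change (\<lambda>t. c t * (1 - z / c t)) =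
      arg_change c + Arg (1 - z / c 1) - Arg (1 - z / c 0)"
    using c nz by (intro arg_change_mult) auto
  moreover have "arg_change (\<lambda>t. c t * (1 - z / c t)) = arg_change (\<lambda>t. c t - z)"
    unfolding arg_change_def using nz by (simp add: algebra_simps)
  ultimately show ?thesis by simp
qed

lemma arg_change_minus_large:
  assumes c: "continuous_on {0..1} c" and z: "\<And>t. t \<in> {0..1} \<Longrightarrow> norm (c t) < norm z"
  shows "arg_change (\<lambda>t. c t - z) = Arg (1 - c 1 / z) - Arg (1 - c 0 / z)"
proof -
  have nz: "z \<noteq> 0" using z[of 0] by auto
  have pos: "Re (1 - c t / z) > 0" if "t \<in> {0..1}" for t
  proof -
    have "norm (c t / z) < 1" using z[OF that] nz by (simp add: norm_divide divide_less_eq)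
    then show ?thesis using complex_Re_le_cmod[of "c t / z"] by simp
  qed
  moreover have cont: "continuous_on {0..1} (\<lambda>t. 1 - c t / z)"
    using c nz by (intro continuous_intros) auto
  ultimately have "arg_change (\<lambda>t. 1 - c t / z) = Arg (1 - c 1 / z) - Arg (1 - c 0 / z)"
    by (intro arg_change_of_Re_pos) auto
  moreover have "arg_change (\<lambda>t. - z * (1 - c t / z)) = arg_change (\<lambda>t. 1 - c t / z)"
    using nz pos cont by (intro arg_change_scale) force+
  moreover have "(\<lambda>t. - z * (1 - c t / z)) = (\<lambda>t. c t - z)" using nz by (auto simp: field_simps)
  ultimately show ?thesis by simp
qed

text \<open>A shift of the window by one index drops a term at the lower end, where \<open>h\<close>
  vanishes, and gains one at the upper end, where \<open>h\<close> agrees with \<open>u\<close>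
  modulo 2. A shift by \<open>j\<close> therefore telescopes to a difference of the discrete
  antiderivative \<open>U\<close> of \<open>u\<close>.\<close>

lemma shifted_sum:
  fixes h u :: "int \<Rightarrow> int"
  assumes low: "\<And>i. i \<le> - L \<Longrightarrow> h i = 0" and high: "\<And>i. i \<ge> L \<Longrightarrow> even (h i - u i)"
    and L: "L \<ge> 0" and K: "K \<ge> L + J + 1" and j: "\<bar>j\<bar> \<le> J"
    and U: "\<And>i. i \<ge> K - J \<Longrightarrow> even (U (i + 1) - U i - u (i + 1))"
  shows "even ((\<Sum>i=-K..K. h (i + j)) - (\<Sum>i=-K..K. h i) - (U (K + j) - U K))"
proof -
  have one: "even ((\<Sum>i=-K..K. h (i + (l + 1))) - (\<Sum>i=-K..K. h (i + l)) - (U (K + (l + 1)) - U (K + l)))"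
    if l: "- J \<le> l" "l + 1 \<le> J" for l
  proof -
    have "(\<Sum>i=-K..K. h (i + (l + 1))) = (\<Sum>i=-K+1..K+1. h (i + l))"
      by (rule sum.reindex_bij_witness[of _ "\<lambda>i. i - 1" "\<lambda>i. i + 1"]) (auto simp: algebra_simps)
    moreover have "{-K..K+1} = insert (-K) {-K+1..K+1}" "{-K..K+1} = insert (K+1) {-K..K}"
      using K l L by auto
    then have "h (-K + l) + (\<Sum>i=-K+1..K+1. h (i + l)) = h (K+1+l) + (\<Sum>i=-K..K. h (i + l))"
      using sum.insert[of "{-K+1..K+1}" "-K" "\<lambda>i. h (i + l)"] sum.insert[of "{-K..K}" "K+1" "\<lambda>i. h (i + l)"]
      by simp
    moreover have "h (-K + l) = 0" using K l by (intro low) auto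
    moreover have "even (h (K + 1 + l) - u (K + 1 + l))" using K l by (intro high) auto
    moreover have "even (U (K + l + 1) - U (K + l) - u (K + l + 1))" using l by (intro U) auto
    ultimately show ?thesis by (simp add: algebra_simps)
  qed
  show ?thesis
  proof (cases "j \<ge> 0")
    case True
    then show ?thesis using j
    proof (induction j rule: int_ge_induct)
      case base then show ?case by simp
    next
      case (step i)
      then show ?case using one[of i] by simp presburger
    qed
  next
    case False
    then have "j \<le> 0" by simp
    then show ?thesis using j
    proof (induction j rule: int_le_induct)
      case base then show ?case by simp
    next
      case (step i)
      then show ?case using one[of "i - 1"] by simp presburger
    qed
  qed
qed

definition indep :: "'v \<times> 'v \<Rightarrow> 'v \<times> 'v \<Rightarrow> bool" where
  "indep e f \<longleftrightarrow> {fst e, snd e} \<inter> {fst f, snd f} = {}"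

lemma indep_sym: "indep e f \<Longrightarrow> indep f e"
  by (auto simp: indep_def)

text \<open>The linear algebra at the end of \<open>parity_relation\<close>, with a variable for
  each window sum. The sum of all hypotheses differs from the conclusion by an even number, which is
  added explicitly.\<close>

lemma even_combination:
  fixes na :: int
  assumes "even (na + B + C + D + pad + tac + pbd + pbc)" "even (B - nb - x)" "even (C - nc)" "even (D - nd - y)"
    "even (pad - tad - h1)" "even (pbd - tbd - h2 - m)" "even (pbc - tbc - h3 - m)" "even (h1 + h2 + h3 + z)"
    "even (uac + uca - tac - oac)" "even (uad + uda - tad - oad)" "even (ubc + ucb - tbc - obc)" "even (ubd + udb - tbd - obd)"
  shows "even (na + uac + uad + (nb + ubc + ubd) + (nc + uca + ucb) + (nd + uda + udb) + oac + oad + obc + obd + z - x - y)"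
    (is "even ?t")
proof -
  let ?s = "(na + B + C + D + pad + tac + pbd + pbc) + (B - nb - x) + (C - nc) + (D - nd - y) + (pad - tad - h1) +
    (pbd - tbd - h2 - m) + (pbc - tbc - h3 - m) + (h1 + h2 + h3 + z) + (uac + uca - tac - oac) + (uad + uda - tad - oad) +
    (ubc + ucb - tbc - obc) + (ubd + udb - tbd - obd)"
  have "even ?s" by (intro dvd_add assms)
  then have "even (?s + 2 * (nb + nc + nd - B - C - D - pad - pbd - pbc + m + tad + tbd + tbc + oac + oad + obc + obd))"
    by (rule dvd_add) simp
  moreover have "?s + 2 * (nb + nc + nd - B - C - D - pad - pbd - pbc + m + tad + tbd + tbc + oac + oad + obc + obd) = ?t"
    by (simp add: algebra_simps)
  ultimately show ?thesis by metis
qed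

text \<open>One lift to the punctured plane is chosen for each vertex and, starting there, for each
  edge. \<open>m\<close> is the index of the deck transformation that takes the chosen lift of the
  second end to the actual end of the lifted edge. Disjointness in the quotient becomes disjointness
  from all translates.\<close>

locale lifted_drawing =
  fixes E :: "('v::linorder \<times> 'v) set"
    and vh :: "'v \<Rightarrow> complex"
    and p :: "'v \<times> 'v \<Rightarrow> real \<Rightarrow> complex"
    and m :: "'v \<times> 'v \<Rightarrow> int"
  assumes finite_E: "finite E"
    and vh_nz: "vh v \<noteq> 0"
    and cont: "e \<in> E \<Longrightarrow> continuous_on {0..1} (p e)"
    and nz: "e \<in> E \<Longrightarrow> t \<in> {0..1} \<Longrightarrow> p e t \<noteq> 0"
    and start: "e \<in> E \<Longrightarrow> p e 0 = vh (fst e)"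
    and fin: "e \<in> E \<Longrightarrow> p e 1 = lift_act (m e) (vh (snd e))"
    and disj: "e \<in> E \<Longrightarrow> f \<in> E \<Longrightarrow> indep e f \<Longrightarrow> s \<in> {0..1} \<Longrightarrow> t \<in> {0..1}
                 \<Longrightarrow> p e s \<noteq> lift_act j (p f t)"
begin

text \<open>A lifted vertex is a pair of a vertex and the index of a deck transformation.\<close>

definition pos :: "'v \<times> int \<Rightarrow> complex" where
  "pos z = lift_act (snd z) (vh (fst z))"

text \<open>This decides which of the two points dominates their difference. Ties are broken by the
  vertices because a deck transformation keeps them, so the relation is invariant under
  shifts.\<close>

definition before :: "'v \<times> int \<Rightarrow> 'v \<times> int \<Rightarrow> bool" where
  "before z w \<longleftrightarrow> norm (pos z) < norm (pos w) \<or> norm (pos z) = norm (pos w) \<and> fst z < fst w"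

definition angle0 :: "'v \<times> int \<Rightarrow> real" where
  "angle0 z = sg (snd z) * Arg (vh (fst z))"

text \<open>
  An argument of \<open>pos w - pos z\<close>. It is chosen so that a deck transformation of odd index
  changes its sign and one of even index does not change it.
\<close>

definition angle :: "'v \<times> int \<Rightarrow> 'v \<times> int \<Rightarrow> real" where
  "angle z w = (if before z w then angle0 w + Arg (1 - pos z / pos w)
                else angle0 z + sg (snd z) * pi + Arg (1 - pos w / pos z))"

definition shift :: "int \<Rightarrow> 'v \<times> int \<Rightarrow> 'v \<times> int" where
  "shift j z = (fst z, snd z + j)"

lemma pos_nz [simp]: "pos z \<noteq> 0"
  by (simp add: pos_def vh_nz)

lemma pos_shift: "pos (shift j z) = lift_act j (pos z)"
  by (simp add: pos_def shift_def lift_act_add add.commute)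

lemma before_shift [simp]: "before (shift j z) (shift j w) = before z w"
  unfolding before_def pos_shift norm_lift_act by (simp add: shift_def)

lemma before_swap: "fst z \<noteq> fst w \<Longrightarrow> before w z \<longleftrightarrow> \<not> before z w"
  unfolding before_def by (auto simp: not_less)

lemma pos_polar: "pos z = of_real (norm (pos z)) * cis (angle0 z)"
proof -
  have "vh (fst z) = of_real (norm (vh (fst z))) * cis (Arg (vh (fst z)))"
    using vh_nz by (metis Arg_eq is_Arg_def cis_conv_exp)
  then show ?thesis
    unfolding angle0_def by (metis lift_act_cis norm_lift_act pos_def)
qed

text \<open>Equal norms do no harm: a point of the closed unit disc other than 1 has real part below
  1.\<close>

lemma before_Re:
  assumes "before z w \<or> norm (pos z) \<le> norm (pos w)" "pos z \<noteq> pos w"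
  shows "Re (1 - pos z / pos w) > 0"
proof -
  let ?q = "pos z / pos w"
  have n: "norm ?q \<le> 1" using assms(1) by (auto simp: norm_divide before_def)
  have "Re ?q \<noteq> 1"
  proof
    assume R: "Re ?q = 1"
    have "(norm ?q)\<^sup>2 = (Re ?q)\<^sup>2 + (Im ?q)\<^sup>2" by (rule cmod_power2)
    moreover have "(norm ?q)\<^sup>2 \<le> 1" using n by (simp add: power_le_one)
    ultimately have "Im ?q = 0" using R by simp
    then have "?q = 1" using R by (simp add: complex_eq_iff)
    then show False using assms(2) by simp
  qed
  then show ?thesis using n complex_Re_le_cmod[of ?q] by simp
qed

lemma angle_polar:
  assumes "pos z \<noteq> pos w"
  shows "pos w - pos z = of_real (norm (pos w - pos z)) * cis (angle z w)"
proof -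
  have Arg: "u = of_real (norm u) * cis (Arg u)" if "u \<noteq> 0" for u
    using that by (metis Arg_eq is_Arg_def cis_conv_exp)
  have polar: "pos w - pos z = of_real (norm (pos w - pos z)) * cis (angle0 w + Arg (1 - pos z / pos w))"
    if "pos z \<noteq> pos w" for z w
  proof -
    have "pos w - pos z = pos w * (1 - pos z / pos w)" by (simp add: field_simps)
    also have "\<dots> = (of_real (norm (pos w)) * cis (angle0 w)) *
        (of_real (norm (1 - pos z / pos w)) * cis (Arg (1 - pos z / pos w)))"
      using that Arg[of "1 - pos z / pos w"] pos_polar[of w] by simp
    also have "\<dots> = of_real (norm (pos w) * norm (1 - pos z / pos w)) *
        cis (angle0 w + Arg (1 - pos z / pos w))"
      by (simp add: cis_mult[symmetric])
    also have "norm (pos w) * norm (1 - pos z / pos w) = norm (pos w - pos z)"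
      by (simp add: norm_mult[symmetric] algebra_simps)
    finally show ?thesis .
  qed
  show ?thesis
  proof (cases "before z w")
    case True
    then show ?thesis using polar[OF assms] by (simp add: angle_def)
  next
    case False
    have "cis (sg j * pi) = -1" for j by (simp add: sg_def complex_eq_iff)
    then have "cis (angle z w) = - cis (angle0 z + Arg (1 - pos w / pos z))"
      using False by (simp add: angle_def flip: cis_mult)
    moreover have "pos w - pos z = - (pos z - pos w)" by simp
    moreover have "pos z - pos w = of_real (norm (pos z - pos w)) * cis (angle0 z + Arg (1 - pos w / pos z))"
      using polar[of w z] assms by metis
    moreover have "norm (pos z - pos w) = norm (pos w - pos z)" by (rule norm_minus_commute)
    ultimately show ?thesis by (metis mult_minus_right)
  qed
qed

lemma angle0_shift: "angle0 (shift j z) = sg j * angle0 z"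
  by (simp add: angle0_def shift_def sg_add)

lemma angle_shift:
  assumes "pos z \<noteq> pos w"
  shows "angle (shift j z) (shift j w) = sg j * angle z w"
proof -
  have q: "pos (shift j z) / pos (shift j w) = (if even j then pos z / pos w else cnj (pos z / pos w))"
    for z w by (simp add: pos_shift lift_act_def)
  have A: "Arg (1 - pos (shift j z) / pos (shift j w)) = sg j * Arg (1 - pos z / pos w)"
    if "Re (1 - pos z / pos w) > 0" for z w
  proof (cases "even j")
    case True then show ?thesis by (simp add: q sg_def)
  next
    case False
    have "1 - pos z / pos w \<notin> \<real>\<^sub>\<le>\<^sub>0" using that by (auto simp: complex_nonpos_Reals_iff)
    then have "Im (cnj (Ln (1 - pos z / pos w))) = Im (Ln (cnj (1 - pos z / pos w)))"
      using cnj_Ln by metis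
    moreover have "1 - pos z / pos w \<noteq> 0" using that by auto
    ultimately have "Arg (cnj (1 - pos z / pos w)) = - Arg (1 - pos z / pos w)"
      by (metis Arg_eq_Im_Ln cnj.sel(2) complex_cnj_zero_iff)
    then show ?thesis using False by (simp add: q sg_def)
  qed
  show ?thesis
  proof (cases "before z w")
    case True
    then show ?thesis
      using A[OF before_Re] assms by (simp add: angle_def angle0_shift algebra_simps)
  next
    case False
    then have "norm (pos w) \<le> norm (pos z)" by (auto simp: before_def)
    then have "Arg (1 - pos (shift j w) / pos (shift j z)) = sg j * Arg (1 - pos w / pos z)"
      using A[OF before_Re] assms by metis
    moreover have "sg (snd (shift j z)) = sg j * sg (snd z)" by (simp add: shift_def sg_add)
    ultimately show ?thesis
      using False by (simp add: angle_def angle0_shift algebra_simps)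
  qed
qed

text \<open>Arguments of opposite vectors differ by an odd multiple of pi. By
  \<open>angle_swap\<close>, \<open>kap\<close> records which of pi and - pi the chosen arguments
  give.\<close>

definition kap :: "'v \<times> int \<Rightarrow> 'v \<times> int \<Rightarrow> int" where
  "kap z w = (if before z w then of_bool (even (snd w)) else of_bool (odd (snd z)))"

lemma angle_swap: "fst z \<noteq> fst w \<Longrightarrow> angle z w - angle w z = pi * (1 - 2 * of_int (kap z w))"
  by (auto simp: angle_def before_swap[of z w] kap_def sg_def)

lemma kap_swap: "fst z \<noteq> fst w \<Longrightarrow> kap z w + kap w z = 1"
  by (auto simp: kap_def before_swap[of z w])

text \<open>An odd deck transformation reverses the orientation and so exchanges the cases pi and -
  pi.\<close>

lemma kap_shift: "even (kap (shift j z) (shift j w) - kap z w - j)"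
  by (auto simp: kap_def) (auto simp: shift_def)

section \<open>Turning numbers of edges about vertices and about the puncture\<close>

definition avoids :: "'v \<Rightarrow> 'v \<times> 'v \<Rightarrow> bool" where
  "avoids v f \<longleftrightarrow> (\<forall>t\<in>{0..1}. \<forall>j. vh v \<noteq> lift_act j (p f t))"

lemma avoids_pos: "avoids v f \<Longrightarrow> t \<in> {0..1} \<Longrightarrow> pos (v, k) \<noteq> lift_act j (p f t)"
  unfolding avoids_def pos_def
  by (metis add.right_neutral diff_add_cancel fst_conv lift_act_add lift_act_inj snd_conv
      add.commute)

lemma indep_avoids:
  assumes "e \<in> E" "f \<in> E" "indep e f"
  shows "avoids (fst e) f" "avoids (snd e) f" "avoids (fst f) e" "avoids (snd f) e"
proof -
  have *: "avoids (fst e) f \<and> avoids (snd e) f" if "e \<in> E" "f \<in> E" "indep e f" for e f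
  proof -
    have 1: "p e 0 \<noteq> lift_act j (p f t)" if "t \<in> {0..1}" for t j
      using disj[of e f 0 t j] \<open>e \<in> E\<close> \<open>f \<in> E\<close> \<open>indep e f\<close> that by auto
    have 2: "p e 1 \<noteq> lift_act (m e + j) (p f t)" if "t \<in> {0..1}" for t j
      using disj[of e f 1 t "m e + j"] \<open>e \<in> E\<close> \<open>f \<in> E\<close> \<open>indep e f\<close> that by auto
    show ?thesis
      using 1 2 start fin \<open>e \<in> E\<close> unfolding avoids_def lift_act_add by (metis lift_act_inj)
  qed
  show "avoids (fst e) f" "avoids (snd e) f" "avoids (fst f) e" "avoids (snd f) e"
    using *[OF assms] *[OF assms(2,1) indep_sym[OF assms(3)]] by blast+
qed

lemma p_0: "f \<in> E \<Longrightarrow> lift_act j (p f 0) = pos (fst f, j)"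
  by (simp add: pos_def start)

lemma p_1: "f \<in> E \<Longrightarrow> lift_act j (p f 1) = pos (snd f, m f + j)"
  by (simp add: pos_def fin add.commute flip: lift_act_add)

text \<open>The whole turns of a translate of the edge about the vertex, relative to the chosen
  arguments at the ends. If the edge avoids the vertex, the floor is taken of an integer, by
  \<open>arg_change_turn\<close>.\<close>

definition turn :: "'v \<Rightarrow> 'v \<times> 'v \<Rightarrow> int \<Rightarrow> int" where
  "turn v f j = \<lfloor>(arg_change (\<lambda>t. lift_act j (p f t) - vh v)
     - angle (v, 0) (snd f, m f + j) + angle (v, 0) (fst f, j)) / (2 * pi)\<rfloor>"

definition wind :: "'v \<times> 'v \<Rightarrow> int" where
  "wind f = \<lfloor>(arg_change (p f) - angle0 (snd f, m f) + angle0 (fst f, 0)) / (2 * pi)\<rfloor>"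

lemma arg_change_turn:
  assumes f: "f \<in> E" "avoids v f"
  shows "arg_change (\<lambda>t. lift_act j (p f t) - vh v) =
    angle (v, 0) (snd f, m f + j) - angle (v, 0) (fst f, j) + 2 * pi * turn v f j"
proof -
  let ?c = "\<lambda>t. lift_act j (p f t) - vh v"
  have v: "vh v = pos (v, 0)" by (simp add: pos_def)
  have nzc: "?c t \<noteq> 0" if "t \<in> {0..1}" for t
    using avoids_pos[OF f(2) that, of 0 j] v by simp
  have c01: "?c 0 = pos (fst f, j) - pos (v, 0)" "?c 1 = pos (snd f, m f + j) - pos (v, 0)"
    using f p_0 p_1 v by auto
  then have ne: "pos (v, 0) \<noteq> pos (fst f, j)" "pos (v, 0) \<noteq> pos (snd f, m f + j)"
    using nzc[of 0] nzc[of 1] by auto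
  obtain n :: int where "arg_change ?c =
      angle (v, 0) (snd f, m f + j) - angle (v, 0) (fst f, j) + 2 * pi * n"
  proof (rule arg_change_int[of ?c])
    show "continuous_on {0..1} ?c" using cont f by (intro continuous_intros)
    show "?c 0 = of_real (norm (pos (fst f, j) - pos (v, 0))) * cis (angle (v, 0) (fst f, j))"
      using angle_polar[OF ne(1)] c01 by simp
    show "?c 1 = of_real (norm (pos (snd f, m f + j) - pos (v, 0))) * cis (angle (v, 0) (snd f, m f + j))"
      using angle_polar[OF ne(2)] c01 by simp
  qed (use nzc ne in auto)
  then show ?thesis by (simp add: turn_def field_simps)
qed

lemma arg_change_wind:
  assumes f: "f \<in> E"
  shows "arg_change (p f) = angle0 (snd f, m f) - angle0 (fst f, 0) + 2 * pi * wind f"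
proof -
  obtain n :: int where "arg_change (p f) = angle0 (snd f, m f) - angle0 (fst f, 0) + 2 * pi * n"
  proof (rule arg_change_int[of "p f"])
    show "p f 0 = of_real (norm (pos (fst f, 0))) * cis (angle0 (fst f, 0))"
      using p_0[OF f, of 0] pos_polar by simp
    show "p f 1 = of_real (norm (pos (snd f, m f))) * cis (angle0 (snd f, m f))"
      using p_1[OF f, of 0] pos_polar by simp
  qed (use cont nz f in auto)
  then show ?thesis by (simp add: wind_def field_simps)
qed

text \<open>A deck transformation moves the vertex to index 0 and multiplies changes of argument and
  chosen angles by the same sign. Modulo 2 the sign disappears, so only the difference of the two
  indices matters.\<close>

lemma arg_change_turn_shift:
  assumes f: "f \<in> E" "avoids v f"
  shows "arg_change (\<lambda>t. lift_act i (p f t) - pos (v, k)) =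
    angle (v, k) (snd f, m f + i) - angle (v, k) (fst f, i) + 2 * pi * (sg k * turn v f (i - k))"
proof -
  let ?c = "\<lambda>t. lift_act (i - k) (p f t) - vh v"
  have *: "lift_act i (p f t) - pos (v, k) = lift_act k (?c t)" for t
    by (simp add: lift_act_diff pos_def flip: lift_act_add)
  have nzc: "?c t \<noteq> 0" if "t \<in> {0..1}" for t
    using avoids_pos[OF f(2) that, of 0 "i - k"] by (simp add: pos_def)
  have ang: "angle (v, k) (w, l) = sg k * angle (v, 0) (w, l - k)" if "pos (v, 0) \<noteq> pos (w, l - k)" for w l
    using angle_shift[OF that, of k] by (simp add: shift_def)
  have "arg_change (\<lambda>t. lift_act k (?c t)) = sg k * arg_change ?c"
    using cont f nzc by (intro arg_change_lift_act continuous_intros) auto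
  also have "\<dots> = sg k * (angle (v, 0) (snd f, m f + (i - k)) - angle (v, 0) (fst f, i - k)
      + 2 * pi * turn v f (i - k))"
    using arg_change_turn[OF f] by simp
  finally show ?thesis
    using ang[of "snd f" "m f + i"] ang[of "fst f" i] avoids_pos[OF f(2), of 0 0 "i - k"]
      avoids_pos[OF f(2), of 1 0 "i - k"] p_0[OF f(1)] p_1[OF f(1)]
    unfolding * by (simp add: algebra_simps)
qed

text \<open>This is \<open>arg_change_square\<close> for \<open>e\<close> and the translate of
  \<open>f\<close> with index \<open>i\<close>, divided by 2 pi. At each pair of ends two angles
  between the same points combine to a value of \<open>kap\<close>, and all signs are dropped modulo
  2.\<close>

lemma relation:
  assumes e: "e \<in> E" and f: "f \<in> E" and ind: "indep e f"
    and "a = fst e" "b = snd e" "c = fst f" "d = snd f"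
  shows "even (turn a f i + turn b f (i - m e) + turn c e (- i) + turn d e (- (m f + i))
    + kap (a, 0) (d, m f + i) + kap (a, 0) (c, i) + kap (b, m e) (d, m f + i) + kap (b, m e) (c, i))"
    (is "even ?R")
proof -
  note av = indep_avoids[OF e f ind]
  have ne: "a \<noteq> c" "a \<noteq> d" "b \<noteq> c" "b \<noteq> d" using ind assms by (auto simp: indep_def)
  have e0: "p e 0 = pos (a, 0)" "p e 1 = pos (b, m e)"
    using p_0[OF e, of 0] p_1[OF e, of 0] assms by auto
  have f0: "lift_act i (p f 0) = pos (c, i)" "lift_act i (p f 1) = pos (d, m f + i)"
    using p_0[OF f, of i] p_1[OF f, of i] assms by auto
  have sq: "arg_change (\<lambda>t. lift_act i (p f t) - pos (a, 0)) + arg_change (\<lambda>s. p e s - pos (d, m f + i)) =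
      arg_change (\<lambda>t. lift_act i (p f t) - pos (b, m e)) + arg_change (\<lambda>s. p e s - pos (c, i))"
    unfolding e0[symmetric] f0[symmetric]
    by (rule arg_change_square[OF cont[OF e] continuous_on_lift_act[OF cont[OF f]] disj[OF e f ind]])
  have t1: "arg_change (\<lambda>t. lift_act i (p f t) - pos (a, 0)) =
      angle (a, 0) (d, m f + i) - angle (a, 0) (c, i) + 2 * pi * turn a f i"
    using arg_change_turn_shift[OF f av(1), of i 0] assms by simp
  have t2: "arg_change (\<lambda>t. p e t - pos (d, m f + i)) =
      angle (d, m f + i) (b, m e) - angle (d, m f + i) (a, 0) + 2 * pi * (sg (m f + i) * turn d e (- (m f + i)))"
    using arg_change_turn_shift[OF e av(4), of 0 "m f + i"] assms by simp
  have t3: "arg_change (\<lambda>t. lift_act i (p f t) - pos (b, m e)) =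
      angle (b, m e) (d, m f + i) - angle (b, m e) (c, i) + 2 * pi * (sg (m e) * turn b f (i - m e))"
    using arg_change_turn_shift[OF f av(2), of i "m e"] assms by simp
  have t4: "arg_change (\<lambda>t. p e t - pos (c, i)) =
      angle (c, i) (b, m e) - angle (c, i) (a, 0) + 2 * pi * (sg i * turn c e (- i))"
    using arg_change_turn_shift[OF e av(3), of 0 i] assms by simp
  have k: "angle (a, 0) (d, m f + i) - angle (d, m f + i) (a, 0) = pi * (1 - 2 * kap (a, 0) (d, m f + i))"
    "angle (a, 0) (c, i) - angle (c, i) (a, 0) = pi * (1 - 2 * kap (a, 0) (c, i))"
    "angle (b, m e) (d, m f + i) - angle (d, m f + i) (b, m e) = pi * (1 - 2 * kap (b, m e) (d, m f + i))"
    "angle (b, m e) (c, i) - angle (c, i) (b, m e) = pi * (1 - 2 * kap (b, m e) (c, i))"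
    using ne by (auto intro!: angle_swap)
  define s :: "int \<Rightarrow> int" where "s j = (if even j then 1 else - 1)" for j
  have sg: "sg j = s j" for j by (simp add: sg_def s_def)
  have "2 * pi * (turn a f i + s (m f + i) * turn d e (- (m f + i)) - s (m e) * turn b f (i - m e)
      - s i * turn c e (- i) - kap (a, 0) (d, m f + i) + kap (a, 0) (c, i)
      + kap (b, m e) (d, m f + i) - kap (b, m e) (c, i)) = 0"
    using sq t1 t2 t3 t4 k unfolding sg by (simp add: algebra_simps)
  then have "turn a f i + s (m f + i) * turn d e (- (m f + i)) - s (m e) * turn b f (i - m e)
      - s i * turn c e (- i) - kap (a, 0) (d, m f + i) + kap (a, 0) (c, i)
      + kap (b, m e) (d, m f + i) - kap (b, m e) (c, i) = 0" (is "?Z = 0")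
    using pi_gt_zero by (metis mult_eq_0_iff of_int_eq_0_iff less_irrefl zero_neq_numeral)
  then have "even ?Z" by simp
  moreover have s: "even (s j * x) = even x" for j x by (simp add: s_def)
  ultimately show ?thesis by (simp add: s del: even_mult_iff) satx
qed

section \<open>Translates far away from the puncture or close to it\<close>

definition ends :: "'v set" where
  "ends = fst ` E \<union> snd ` E"

text \<open>By compactness the norms on all edges and at all vertices lie between two positive
  bounds, and the deck transformation of index \<open>i\<close> multiplies norms by
  \<open>exp i\<close>.\<close>

lemma norm_bounds:
  obtains L :: int where "L \<ge> 0"
    "\<And>i v f t. i \<ge> L \<Longrightarrow> v \<in> ends \<Longrightarrow> f \<in> E \<Longrightarrow> t \<in> {0..1} \<Longrightarrow> norm (vh v) < norm (lift_act i (p f t))"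
    "\<And>i v f t. i \<le> - L \<Longrightarrow> v \<in> ends \<Longrightarrow> f \<in> E \<Longrightarrow> t \<in> {0..1} \<Longrightarrow> norm (lift_act i (p f t)) < norm (vh v)"
    "\<And>i v w. i \<ge> L \<Longrightarrow> v \<in> ends \<Longrightarrow> w \<in> ends \<Longrightarrow> norm (vh v) < norm (pos (w, i))"
    "\<And>i v w. i \<le> - L \<Longrightarrow> v \<in> ends \<Longrightarrow> w \<in> ends \<Longrightarrow> norm (pos (w, i)) < norm (vh v)"
proof -
  define C where "C = (\<Union>f\<in>E. (\<lambda>t. norm (p f t)) ` {0..1}) \<union> (\<lambda>v. norm (vh v)) ` ends"
  have fin: "finite ends" using finite_E by (simp add: ends_def)
  have "compact C"
    unfolding C_def
    by (intro compact_Un compact_UN finite_E compact_continuous_image continuous_on_norm cont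
        finite_imp_compact finite_imageI fin compact_Icc)
  have C0: "x > 0" if "x \<in> C" for x using that nz vh_nz unfolding C_def by auto
  obtain R where R: "\<And>x. x \<in> C \<Longrightarrow> x \<le> R"
    using bounded_imp_bdd_above[OF compact_imp_bounded[OF \<open>compact C\<close>]] unfolding bdd_above_def by auto
  have "0 \<notin> C" using C0 by force
  then obtain r where r: "r > 0" "\<And>x. x \<in> C \<Longrightarrow> x \<ge> r"
    using separate_point_closed[OF compact_imp_closed[OF \<open>compact C\<close>], of 0] C0
    by (auto simp: dist_real_def) (metis abs_of_pos)
  obtain L :: nat where L: "R / r < of_nat L" using reals_Archimedean2 by blast
  have "of_nat L < exp (of_nat L :: real)" using exp_ge_add_one_self[of "of_nat L"] by linarith
  then have RL: "R < exp (of_nat L) * r" using L r(1) by (simp add: field_simps) (smt (verit) mult_less_cancel_left_pos mult.commute)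
  have up: "y < exp (of_int i) * x" if "i \<ge> int L" "x \<in> C" "y \<in> C" for i x y
  proof -
    have "exp (of_nat L) * r \<le> exp (of_int i) * x"
    proof (rule mult_mono)
      have "real_of_int (int L) \<le> real_of_int i" using that(1) by (simp only: of_int_le_iff)
      then show "exp (of_nat L) \<le> exp (real_of_int i)" by simp
    qed (use that r in auto)
    then show ?thesis using RL R[OF that(3)] by linarith
  qed
  have down: "exp (of_int i) * x < y" if "i \<le> - int L" "x \<in> C" "y \<in> C" for i x y
  proof -
    have "x < exp (of_int (- i)) * y" using that by (intro up) auto
    then show ?thesis by (simp add: exp_minus field_simps)
  qed
  show thesis
  proof (rule that[of "int L"])
    show "0 \<le> int L" by simp
    fix v assume v: "v \<in> ends"
    have vC: "norm (vh v) \<in> C" if "v \<in> ends" for v using that by (auto simp: C_def)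
    have pC: "norm (p f t) \<in> C" if "f \<in> E" "t \<in> {0..1}" for f t using that unfolding C_def by blast
    show "norm (vh v) < norm (lift_act i (p f t))" if "i \<ge> int L" "f \<in> E" "t \<in> {0..1}" for i f t
      using up[OF that(1) pC[OF that(2,3)] vC[OF v]] by (simp add: norm_lift_act)
    show "norm (lift_act i (p f t)) < norm (vh v)" if "i \<le> - int L" "f \<in> E" "t \<in> {0..1}" for i f t
      using down[OF that(1) pC[OF that(2,3)] vC[OF v]] by (simp add: norm_lift_act)
    show "norm (vh v) < norm (pos (w, i))" if "i \<ge> int L" "w \<in> ends" for i w
      using up[OF that(1) vC[OF that(2)] vC[OF v]] by (simp add: norm_lift_act pos_def)
    show "norm (pos (w, i)) < norm (vh v)" if "i \<le> - int L" "w \<in> ends" for i w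
      using down[OF that(1) vC[OF that(2)] vC[OF v]] by (simp add: norm_lift_act pos_def)
  qed
qed

lemma kap_far:
  assumes "norm (vh v) < norm (pos (w, i))" shows "kap (v, 0) (w, i) = of_bool (even i)"
  using assms by (simp add: kap_def before_def pos_def)

lemma kap_near:
  assumes "norm (pos (w, i)) < norm (vh v)" shows "kap (v, 0) (w, i) = 0"
  using assms by (simp add: kap_def before_def pos_def)

text \<open>The base point can be moved from the vertex to 0 without meeting the far translate. The
  turning number thus becomes the one about the puncture, up to the sign of the deck
  transformation.\<close>

lemma turn_far:
  assumes f: "f \<in> E" "avoids v f"
    and far: "\<And>t. t \<in> {0..1} \<Longrightarrow> norm (vh v) < norm (lift_act i (p f t))"
  shows "even (turn v f i - wind f)"
proof -
  have v: "vh v = pos (v, 0)" by (simp add: pos_def)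
  let ?c = "\<lambda>t. lift_act i (p f t)"
  have c: "continuous_on {0..1} ?c" using cont f by (intro continuous_intros)
  have bef: "before (v, 0) (fst f, i)" "before (v, 0) (snd f, m f + i)"
    using far[of 0] far[of 1] p_0[OF f(1), of i] p_1[OF f(1), of i] by (auto simp: before_def v)
  have "arg_change (\<lambda>t. ?c t - vh v) = arg_change ?c + Arg (1 - vh v / ?c 1) - Arg (1 - vh v / ?c 0)"
    by (rule arg_change_minus_small[OF c far])
  also have "arg_change ?c = sg i * arg_change (p f)"
    by (rule arg_change_lift_act[OF cont nz]) (use f in auto)
  finally have "2 * pi * turn v f i = sg i * (2 * pi * wind f)"
    using arg_change_turn[OF f, of i] arg_change_wind[OF f(1)] bef p_0[OF f(1), of i] p_1[OF f(1), of i]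
    by (simp add: angle_def angle0_def v sg_add algebra_simps)
  then have "real_of_int (turn v f i) = of_int (if even i then wind f else - wind f)"
    by (simp add: sg_def split: if_splits)
  then have "turn v f i = (if even i then wind f else - wind f)"
    by (simp only: of_int_eq_iff)
  then show ?thesis by simp
qed

text \<open>The translate lies in the open disc about 0 that has the vertex on its boundary, so its
  difference from the vertex stays in a half plane.\<close>

lemma turn_near:
  assumes f: "f \<in> E" "avoids v f"
    and near: "\<And>t. t \<in> {0..1} \<Longrightarrow> norm (lift_act i (p f t)) < norm (vh v)"
  shows "turn v f i = 0"
proof -
  have v: "vh v = pos (v, 0)" by (simp add: pos_def)
  let ?c = "\<lambda>t. lift_act i (p f t)"
  have c: "continuous_on {0..1} ?c" using cont f by (intro continuous_intros)
  have bef: "\<not> before (v, 0) (fst f, i)" "\<not> before (v, 0) (snd f, m f + i)"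
    using near[of 0] near[of 1] p_0[OF f(1), of i] p_1[OF f(1), of i] by (auto simp: before_def v)
  have "arg_change (\<lambda>t. ?c t - vh v) = Arg (1 - ?c 1 / vh v) - Arg (1 - ?c 0 / vh v)"
    by (rule arg_change_minus_large[OF c near])
  then show ?thesis
    using arg_change_turn[OF f, of i] bef p_0[OF f(1), of i] p_1[OF f(1), of i]
    by (simp add: angle_def v)
qed

text \<open>A path in the right half plane does not wind about 0. This serves the projective plane,
  where the drawing lifts to this half plane.\<close>

lemma wind_Re_pos:
  assumes f: "f \<in> E" and Re: "\<And>t. t \<in> {0..1} \<Longrightarrow> Re (p f t) > 0"
  shows "wind f = 0"
proof -
  have "arg_change (p f) = Arg (p f 1) - Arg (p f 0)"
    by (rule arg_change_of_Re_pos) (use cont f Re in auto)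
  moreover have "p f 0 = vh (fst f)" using start f by simp
  moreover have "Arg (p f 1) = angle0 (snd f, m f)"
  proof -
    have "Re (vh (snd f)) > 0"
      using Re[of 1] fin[OF f] by (auto simp: lift_act_def zero_less_mult_iff split: if_splits)
    then have "vh (snd f) \<notin> \<real>\<^sub>\<le>\<^sub>0" by (auto simp: complex_nonpos_Reals_iff)
    then have "Arg (cnj (vh (snd f))) = - Arg (vh (snd f))"
      using cnj_Ln[of "vh (snd f)"] by (metis Arg_eq_Im_Ln cnj.sel(2) complex_cnj_zero_iff vh_nz)
    then show ?thesis
      using fin[OF f] by (simp add: angle0_def sg_def lift_act_def)
  qed
  ultimately have "2 * pi * wind f = 0" using arg_change_wind[OF f] by (simp add: angle0_def)
  then show ?thesis by simp
qed

text \<open>The order terms have an odd sum exactly if the two edges interleave, that is, cross as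
  chords when the vertices lie in order on a convex curve. The products form the intersection number
  of the classes of the edges modulo 2. So the crossings of the chords agree with the intersection
  numbers up to a coboundary; \<open>Y v f\<close> plays the role of the number of times that
  \<open>v\<close> is moved across \<open>f\<close>.\<close>

theorem parity_relation:
  obtains Y :: "'v \<Rightarrow> 'v \<times> 'v \<Rightarrow> int" where
    "\<And>a b c d. (a, b) \<in> E \<Longrightarrow> (c, d) \<in> E \<Longrightarrow> indep (a, b) (c, d) \<Longrightarrow>
      even (Y a (c, d) + Y b (c, d) + Y c (a, b) + Y d (a, b)
        + of_bool (a < c) + of_bool (a < d) + of_bool (b < c) + of_bool (b < d)
        + m (a, b) * m (c, d) + m (a, b) * wind (c, d) + wind (a, b) * m (c, d))"
proof -
  obtain L where L: "L \<ge> 0"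
    and far: "\<And>i v f t. i \<ge> L \<Longrightarrow> v \<in> ends \<Longrightarrow> f \<in> E \<Longrightarrow> t \<in> {0..1} \<Longrightarrow> norm (vh v) < norm (lift_act i (p f t))"
    and near: "\<And>i v f t. i \<le> - L \<Longrightarrow> v \<in> ends \<Longrightarrow> f \<in> E \<Longrightarrow> t \<in> {0..1} \<Longrightarrow> norm (lift_act i (p f t)) < norm (vh v)"
    and pfar: "\<And>i v w. i \<ge> L \<Longrightarrow> v \<in> ends \<Longrightarrow> w \<in> ends \<Longrightarrow> norm (vh v) < norm (pos (w, i))"
    and pnear: "\<And>i v w. i \<le> - L \<Longrightarrow> v \<in> ends \<Longrightarrow> w \<in> ends \<Longrightarrow> norm (pos (w, i)) < norm (vh v)"
    by (rule norm_bounds) blast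
  \<comment> \<open>\<open>J\<close> bounds every shift of a window that occurs below, including
    \<open>m ?f - m ?e\<close>.\<close>
  define J where "J = 2 * (\<Sum>e\<in>E. \<bar>m e\<bar>)"
  have mJ: "2 * \<bar>m e\<bar> \<le> J" if "e \<in> E" for e
    unfolding J_def using member_le_sum[OF that _ finite_E, of "\<lambda>e. \<bar>m e\<bar>"] by simp
  \<comment> \<open>An even \<open>K\<close> gives \<open>(K + j) div 2 - K div 2 = j div 2\<close>
    in \<open>Tshift\<close>. The window from \<open>- K\<close> to \<open>K\<close> has an odd
    number of indices.\<close>
  define K where "K = 2 * (L + J + 1)"
  have "J \<ge> 0" unfolding J_def by (simp add: sum_nonneg)
  then have K: "K \<ge> L + J + 1" "even K" "K \<ge> 0" using L by (auto simp: K_def)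
  define N where "N v f = (\<Sum>i=-K..K. turn v f i)" for v f
  define T where "T v w = (\<Sum>i=-K..K. kap (v, 0) (w, i))" for v w
  \<comment> \<open>Each index by which the window moves up brings in one far translate, which turns
    \<open>wind f\<close> times modulo 2.\<close>
  have Nshift: "even ((\<Sum>i=-K..K. turn v f (i + j)) - N v f - j * wind f)"
    if f: "f \<in> E" "avoids v f" and v: "v \<in> ends" and j: "\<bar>j\<bar> \<le> J" for v f j
  proof -
    have "even ((\<Sum>i=-K..K. turn v f (i + j)) - (\<Sum>i=-K..K. turn v f i)
        - ((K + j) * wind f - K * wind f))"
      by (rule shifted_sum[where u = "\<lambda>i. wind f" and L = L and J = J])
        (use turn_near[OF f near] turn_far[OF f far] v f L K j in \<open>auto simp: algebra_simps\<close>)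
    then show ?thesis by (simp add: N_def algebra_simps)
  qed
  \<comment> \<open>Far out, \<open>kap\<close> is 1 exactly at the even indices. The shift
    therefore counts the even numbers in an interval, whence the rounded half of
    \<open>j\<close>.\<close>
  have Tshift: "even ((\<Sum>i=-K..K. kap (v, 0) (w, i + j)) - T v w - j div 2)"
    if v: "v \<in> ends" "w \<in> ends" and j: "\<bar>j\<bar> \<le> J" for v w j
  proof -
    have "even ((\<Sum>i=-K..K. kap (v, 0) (w, i + j)) - (\<Sum>i=-K..K. kap (v, 0) (w, i))
        - ((K + j) div 2 - K div 2))"
    proof (rule shifted_sum[where u = "\<lambda>i. of_bool (even i)" and L = L and J = J])
      fix i :: int
      show "even ((i + 1) div 2 - i div 2 - of_bool (even (i + 1)))"
        by (cases "even i") (auto elim!: evenE oddE)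
    qed (use kap_far[OF pfar] kap_near[OF pnear] v L K j in auto)
    moreover have "(K + j) div 2 - K div 2 = j div 2" using K(2) by presburger
    ultimately show ?thesis by (simp add: T_def)
  qed
  have refl: "(\<Sum>i=-K..K. g (- i)) = (\<Sum>i=-K..K. g i)" for g :: "int \<Rightarrow> int"
    by (rule sum.reindex_bij_witness[of _ uminus uminus]) auto
  have cardK: "odd (card {-K..K})" using K(3) by (simp add: even_nat_iff)
  have parity_sum: "even (sum F {-K..K} - sum G {-K..K} - c)"
    if "\<And>i. even (F i - G i - c)" for F G :: "int \<Rightarrow> int" and c
  proof -
    have "even (\<Sum>i=-K..K. F i - G i - c)" by (rule dvd_sum) (use that in auto)
    then have "even (sum F {-K..K} - sum G {-K..K} - int (card {-K..K}) * c)"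
      by (simp add: sum_subtractf)
    then show ?thesis using cardK K(3) by simp
  qed
  \<comment> \<open>The two values of \<open>kap\<close> for a pair add up to 1 at each of an odd
    number of indices. Moving the index from one vertex to the other costs \<open>i\<close> modulo
    2, and these corrections cancel between \<open>i\<close> and \<open>- i\<close>.\<close>
  have Tswap: "odd (T v w + T w v)" if "v \<noteq> w" for v w
  proof -
    have *: "even (kap (v, 0) (w, i) + kap (w, 0) (v, - i) - 1 - i)" for i
      using kap_swap[of "(v, 0)" "(w, i)"] kap_shift[of i "(w, 0)" "(v, - i)"] that
      by (simp add: shift_def) presburger
    have "even (\<Sum>i=-K..K. kap (v, 0) (w, i) + kap (w, 0) (v, - i) - 1 - i)"
      by (rule dvd_sum) (use * in auto)
    then have "even (T v w + (\<Sum>i=-K..K. kap (w, 0) (v, - i)) - int (card {-K..K}) - (\<Sum>i=-K..K. i))"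
      by (simp add: T_def sum_subtractf sum.distrib)
    moreover have "(\<Sum>i=-K..K. i) = 0" using refl[of "\<lambda>i. i"] by (simp add: sum_negf)
    ultimately show ?thesis using refl[of "\<lambda>i. kap (w, 0) (v, i)"] cardK K(3) by (simp add: T_def)
  qed
  \<comment> \<open>\<open>T\<close> together with the order term is symmetric modulo 2.
    \<open>U\<close> keeps its value for only one order of each pair, so \<open>S v w\<close>
    becomes \<open>U v w + U w v\<close> and the sums \<open>T\<close> can be absorbed into
    \<open>Y\<close>.\<close>
  define S where "S v w = T v w + of_bool (v < w)" for v w
  have S: "even (S v w + S w v)" if "v \<noteq> w" for v w
    using Tswap[OF that] that by (cases "v < w") (auto simp: S_def)
  define U where "U v w = (if v < w then S v w else 0)" for v w
  have U: "even (U v w + U w v - T v w - of_bool (v < w))" if "v \<noteq> w" for v w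
    using S[OF that] that by (cases "v < w") (auto simp: U_def S_def)
  define Y where "Y v f = N v f + U v (fst f) + U v (snd f)" for v f
  show thesis
  proof (rule that[of Y])
    fix a b c d
    assume e: "(a, b) \<in> E" and f: "(c, d) \<in> E" and ind: "indep (a, b) (c, d)"
    let ?e = "(a, b)" and ?f = "(c, d)"
    have v: "a \<in> ends" "b \<in> ends" "c \<in> ends" "d \<in> ends"
      using e f unfolding ends_def by force+
    note av = indep_avoids[OF e f ind, simplified]
    have je: "\<bar>- m ?e\<bar> \<le> J" "\<bar>- m ?f\<bar> \<le> J" "\<bar>m ?f\<bar> \<le> J" "\<bar>m ?f - m ?e\<bar> \<le> J"
      using mJ[OF e] mJ[OF f] by auto
    have rel: "even (turn a ?f i + turn b ?f (i - m ?e) + turn c ?e (- i) + turn d ?e (- (m ?f + i))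
      + kap (a, 0) (d, m ?f + i) + kap (a, 0) (c, i) + kap (b, m ?e) (d, m ?f + i) + kap (b, m ?e) (c, i))" for i
      using relation[OF e f ind, of a b c d i] by simp
    have "even (\<Sum>i=-K..K. turn a ?f i + turn b ?f (i - m ?e) + turn c ?e (- i) + turn d ?e (- (m ?f + i))
      + kap (a, 0) (d, m ?f + i) + kap (a, 0) (c, i) + kap (b, m ?e) (d, m ?f + i) + kap (b, m ?e) (c, i))"
      by (rule dvd_sum) (use rel in auto)
    then have 1: "even (N a ?f + (\<Sum>i=-K..K. turn b ?f (i - m ?e)) + (\<Sum>i=-K..K. turn c ?e (- i))
      + (\<Sum>i=-K..K. turn d ?e (- (m ?f + i))) + (\<Sum>i=-K..K. kap (a, 0) (d, m ?f + i)) + T a c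
      + (\<Sum>i=-K..K. kap (b, m ?e) (d, m ?f + i)) + (\<Sum>i=-K..K. kap (b, m ?e) (c, i)))"
      by (simp add: sum.distrib N_def T_def)
    have 2: "even ((\<Sum>i=-K..K. turn b ?f (i - m ?e)) - N b ?f - (- m ?e) * wind ?f)"
      using Nshift[OF f av(2) v(2) je(1)] by simp
    have 3: "even ((\<Sum>i=-K..K. turn c ?e (- i)) - N c ?e)"
      using refl[of "turn c ?e"] by (simp add: N_def)
    have 4: "even ((\<Sum>i=-K..K. turn d ?e (- (m ?f + i))) - N d ?e - (- m ?f) * wind ?e)"
      using Nshift[OF e av(4) v(4) je(2)] refl[of "\<lambda>i. turn d ?e (i - m ?f)"] by (simp add: algebra_simps)
    have 5: "even ((\<Sum>i=-K..K. kap (a, 0) (d, m ?f + i)) - T a d - m ?f div 2)"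
      using Tshift[OF v(1,4) je(3)] by (simp add: add.commute)
    have ks: "even ((\<Sum>i=-K..K. kap (b, m ?e) (w, j + i)) - (\<Sum>i=-K..K. kap (b, 0) (w, j + i - m ?e)) - m ?e)" for w j
    proof (rule parity_sum)
      show "even (kap (b, m ?e) (w, j + i) - kap (b, 0) (w, j + i - m ?e) - m ?e)" for i
        using kap_shift[of "m ?e" "(b, 0)" "(w, j + i - m ?e)"] by (simp add: shift_def)
    qed
    have 6: "even ((\<Sum>i=-K..K. kap (b, m ?e) (d, m ?f + i)) - T b d - (m ?f - m ?e) div 2 - m ?e)"
      using Tshift[OF v(2,4) je(4)] ks[of d "m ?f"] by (simp add: algebra_simps) presburger
    have 7: "even ((\<Sum>i=-K..K. kap (b, m ?e) (c, i)) - T b c - (- m ?e) div 2 - m ?e)"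
      using Tshift[OF v(2,3) je(1)] ks[of c 0] by (simp add: algebra_simps) presburger
    \<comment> \<open>The product \<open>m ?e * m ?f\<close> of the final relation is what remains
      of the rounded halves.\<close>
    have 8: "even (m ?f div 2 + (m ?f - m ?e) div 2 + (- m ?e) div 2 + m ?e * m ?f)"
      unfolding even_add even_mult_iff by presburger
    have ne: "a \<noteq> c" "a \<noteq> d" "b \<noteq> c" "b \<noteq> d" using ind by (auto simp: indep_def)
    show "even (Y a ?f + Y b ?f + Y c ?e + Y d ?e
        + of_bool (a < c) + of_bool (a < d) + of_bool (b < c) + of_bool (b < d)
        + m ?e * m ?f + m ?e * wind ?f + wind ?e * m ?f)"
      using even_combination[OF 1 2 3 4 5 6 7 8 U[OF ne(1)] U[OF ne(2)] U[OF ne(3)] U[OF ne(4)]]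
      by (simp only: Y_def fst_conv snd_conv) (simp add: algebra_simps)
  qed
qed

end

text \<open>The conclusion of \<open>parity_relation\<close> detached from the lifts. It is all that
  the combinatorial part uses of a drawing.\<close>

definition parity_system :: "('v::linorder \<times> 'v) set \<Rightarrow> ('v \<times> 'v \<Rightarrow> int) \<Rightarrow> ('v \<times> 'v \<Rightarrow> int) \<Rightarrow> bool" where
  "parity_system D m n \<longleftrightarrow> (\<exists>Y. \<forall>a b c d. (a, b) \<in> D \<longrightarrow> (c, d) \<in> D \<longrightarrow> indep (a, b) (c, d) \<longrightarrow>
      even (Y a (c, d) + Y b (c, d) + Y c (a, b) + Y d (a, b)
        + of_bool (a < c) + of_bool (a < d) + of_bool (b < c) + of_bool (b < d)
        + m (a, b) * m (c, d) + m (a, b) * n (c, d) + n (a, b) * m (c, d)))"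

section \<open>Lifting an embedding\<close>

text \<open>
  A point with coordinates \<open>u\<close>, \<open>x\<close>, \<open>w\<close>, where \<open>u = cis (2 * \<theta>)\<close>, lifts to
  \<open>lift_point x w \<theta>\<close>. The two square roots \<open>cis \<theta>\<close> and \<open>- cis \<theta>\<close> of \<open>u\<close> give lifts that
  are interchanged by deck transformations of odd index.
\<close>

definition lift_point :: "real \<Rightarrow> complex \<Rightarrow> real \<Rightarrow> complex" where
  "lift_point x w \<theta> = of_real (exp (\<theta> / pi)) * Complex x (Re (w * cis (- \<theta>)))"

lemma cis_pi_int: "cis (pi * of_int m) = (if even m then 1 else - 1)"
proof (cases "even m")
  case True
  then show ?thesis using cis_multiple_2pi[of "of_int (m div 2)"] by (auto simp: mult_ac elim!: evenE)
next
  case False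
  then obtain k where m: "m = 2 * k + 1" by (auto elim: oddE)
  have "cis (pi * of_int m) = cis (2 * pi * of_int k) * cis pi"
    unfolding cis_mult m by (simp add: algebra_simps)
  then show ?thesis using False cis_multiple_2pi[of "of_int k"] by simp
qed

lemma lift_point_shift: "lift_point x w (\<theta> + pi * of_int m) = lift_act m (lift_point x w \<theta>)"
proof -
  have "cis (- (\<theta> + pi * of_int m)) = cis (- \<theta>) * (if even m then 1 else - 1)"
    using cis_mult[of "- \<theta>" "pi * of_int (- m)"] cis_pi_int[of "- m"] by simp
  then show ?thesis
    by (simp add: lift_point_def lift_act_def add_divide_distrib exp_add complex_eq_iff)
qed

lemma on_line:
  assumes "w\<^sup>2 = of_real ((norm w)\<^sup>2) * cis (2 * \<theta>)"
  shows "w = of_real (Re (w * cis (- \<theta>))) * cis \<theta>"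
proof -
  have "(w * cis (- \<theta>))\<^sup>2 = w\<^sup>2 * cis (- (2 * \<theta>))"
    by (simp add: power_mult_distrib power2_eq_square[of "cis _"] cis_mult)
  also have "\<dots> = of_real ((norm w)\<^sup>2) * (cis (2 * \<theta>) * cis (- (2 * \<theta>)))" using assms by simp
  also have "\<dots> = (of_real (norm w))\<^sup>2" by (simp add: cis_mult)
  finally have "w * cis (- \<theta>) = of_real (norm w) \<or> w * cis (- \<theta>) = - of_real (norm w)"
    by (simp add: power2_eq_iff)
  then have "Im (w * cis (- \<theta>)) = 0" by (metis Im_complex_of_real neg_0_equal_iff_equal uminus_complex.sel(2))
  then have "w * cis (- \<theta>) = of_real (Re (w * cis (- \<theta>)))" by (simp add: complex_eq_iff)
  moreover have "w = w * cis (- \<theta>) * cis \<theta>" by (simp add: mult.assoc cis_mult)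
  ultimately show ?thesis by metis
qed

lemma norm_lift_point:
  assumes "w\<^sup>2 = of_real ((norm w)\<^sup>2) * cis (2 * \<theta>)" "x\<^sup>2 + (norm w)\<^sup>2 = 1"
  shows "norm (lift_point x w \<theta>) = exp (\<theta> / pi)"
proof -
  have "norm w = \<bar>Re (w * cis (- \<theta>))\<bar>"
    using on_line[OF assms(1)] by (metis norm_mult norm_of_real norm_cis mult.right_neutral)
  then have "(norm w)\<^sup>2 = (Re (w * cis (- \<theta>)))\<^sup>2" by simp
  then have "norm (Complex x (Re (w * cis (- \<theta>)))) = 1"
    using assms(2) by (simp add: cmod_def)
  then show ?thesis by (simp add: lift_point_def norm_mult)
qed

text \<open>The norm of a lifted point recovers the angle; its direction then recovers
  \<open>x\<close> and the real multiple of \<open>cis \<theta>\<close> that \<open>w\<close>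
  is.\<close>

lemma lift_point_inject:
  assumes eq: "lift_point x w \<theta> = lift_point x' w' \<theta>'"
    and w: "w\<^sup>2 = of_real ((norm w)\<^sup>2) * cis (2 * \<theta>)" "x\<^sup>2 + (norm w)\<^sup>2 = 1"
    and w': "w'\<^sup>2 = of_real ((norm w')\<^sup>2) * cis (2 * \<theta>')" "x'\<^sup>2 + (norm w')\<^sup>2 = 1"
  shows "\<theta> = \<theta>'" "x = x'" "w = w'"
proof -
  show \<theta>: "\<theta> = \<theta>'"
    using norm_lift_point[OF w] norm_lift_point[OF w'] eq by simp
  have "Complex x (Re (w * cis (- \<theta>))) = Complex x' (Re (w' * cis (- \<theta>)))"
    using eq \<theta> by (simp add: lift_point_def)
  then show "x = x'" "w = w'"
    using on_line[OF w(1)] on_line[OF w'(1)] \<theta> by (metis complex.inject)+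
qed

text \<open>The angle is halved, so its end value is determined only up to multiples of pi. The
  integer \<open>m\<close> becomes the index of a deck transformation by
  \<open>lift_point_shift\<close>.\<close>

lemma path_lift:
  assumes f: "continuous_on {0..1::real} f1" "continuous_on {0..1} f2" "continuous_on {0..1} f3"
    and norm: "\<And>t. t \<in> {0..1} \<Longrightarrow> norm (f1 t) = 1"
    and s: "f1 0 = cis (2 * \<alpha>)" and e: "f1 1 = cis (2 * \<beta>)"
  obtains \<theta> and m :: int where "continuous_on {0..1} \<theta>" "\<And>t. t \<in> {0..1} \<Longrightarrow> f1 t = cis (2 * \<theta> t)"
    "\<theta> 0 = \<alpha>" "\<theta> 1 = \<beta> + pi * of_int m"
proof -
  obtain g where g: "continuous_on {0..1} g" "\<And>t. t \<in> {0..1} \<Longrightarrow> f1 t = exp (g t)"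
    by (rule path_log[OF f(1)]) (use norm in force)+
  have Re: "Re (g t) = 0" if "t \<in> {0..1}" for t
    using norm[OF that] g(2)[OF that] by simp
  have f1: "f1 t = cis (Im (g t))" if "t \<in> {0..1}" for t
    using g(2)[OF that] Re[OF that] by (simp add: exp_eq_polar)
  have *: "\<exists>k::int. a = b + pi * of_int k" if "cis (2 * a) = cis (2 * b)" for a b
  proof -
    have "exp (\<i> * of_real (2 * a)) = exp (\<i> * of_real (2 * b))" using that by (simp add: cis_conv_exp)
    then obtain k :: int where "\<i> * of_real (2 * a) = \<i> * of_real (2 * b) + of_real (of_int (2 * k) * pi) * \<i>"
      unfolding exp_eq by blast
    then have "2 * a = 2 * (b + pi * of_int k)" by (simp add: complex_eq_iff algebra_simps)
    then have "a = b + pi * of_int k" by simp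
    then show ?thesis ..
  qed
  obtain k :: int where k: "Im (g 0) / 2 = \<alpha> + pi * of_int k" using *[of "Im (g 0) / 2" \<alpha>] f1[of 0] s by auto
  obtain l :: int where l: "Im (g 1) / 2 = \<beta> + pi * of_int l" using *[of "Im (g 1) / 2" \<beta>] f1[of 1] e by auto
  show thesis
  proof (rule that[of "\<lambda>t. Im (g t) / 2 - pi * of_int k" "l - k"])
    show "continuous_on {0..1} (\<lambda>t. Im (g t) / 2 - pi * of_int k)"
      using g(1) by (intro continuous_intros) auto
    fix t :: real assume t: "t \<in> {0..1}"
    have "cis (2 * (Im (g t) / 2 - pi * of_int k)) = cis (Im (g t)) * cis (- (2 * pi * of_int k))"
      by (simp add: cis_mult algebra_simps)
    also have "cis (- (2 * pi * of_int k)) = 1"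
      using cis_multiple_2pi[of "- of_int k"] by (simp add: algebra_simps)
    finally show "f1 t = cis (2 * (Im (g t) / 2 - pi * of_int k))" using f1[OF t] by simp
  qed (use k l in \<open>simp_all add: algebra_simps\<close>)
qed

lemma graph_embeds_inE:
  assumes "graph_embeds_in V E X"
  obtains \<phi> \<gamma> where "inj_on \<phi> V" "\<phi> ` V \<subseteq> topspace X"
    "\<And>e. e \<in> E \<Longrightarrow> pathin X (\<gamma> e) \<and> inj_on (\<gamma> e) {0..1} \<and> {\<gamma> e 0, \<gamma> e 1} = \<phi> ` e \<and> \<gamma> e ` {0<..<1} \<inter> \<phi> ` V = {}"
    "\<And>e e'. e \<in> E \<Longrightarrow> e' \<in> E \<Longrightarrow> e \<noteq> e' \<Longrightarrow> \<gamma> e ` {0<..<1} \<inter> \<gamma> e' ` {0<..<1} = {}"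
proof -
  from assms[unfolded graph_embeds_in_def] show thesis
    by (elim exE conjE) (rule that, assumption, assumption, erule (1) bspec, metis)
qed

lemma oriented_edge_path:
  assumes "pathin X \<gamma>" "{\<gamma> 0, \<gamma> 1} = {x, y}"
  obtains \<delta> where "pathin X \<delta>" "\<delta> 0 = x" "\<delta> 1 = y" "\<delta> ` {0..1} = \<gamma> ` {0..1}"
proof (cases "\<gamma> 0 = x \<and> \<gamma> 1 = y")
  case True then show ?thesis using that assms by blast
next
  case False
  then have *: "\<gamma> 0 = y" "\<gamma> 1 = x" using assms(2) by (auto simp: doubleton_eq_iff)
  have "continuous_map (top_of_set {0..1}) (top_of_set {0..1}) (\<lambda>t::real. 1 - t)"
    by (auto intro!: continuous_intros)
  then have "pathin X (\<gamma> \<circ> (\<lambda>t. 1 - t))"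
    using assms(1) unfolding pathin_def by (rule continuous_map_compose)
  moreover have "(\<gamma> \<circ> (\<lambda>t. 1 - t)) ` {0..1} = \<gamma> ` {0..1}"
    unfolding image_comp[symmetric] by simp
  ultimately show ?thesis using that[of "\<gamma> \<circ> (\<lambda>t. 1 - t)"] * by simp
qed

text \<open>The three functions place the surface in the Klein bottle as a circle bundle:
  \<open>f1\<close> is the point of the base circle, and over it \<open>f2\<close> and
  \<open>f3\<close> lie on a circle whose second axis is the real line of the square roots of
  \<open>f1 x\<close>. After one round that line comes back reversed. Only injectivity is asked for,
  so a Moebius band is covered as well.\<close>

lemma embedding_parity:
  fixes X :: "'b topology" and V :: "'v::linorder set" and f1 f3 :: "'b \<Rightarrow> complex"
  assumes emb: "graph_embeds_in V E X"
    and cont: "continuous_map X euclidean f1" "continuous_map X euclidean f2" "continuous_map X euclidean f3"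
    and norm: "\<And>x. x \<in> topspace X \<Longrightarrow> norm (f1 x) = 1"
    and line: "\<And>x. x \<in> topspace X \<Longrightarrow> (f3 x)\<^sup>2 = of_real ((norm (f3 x))\<^sup>2) * f1 x"
    and circ: "\<And>x. x \<in> topspace X \<Longrightarrow> (f2 x)\<^sup>2 + (norm (f3 x))\<^sup>2 = 1"
    and inj: "\<And>x y. x \<in> topspace X \<Longrightarrow> y \<in> topspace X \<Longrightarrow> f1 x = f1 y \<Longrightarrow> f2 x = f2 y \<Longrightarrow> f3 x = f3 y \<Longrightarrow> x = y"
    and D: "finite D" "\<And>u w. (u, w) \<in> D \<Longrightarrow> u \<in> V \<and> w \<in> V \<and> {u, w} \<in> E"
  obtains m n where "parity_system D m n" "(\<And>x. x \<in> topspace X \<Longrightarrow> f2 x > 0) \<Longrightarrow> \<forall>e\<in>D. n e = 0"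
proof -
  obtain \<phi> \<gamma> where \<phi>: "inj_on \<phi> V" "\<phi> ` V \<subseteq> topspace X"
    and \<gamma>: "\<And>e. e \<in> E \<Longrightarrow> pathin X (\<gamma> e) \<and> {\<gamma> e 0, \<gamma> e 1} = \<phi> ` e \<and> \<gamma> e ` {0<..<1} \<inter> \<phi> ` V = {}"
    and \<gamma>2: "\<And>e e'. e \<in> E \<Longrightarrow> e' \<in> E \<Longrightarrow> e \<noteq> e' \<Longrightarrow> \<gamma> e ` {0<..<1} \<inter> \<gamma> e' ` {0<..<1} = {}"
    using emb by (rule graph_embeds_inE) blast
  have "\<exists>\<delta>. pathin X \<delta> \<and> \<delta> 0 = \<phi> (fst d) \<and> \<delta> 1 = \<phi> (snd d) \<and> \<delta> ` {0..1} = \<gamma> {fst d, snd d} ` {0..1}"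
    if "d \<in> D" for d
    using oriented_edge_path[of X "\<gamma> {fst d, snd d}" "\<phi> (fst d)" "\<phi> (snd d)"] \<gamma>[of "{fst d, snd d}"]
      D(2)[of "fst d" "snd d"] that by (metis image_insert image_empty prod.collapse)
  then obtain \<delta> where \<delta>: "\<And>d. d \<in> D \<Longrightarrow> pathin X (\<delta> d)" "\<And>d. d \<in> D \<Longrightarrow> \<delta> d 0 = \<phi> (fst d)"
      "\<And>d. d \<in> D \<Longrightarrow> \<delta> d 1 = \<phi> (snd d)" "\<And>d. d \<in> D \<Longrightarrow> \<delta> d ` {0..1} = \<gamma> {fst d, snd d} ` {0..1}"
    by metis
  have \<delta>X: "\<delta> d t \<in> topspace X" if "d \<in> D" "t \<in> {0..1}" for d t
    using \<delta>(1)[OF that(1)] that(2) unfolding pathin_def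
    by (metis continuous_map_image_subset_topspace image_subset_iff topspace_euclidean_subtopology)
  have \<delta>disj: "\<delta> d s \<noteq> \<delta> d' t" if d: "d \<in> D" "d' \<in> D" "indep d d'" and st: "s \<in> {0..1}" "t \<in> {0..1}" for d d' s t
  proof
    assume eq: "\<delta> d s = \<delta> d' t"
    let ?e = "{fst d, snd d}" and ?e' = "{fst d', snd d'}"
    have e: "?e \<in> E" "?e' \<in> E" "?e \<subseteq> V" "?e' \<subseteq> V" using D(2)[of "fst d" "snd d"] D(2)[of "fst d'" "snd d'"] d by auto
    have ii: "?e \<inter> ?e' = {}" "?e \<noteq> ?e'" using d(3) unfolding indep_def by auto
    have split: "{0..1::real} = {0<..<1} \<union> {0, 1}" by auto
    have im: "\<gamma> e ` {0..1} = \<gamma> e ` {0<..<1} \<union> \<phi> ` e" if "e \<in> E" for e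
    proof -
      have "\<gamma> e ` {0..1} = \<gamma> e ` {0<..<1} \<union> {\<gamma> e 0, \<gamma> e 1}"
        unfolding split by (simp add: image_Un)
      then show ?thesis using \<gamma>[OF that] by simp
    qed
    define A B A' B' where "A = \<gamma> ?e ` {0<..<1}" and "B = \<phi> ` ?e"
      and "A' = \<gamma> ?e' ` {0<..<1}" and "B' = \<phi> ` ?e'"
    have "\<delta> d s \<in> \<gamma> ?e ` {0..1}" using \<delta>(4)[OF d(1)] st(1) by (metis imageI)
    then have 1: "\<delta> d s \<in> A \<union> B" using im[OF e(1)] by (simp only: A_def B_def)
    have "\<delta> d s \<in> \<gamma> ?e' ` {0..1}" using \<delta>(4)[OF d(2)] st(2) eq by (metis imageI)
    then have 2: "\<delta> d s \<in> A' \<union> B'" using im[OF e(2)] by (simp only: A'_def B'_def)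
    have 3: "A \<inter> A' = {}" unfolding A_def A'_def by (rule \<gamma>2[OF e(1,2) ii(2)])
    have "A \<inter> \<phi> ` V = {}" "A' \<inter> \<phi> ` V = {}" using \<gamma>[OF e(1)] \<gamma>[OF e(2)] by (simp_all only: A_def A'_def)
    moreover have "B \<subseteq> \<phi> ` V" "B' \<subseteq> \<phi> ` V" unfolding B_def B'_def by (rule image_mono[OF e(3)], rule image_mono[OF e(4)])
    moreover have "B \<inter> B' = {}"
      using inj_on_image_Int[OF \<phi>(1) e(3,4)] unfolding B_def B'_def ii(1) by simp
    moreover have False if "x \<in> A \<union> B" "x \<in> A' \<union> B'" "A \<inter> A' = {}" "A \<inter> W = {}" "A' \<inter> W = {}"
      "B \<subseteq> W" "B' \<subseteq> W" "B \<inter> B' = {}" for x W using that by auto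
    ultimately show False using 1 2 3 by metis
  qed
  define \<alpha> where "\<alpha> v = Arg (f1 (\<phi> v)) / 2" for v
  have \<alpha>: "f1 (\<phi> v) = cis (2 * \<alpha> v)" if "v \<in> V" for v
  proof -
    have n: "norm (f1 (\<phi> v)) = 1" using norm \<phi>(2) that by blast
    then have "f1 (\<phi> v) \<noteq> 0" by force
    then have "f1 (\<phi> v) = of_real (norm (f1 (\<phi> v))) * cis (Arg (f1 (\<phi> v)))"
      unfolding cis_conv_exp by (rule Arg_eq)
    also have "\<dots> = cis (2 * \<alpha> v)" by (simp add: n \<alpha>_def)
    finally show ?thesis .
  qed
  have cont\<delta>: "continuous_on {0..1} (\<lambda>t. f (\<delta> d t))" if "d \<in> D" "continuous_map X euclidean f"
    for d and f :: "'b \<Rightarrow> 'c::topological_space"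
    using continuous_map_compose[OF \<delta>(1)[OF that(1), unfolded pathin_def] that(2)] by (simp add: o_def)
  have "\<exists>\<theta> m. continuous_on {0..1} \<theta> \<and> (\<forall>t\<in>{0..1}. f1 (\<delta> d t) = cis (2 * \<theta> t)) \<and>
      \<theta> 0 = \<alpha> (fst d) \<and> \<theta> 1 = \<alpha> (snd d) + pi * of_int m" if d: "d \<in> D" for d
  proof -
    obtain \<theta> and m :: int where "continuous_on {0..1} \<theta>" "\<And>t. t \<in> {0..1} \<Longrightarrow> f1 (\<delta> d t) = cis (2 * \<theta> t)"
      "\<theta> 0 = \<alpha> (fst d)" "\<theta> 1 = \<alpha> (snd d) + pi * of_int m"
      by (rule path_lift[of "\<lambda>t. f1 (\<delta> d t)" "\<lambda>t. f2 (\<delta> d t)" "\<lambda>t. f3 (\<delta> d t)" "\<alpha> (fst d)" "\<alpha> (snd d)"])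
        (use cont\<delta>[OF d] cont norm \<delta>X d \<delta>(2,3) \<alpha> D(2)[of "fst d" "snd d"] in auto)
    then show ?thesis by blast
  qed
  then obtain \<theta> m where \<theta>: "\<And>d. d \<in> D \<Longrightarrow> continuous_on {0..1} (\<theta> d)"
      "\<And>d t. d \<in> D \<Longrightarrow> t \<in> {0..1} \<Longrightarrow> f1 (\<delta> d t) = cis (2 * \<theta> d t)"
      "\<And>d. d \<in> D \<Longrightarrow> \<theta> d 0 = \<alpha> (fst d)" "\<And>d. d \<in> D \<Longrightarrow> \<theta> d 1 = \<alpha> (snd d) + pi * of_int (m d)"
    by metis
  define p where "p d t = lift_point (f2 (\<delta> d t)) (f3 (\<delta> d t)) (\<theta> d t)" for d t
  \<comment> \<open>The locale asks for a nonzero value at every \<open>v\<close>; outside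
    \<open>V\<close> any such value will do.\<close>
  define vh where "vh v = (if v \<in> V then lift_point (f2 (\<phi> v)) (f3 (\<phi> v)) (\<alpha> v) else 1)" for v
  have w: "(f3 (\<delta> d t))\<^sup>2 = of_real ((norm (f3 (\<delta> d t)))\<^sup>2) * cis (2 * (\<theta> d t + pi * of_int j))"
    if "d \<in> D" "t \<in> {0..1}" for d t and j :: int
  proof -
    have "cis (2 * (\<theta> d t + pi * of_int j)) = cis (2 * \<theta> d t) * cis (2 * pi * of_int j)"
      by (simp add: cis_mult algebra_simps)
    also have "cis (2 * pi * of_int j) = 1"
      using cis_multiple_2pi[of "of_int j"] by simp
    finally show ?thesis using line[OF \<delta>X[OF that]] \<theta>(2)[OF that] by simp
  qed
  have c: "(f2 (\<delta> d t))\<^sup>2 + (norm (f3 (\<delta> d t)))\<^sup>2 = 1" if "d \<in> D" "t \<in> {0..1}" for d t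
    using circ \<delta>X that by auto
  interpret lifted_drawing D vh p m
  proof
    show "finite D" by fact
    show "vh v \<noteq> 0" for v
    proof (cases "v \<in> V")
      case True
      then have X: "\<phi> v \<in> topspace X" using \<phi>(2) by auto
      have "norm (vh v) = exp (\<alpha> v / pi)"
        using norm_lift_point[of "f3 (\<phi> v)" "\<alpha> v" "f2 (\<phi> v)"] line[OF X] circ[OF X] \<alpha>[OF True] True
        by (simp add: vh_def)
      then show ?thesis by (metis exp_not_eq_zero norm_eq_zero)
    qed (simp add: vh_def)
    fix d assume d: "d \<in> D"
    define r where "r t = Re (f3 (\<delta> d t) * cis (- \<theta> d t))" for t
    have "continuous_on {0..1} r"
      unfolding r_def using cont\<delta>[OF d cont(3)] \<theta>(1)[OF d] by (intro continuous_intros) auto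
    moreover have "p d = (\<lambda>t. of_real (exp (\<theta> d t / pi)) * (of_real (f2 (\<delta> d t)) + \<i> * of_real (r t)))"
      by (simp add: fun_eq_iff p_def lift_point_def Complex_eq r_def)
    ultimately show "continuous_on {0..1} (p d)"
      using cont\<delta>[OF d cont(2)] \<theta>(1)[OF d] by (auto intro!: continuous_intros)
    show "p d t \<noteq> 0" if "t \<in> {0..1}" for t
      using norm_lift_point[OF _ c[OF d that], of "\<theta> d t"] w[OF d that, of 0]
      by (simp add: p_def) (metis exp_not_eq_zero norm_eq_zero)
    have V: "fst d \<in> V" "snd d \<in> V" using D(2)[of "fst d" "snd d"] d by auto
    show "p d 0 = vh (fst d)" using \<delta>(2)[OF d] \<theta>(3)[OF d] V by (simp add: p_def vh_def)
    show "p d 1 = lift_act (m d) (vh (snd d))"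
      using \<delta>(3)[OF d] \<theta>(4)[OF d] V by (simp add: p_def vh_def lift_point_shift)
    fix d' s t j assume d': "d' \<in> D" "indep d d'" and s: "s \<in> {0..1::real}" and t: "t \<in> {0..1::real}"
    show "p d s \<noteq> lift_act j (p d' t)"
    proof
      assume "p d s = lift_act j (p d' t)"
      then have eq: "lift_point (f2 (\<delta> d s)) (f3 (\<delta> d s)) (\<theta> d s + pi * of_int 0)
          = lift_point (f2 (\<delta> d' t)) (f3 (\<delta> d' t)) (\<theta> d' t + pi * of_int j)"
        by (simp add: p_def lift_point_shift)
      note * = lift_point_inject[OF eq w[OF d s] c[OF d s] w[OF d'(1) t] c[OF d'(1) t]]
      have "cis (2 * \<theta> d s) = cis (2 * \<theta> d' t) * cis (2 * pi * of_int j)"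
        using *(1) by (simp add: cis_mult algebra_simps)
      then have "f1 (\<delta> d s) = f1 (\<delta> d' t)"
        using \<theta>(2) d d' s t cis_multiple_2pi[of "of_int j"] by simp
      then have "\<delta> d s = \<delta> d' t" using inj[OF \<delta>X[OF d s] \<delta>X[OF d'(1) t]] * by blast
      then show False using \<delta>disj[OF d d' s t] by blast
    qed
  qed
  obtain Y where "\<And>a b c d. (a, b) \<in> D \<Longrightarrow> (c, d) \<in> D \<Longrightarrow> indep (a, b) (c, d) \<Longrightarrow>
      even (Y a (c, d) + Y b (c, d) + Y c (a, b) + Y d (a, b)
        + of_bool (a < c) + of_bool (a < d) + of_bool (b < c) + of_bool (b < d)
        + m (a, b) * m (c, d) + m (a, b) * wind (c, d) + wind (a, b) * m (c, d))"
    using parity_relation by blast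
  then have "parity_system D m wind" unfolding parity_system_def by blast
  moreover have "\<forall>e\<in>D. wind e = 0" if "\<And>x. x \<in> topspace X \<Longrightarrow> f2 x > 0"
  proof
    fix d assume d: "d \<in> D"
    show "wind d = 0"
      by (rule wind_Re_pos[OF d]) (use that \<delta>X[OF d] in \<open>simp add: p_def lift_point_def\<close>)
  qed
  ultimately show thesis using that by blast
qed

section \<open>Coordinates on the surfaces\<close>

text \<open>A quotient map restricted to the preimage of an open set is again a quotient map.
  \<open>W\<close> is either the whole surface or the complement of a point.\<close>

lemma descend_to_surface:
  fixes F :: "complex \<times> real \<Rightarrow> 'c::topological_space"
  assumes W: "openin (nonorientable_surface k) W"
    and F: "continuous_on {p \<in> holed_sphere k. crosscap_class k p \<in> W} F"
    and turn: "\<And>p j. p \<in> holed_sphere k \<Longrightarrow> j < k \<Longrightarrow> p \<in> cap_circle k j \<Longrightarrow> F (half_turn k j p) = F p"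
  obtains f where "continuous_map (subtopology (nonorientable_surface k) W) euclidean f"
    "\<And>p. p \<in> holed_sphere k \<Longrightarrow> f (crosscap_class k p) = F p"
proof -
  let ?U = "{p \<in> holed_sphere k. crosscap_class k p \<in> W}"
  define f where "f x = F (SOME p. p \<in> holed_sphere k \<and> crosscap_class k p = x)" for x
  have f: "f (crosscap_class k p) = F p" if p: "p \<in> holed_sphere k" for p
  proof -
    define q where "q = (SOME q. q \<in> holed_sphere k \<and> crosscap_class k q = crosscap_class k p)"
    have "q \<in> holed_sphere k \<and> crosscap_class k q = crosscap_class k p"
      unfolding q_def by (rule someI[of _ p]) (use p in simp)
    then have "q \<in> crosscap_class k p" by (auto simp: crosscap_class_def)
    then have "F q = F p" using turn[OF p] by (auto simp: crosscap_class_def)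
    then show ?thesis by (simp add: f_def q_def)
  qed
  have "quotient_map (subtopology (top_of_set (holed_sphere k)) ?U) (subtopology (nonorientable_surface k) W) (crosscap_class k)"
    by (rule quotient_map_restriction[OF quotient_map_crosscap_class]) (use W in auto)
  moreover have "subtopology (top_of_set (holed_sphere k)) ?U = top_of_set ?U"
    by (simp add: subtopology_subtopology Int_absorb1 Collect_conj_eq)
  ultimately have q: "quotient_map (top_of_set ?U) (subtopology (nonorientable_surface k) W) (crosscap_class k)"
    by simp
  have "continuous_map (top_of_set ?U) euclidean (f \<circ> crosscap_class k)"
    by (rule continuous_map_eq[of _ _ F]) (use F f in auto)
  then have "continuous_map (subtopology (nonorientable_surface k) W) euclidean f"
    by (rule continuous_compose_quotient_map[OF q])
  then show thesis using f that by blast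
qed

section \<open>The holed spheres with at most two caps in coordinates\<close>

lemma inner_cap_centre:
  "p \<bullet> cap_centre 2 0 = Re (fst p)" "p \<bullet> cap_centre 2 1 = - Re (fst p)" "p \<bullet> cap_centre 1 0 = Re (fst p)"
  by (cases p; simp add: cap_centre_def inner_Pair inner_complex_def)+

lemma half_turn_eq:
  assumes "k = 2 \<and> j < 2 \<or> k = 1 \<and> j = 0"
  shows "half_turn k j p = (cnj (fst p), - snd p)"
proof -
  have "j = 0 \<or> j = 1" using assms by auto
  then show ?thesis using assms
    by (cases p)
      (auto simp: half_turn_def inner_cap_centre[simplified] cap_centre_def inner_Pair inner_complex_def complex_eq_iff)
qed

lemma sphere_iff: "(w, h) \<in> sphere (0::complex \<times> real) 1 \<longleftrightarrow> (Re w)\<^sup>2 + (Im w)\<^sup>2 + h\<^sup>2 = 1"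
  by (simp add: norm_Pair cmod_power2)

lemma lessThan_2: "{..<2::nat} = {0, 1}" by auto

lemma holed_sphere_2: "p \<in> holed_sphere 2 \<longleftrightarrow> p \<in> sphere 0 1 \<and> \<bar>Re (fst p)\<bar> \<le> sqrt 2 / 2"
  unfolding holed_sphere_def open_cap_def lessThan_2
  by (auto simp: inner_cap_centre[simplified] cos_45 not_less)

lemma abs_eq_pos_iff: "s > 0 \<Longrightarrow> \<bar>x\<bar> = s \<longleftrightarrow> x = s \<or> x = - s" for x s :: real
  by auto

lemma cap_circle_2: "(\<exists>j<2. p \<in> cap_circle 2 j) \<longleftrightarrow> p \<in> sphere 0 1 \<and> \<bar>Re (fst p)\<bar> = sqrt 2 / 2"
proof -
  have "(\<exists>j<2. p \<in> cap_circle 2 j) \<longleftrightarrow> p \<in> cap_circle 2 0 \<or> p \<in> cap_circle 2 1"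
    by (auto simp: less_2_cases_iff)
  also have "\<dots> \<longleftrightarrow> p \<in> sphere 0 1 \<and> \<bar>Re (fst p)\<bar> = sqrt 2 / 2"
  proof -
    have "x = s \<or> - x = s \<longleftrightarrow> \<bar>x\<bar> = s" if "s > 0" for x s :: real using that by auto
    from this[of "sqrt 2 / 2" "Re (fst p)"] show ?thesis
      unfolding cap_circle_def mem_Collect_eq inner_cap_centre[simplified] cos_45
      by (auto simp: inner_cap_centre[simplified] cos_45 simp del: mem_sphere_0)
  qed
  finally show ?thesis .
qed

lemma holed_sphere_1: "p \<in> holed_sphere 1 \<longleftrightarrow> p \<in> sphere 0 1 \<and> Re (fst p) \<le> 0"
  unfolding holed_sphere_def open_cap_def by (auto simp: inner_cap_centre[simplified] not_less)

lemma cap_circle_1: "p \<in> cap_circle 1 0 \<longleftrightarrow> p \<in> sphere 0 1 \<and> Re (fst p) = 0"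
  by (simp add: cap_circle_def inner_cap_centre[simplified])

lemma holed_sphere_0: "holed_sphere 0 = sphere 0 1"
  by (simp add: holed_sphere_def)

lemma crosscap_class_0: "crosscap_class 0 p = {p}"
  by (simp add: crosscap_class_def)

lemma crosscap_class_2:
  assumes "p \<in> holed_sphere 2"
  shows "crosscap_class 2 p = (if \<bar>Re (fst p)\<bar> = sqrt 2 / 2 then {p, (cnj (fst p), - snd p)} else {p})"
proof -
  define q where "q = (cnj (fst p), - snd p)"
  have h: "half_turn 2 j p = q" if "j < 2" for j
    unfolding q_def by (rule half_turn_eq) (use that in simp)
  have "{half_turn 2 j p | j. j < 2 \<and> p \<in> cap_circle 2 j}
      = (\<lambda>j. half_turn 2 j p) ` {j. j < 2 \<and> p \<in> cap_circle 2 j}" by blast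
  also have "\<dots> = (\<lambda>j. q) ` {j. j < 2 \<and> p \<in> cap_circle 2 j}"
    by (rule image_cong) (use h in \<open>simp_all only: mem_Collect_eq\<close>)
  also have "\<dots> = (if \<exists>j<2. p \<in> cap_circle 2 j then {q} else {})"
    by (auto simp: image_constant_conv)
  finally show ?thesis using assms unfolding crosscap_class_def cap_circle_2
    by (simp add: holed_sphere_2 q_def)
qed

lemma crosscap_class_1:
  assumes "p \<in> holed_sphere 1"
  shows "crosscap_class 1 p = (if Re (fst p) = 0 then {p, (cnj (fst p), - snd p)} else {p})"
proof -
  have "half_turn 1 0 p = (cnj (fst p), - snd p)" by (rule half_turn_eq) simp
  then have "{half_turn 1 j p | j. j < 1 \<and> p \<in> cap_circle 1 j}
      = (if p \<in> cap_circle 1 0 then {(cnj (fst p), - snd p)} else {})"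
    by auto
  moreover have "p \<in> cap_circle 1 0 \<longleftrightarrow> Re (fst p) = 0"
    using assms unfolding holed_sphere_1 cap_circle_1 by simp
  ultimately show ?thesis unfolding crosscap_class_def by simp
qed

text \<open>The components orthogonal to the axis through the cap centres. In these terms the
  identification at a cap circle keeps the axial coordinate and changes the sign of
  \<open>perp\<close>.\<close>

definition perp :: "complex \<times> real \<Rightarrow> complex" where
  "perp p = Complex (Im (fst p)) (snd p)"

lemma sphere_perp: "p \<in> sphere 0 1 \<longleftrightarrow> (Re (fst p))\<^sup>2 + (norm (perp p))\<^sup>2 = 1"
  by (cases p) (simp only: sphere_iff, simp add: perp_def cmod_power2 add.assoc)

lemma perp_turn: "perp (cnj (fst p), - snd p) = - perp p"
  by (simp add: perp_def complex_eq_iff)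

lemma point_eq_iff: "p = q \<longleftrightarrow> Re (fst p) = Re (fst q) \<and> perp p = perp q"
  by (cases p; cases q) (auto simp: perp_def complex_eq_iff)

lemma continuous_on_perp [continuous_intros]: "continuous_on S f \<Longrightarrow> continuous_on S (\<lambda>x. perp (f x))"
  unfolding perp_def Complex_eq by (intro continuous_intros)

text \<open>A point of the circle that represents the real line spanned by \<open>u\<close>: it does
  not distinguish \<open>u\<close> from \<open>- u\<close>.\<close>

definition unit_sq :: "complex \<Rightarrow> complex" where
  "unit_sq u = u\<^sup>2 / of_real ((norm u)\<^sup>2)"

lemma unit_sq_eq:
  assumes "u \<noteq> 0" "v \<noteq> 0" "unit_sq u = unit_sq v" "norm u = norm v"
  shows "u = v \<or> u = - v"
proof -
  have "u\<^sup>2 = v\<^sup>2" using assms by (simp add: unit_sq_def)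
  then show ?thesis by (simp add: power2_eq_iff)
qed

lemma continuous_on_unit_sq [continuous_intros]:
  "continuous_on S f \<Longrightarrow> (\<And>x. x \<in> S \<Longrightarrow> f x \<noteq> 0) \<Longrightarrow> continuous_on S (\<lambda>x. unit_sq (f x))"
  unfolding unit_sq_def by (intro continuous_intros) auto

lemma norm_unit_sq: "u \<noteq> 0 \<Longrightarrow> norm (unit_sq u) = 1"
  by (simp add: unit_sq_def norm_divide norm_power)

text \<open>The real line spanned by \<open>perp p\<close> fibres the surface over a circle. On a
  fibre, \<open>F2\<close> measures the position along the axis and \<open>F3\<close> the side of
  the line. \<open>F3\<close> shrinks to 0 at both cap circles, where opposite points are
  identified, so the two segments over a line close up to a circle. The factors
  \<open>sqrt 2\<close> and \<open>1 - 2 * (Re (fst p))\<^sup>2\<close> make it a unit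
  circle.\<close>

theorem parity_N2:
  fixes V :: "'v::linorder set"
  assumes "graph_embeds_in V E (nonorientable_surface 2)"
    and "finite D" "\<And>u w. (u, w) \<in> D \<Longrightarrow> u \<in> V \<and> w \<in> V \<and> {u, w} \<in> E"
  obtains m n where "parity_system D m n"
proof -
  let ?X = "nonorientable_surface 2" and ?H = "holed_sphere 2"
  have sub: "subtopology ?X (topspace ?X) = ?X" by simp
  have U: "{p \<in> ?H. crosscap_class 2 p \<in> topspace ?X} = ?H"
    by (auto simp: topspace_nonorientable_surface)
  have x2: "(Re (fst p))\<^sup>2 \<le> 1/2" if "p \<in> ?H" for p
  proof -
    have "\<bar>Re (fst p)\<bar>\<^sup>2 \<le> (sqrt 2 / 2)\<^sup>2" using that by (intro power_mono) (auto simp: holed_sphere_2)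
    then show ?thesis by (simp add: power_divide)
  qed
  have perp: "(norm (perp p))\<^sup>2 = 1 - (Re (fst p))\<^sup>2" "perp p \<noteq> 0" if "p \<in> ?H" for p
    using that x2[OF that] sphere_perp[of p] by (auto simp: holed_sphere_2 simp del: mem_sphere_0)
  define F1 where "F1 p = unit_sq (perp p)" for p
  define F2 where "F2 p = sqrt 2 * Re (fst p)" for p :: "complex \<times> real"
  define F3 where "F3 p = of_real (sqrt (1 - 2 * (Re (fst p))\<^sup>2) / norm (perp p)) * perp p" for p
  have turn: "F1 (half_turn 2 j p) = F1 p" "F2 (half_turn 2 j p) = F2 p" "F3 (half_turn 2 j p) = F3 p"
    if p: "p \<in> ?H" and j: "j < 2" "p \<in> cap_circle 2 j" for p j
  proof -
    have "\<bar>Re (fst p)\<bar> = sqrt 2 / 2" using cap_circle_2[of p] j by auto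
    then have "\<bar>Re (fst p)\<bar>\<^sup>2 = (sqrt 2 / 2)\<^sup>2" by (rule arg_cong)
    then have "(Re (fst p))\<^sup>2 = 1/2" by (simp add: power_divide)
    moreover have "half_turn 2 j p = (cnj (fst p), - snd p)" using j half_turn_eq by auto
    ultimately show "F1 (half_turn 2 j p) = F1 p" "F2 (half_turn 2 j p) = F2 p" "F3 (half_turn 2 j p) = F3 p"
      by (simp_all add: F1_def F2_def F3_def perp_turn unit_sq_def)
  qed
  have c1: "continuous_on ?H F1"
    unfolding F1_def by (intro continuous_intros perp(2))
  have c2: "continuous_on ?H F2"
    unfolding F2_def by (intro continuous_intros)
  have c3: "continuous_on ?H F3"
    unfolding F3_def by (intro continuous_intros) (use perp(2) in auto)
  have desc: "\<exists>f. continuous_map ?X euclidean f \<and> (\<forall>p\<in>?H. f (crosscap_class 2 p) = F p)"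
    if "continuous_on ?H F" "\<And>p j. p \<in> ?H \<Longrightarrow> j < 2 \<Longrightarrow> p \<in> cap_circle 2 j \<Longrightarrow> F (half_turn 2 j p) = F p"
    for F :: "complex \<times> real \<Rightarrow> 'c::topological_space"
    by (rule descend_to_surface[of 2 "topspace ?X" F])
      (use that in \<open>simp_all add: U[simplified], blast\<close>)
  obtain f1 where f1: "continuous_map ?X euclidean f1" "\<And>p. p \<in> ?H \<Longrightarrow> f1 (crosscap_class 2 p) = F1 p"
    using desc[OF c1 turn(1)] by blast
  obtain f2 where f2: "continuous_map ?X euclidean f2" "\<And>p. p \<in> ?H \<Longrightarrow> f2 (crosscap_class 2 p) = F2 p"
    using desc[OF c2 turn(2)] by blast
  obtain f3 where f3: "continuous_map ?X euclidean f3" "\<And>p. p \<in> ?H \<Longrightarrow> f3 (crosscap_class 2 p) = F3 p"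
    using desc[OF c3 turn(3)] by blast
  have nF3: "norm (F3 p) = sqrt (1 - 2 * (Re (fst p))\<^sup>2)" if "p \<in> ?H" for p
    using x2[OF that] perp(2)[OF that] by (simp add: F3_def norm_mult norm_divide)
  have same: "crosscap_class 2 p = crosscap_class 2 q"
    if p: "p \<in> ?H" and q: "q \<in> ?H" and eq: "F1 p = F1 q" "F2 p = F2 q" "F3 p = F3 q" for p q
  proof -
    have Re: "Re (fst p) = Re (fst q)" using eq(2) by (simp add: F2_def)
    then have n: "norm (perp p) = norm (perp q)"
      using perp(1)[OF p] perp(1)[OF q] by (metis norm_ge_zero power2_eq_imp_eq)
    then have pq: "perp p = perp q \<or> perp p = - perp q"
      using unit_sq_eq perp(2) p q eq(1) unfolding F1_def by blast
    show ?thesis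
    proof (cases "perp p = perp q")
      case True then show ?thesis using Re point_eq_iff by metis
    next
      \<comment> \<open>Here \<open>p\<close> and \<open>q\<close> differ by the sign of
        \<open>perp\<close>. The common value of \<open>F3\<close> must be 0, which happens only on
        the cap circles, where such points are identified.\<close>
      case False
      then have m: "perp p = - perp q" using pq by simp
      have "F3 p = - F3 q" using Re n by (simp add: F3_def m)
      then have "F3 q = 0" using eq(3) by simp
      then have "(Re (fst q))\<^sup>2 = 1/2" using perp(2)[OF q] by (simp add: F3_def)
      then have "(Re (fst q))\<^sup>2 = (sqrt 2 / 2)\<^sup>2" by (simp add: power_divide)
      then have "Re (fst q) = sqrt 2 / 2 \<or> Re (fst q) = - (sqrt 2 / 2)"
        by (simp only: power2_eq_iff)
      then have "\<bar>Re (fst q)\<bar> = sqrt 2 / 2" by (subst abs_eq_pos_iff) simp_all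
      moreover have "p = (cnj (fst q), - snd q)" using Re m by (simp add: point_eq_iff perp_turn)
      moreover from this have "(cnj (fst p), - snd p) = q" by (simp add: prod_eq_iff)
      ultimately show ?thesis using crosscap_class_2[OF p] crosscap_class_2[OF q] Re by (simp add: insert_commute)
    qed
  qed
  show thesis
  proof (rule embedding_parity[OF assms(1) f1(1) f2(1) f3(1) _ _ _ _ assms(2)])
    fix x assume "x \<in> topspace ?X"
    then obtain p where p: "p \<in> ?H" "x = crosscap_class 2 p" by (auto simp: topspace_nonorientable_surface)
    show "norm (f1 x) = 1" using f1(2) p perp(2) by (simp add: F1_def norm_unit_sq)
    show "(f2 x)\<^sup>2 + (norm (f3 x))\<^sup>2 = 1"
      using f2(2) f3(2) p x2[OF p(1)] nF3[OF p(1)] by (simp add: F2_def power_mult_distrib)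
    have "(F3 p)\<^sup>2 = of_real ((sqrt (1 - 2 * (Re (fst p))\<^sup>2))\<^sup>2) * F1 p"
      using perp(2)[OF p(1)] by (simp add: F3_def F1_def unit_sq_def power_mult_distrib power_divide)
    then show "(f3 x)\<^sup>2 = of_real ((norm (f3 x))\<^sup>2) * f1 x"
      using f1(2) f3(2) p nF3[OF p(1)] by simp
  next
    fix x y assume x: "x \<in> topspace ?X" and y: "y \<in> topspace ?X"
      and eq: "f1 x = f1 y" "f2 x = f2 y" "f3 x = f3 y"
    obtain p where p: "p \<in> ?H" "x = crosscap_class 2 p"
      using x by (auto simp: topspace_nonorientable_surface)
    obtain q where q: "q \<in> ?H" "y = crosscap_class 2 q"
      using y by (auto simp: topspace_nonorientable_surface)
    show "x = y"
      using same[OF p(1) q(1)] eq f1(2)[OF p(1)] f1(2)[OF q(1)] f2(2)[OF p(1)] f2(2)[OF q(1)]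
        f3(2)[OF p(1)] f3(2)[OF q(1)] unfolding p(2) q(2) by metis
  next
    show "u \<in> V \<and> w \<in> V \<and> {u, w} \<in> E" if "(u, w) \<in> D" for u w
      by (rule assms(3)[OF that])
  next
    fix m n assume "parity_system D m n"
    then show thesis by (rule that)
  qed
qed

section \<open>Embeddings that miss a point\<close>

lemma interior_finite_UN_closed:
  assumes "finite I" "\<And>i. i \<in> I \<Longrightarrow> closed (B i)" "\<And>i. i \<in> I \<Longrightarrow> interior (B i) = {}"
  shows "interior (\<Union>i\<in>I. B i) = {}"
  using assms
proof (induction I rule: finite_induct)
  case (insert i I)
  then show ?case
    using interior_closed_Un_empty_interior[of "B i" "\<Union>i\<in>I. B i"] by auto
qed simp

lemma graph_embeds_in_map:
  assumes "graph_embeds_in V E X" "continuous_map X Y h" "inj_on h (topspace X)"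
  shows "graph_embeds_in V E Y"
proof -
  obtain \<phi> \<gamma> where \<phi>: "inj_on \<phi> V" "\<phi> ` V \<subseteq> topspace X"
    and \<gamma>: "\<And>e. e \<in> E \<Longrightarrow> pathin X (\<gamma> e) \<and> inj_on (\<gamma> e) {0..1} \<and> {\<gamma> e 0, \<gamma> e 1} = \<phi> ` e \<and> \<gamma> e ` {0<..<1} \<inter> \<phi> ` V = {}"
    and \<gamma>2: "\<And>e e'. e \<in> E \<Longrightarrow> e' \<in> E \<Longrightarrow> e \<noteq> e' \<Longrightarrow> \<gamma> e ` {0<..<1} \<inter> \<gamma> e' ` {0<..<1} = {}"
    using assms(1) by (rule graph_embeds_inE) blast
  have im: "\<gamma> e ` {0..1} \<subseteq> topspace X" if "e \<in> E" for e
    using \<gamma>[OF that] unfolding pathin_def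
    by (metis continuous_map_image_subset_topspace topspace_euclidean_subtopology)
  have im': "\<gamma> e ` {0<..<1} \<subseteq> topspace X" if "e \<in> E" for e
    using im[OF that] by (meson greaterThanLessThan_subseteq_atLeastAtMost_iff image_mono order.refl subset_trans)
  have inj: "h ` A \<inter> h ` B = {}" if "A \<subseteq> topspace X" "B \<subseteq> topspace X" "A \<inter> B = {}" for A B
    using inj_on_image_Int[OF assms(3) that(1,2)] that(3) by simp
  show ?thesis
    unfolding graph_embeds_in_def
  proof (intro exI[of _ "h \<circ> \<phi>"] exI[of _ "\<lambda>e. h \<circ> \<gamma> e"] conjI ballI impI)
    show "inj_on (h \<circ> \<phi>) V" using \<phi> assms(3) by (meson comp_inj_on inj_on_subset)
    show "(h \<circ> \<phi>) ` V \<subseteq> topspace Y"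
      using \<phi>(2) continuous_map_image_subset_topspace[OF assms(2)] by (auto simp: image_subset_iff)
    fix e assume e: "e \<in> E"
    show "pathin Y (h \<circ> \<gamma> e)"
      using \<gamma>[OF e] assms(2) unfolding pathin_def by (metis continuous_map_compose)
    show "inj_on (h \<circ> \<gamma> e) {0..1}"
      using \<gamma>[OF e] im[OF e] assms(3) by (meson comp_inj_on inj_on_subset)
    have "{(h \<circ> \<gamma> e) 0, (h \<circ> \<gamma> e) 1} = h ` {\<gamma> e 0, \<gamma> e 1}" by simp
    then show "{(h \<circ> \<gamma> e) 0, (h \<circ> \<gamma> e) 1} = (h \<circ> \<phi>) ` e"
      using \<gamma>[OF e] by (metis image_comp)
    show "(h \<circ> \<gamma> e) ` {0<..<1} \<inter> (h \<circ> \<phi>) ` V = {}"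
      unfolding image_comp[symmetric] using \<gamma>[OF e] by (intro inj im'[OF e] \<phi>(2)) blast
    fix e' assume e': "e' \<in> E" "e \<noteq> e'"
    show "(h \<circ> \<gamma> e) ` {0<..<1} \<inter> (h \<circ> \<gamma> e') ` {0<..<1} = {}"
      unfolding image_comp[symmetric] by (intro inj im' \<gamma>2 e e')
  qed
qed

text \<open>Arcs have no interior points in a surface, by invariance of dimension.\<close>

lemma embedding_misses_point:
  fixes J :: "'b \<Rightarrow> 'c::t2_space" and \<psi> :: "complex \<Rightarrow> 'b"
  assumes emb: "graph_embeds_in V E X" and fin: "finite V" "finite E"
    and J: "continuous_map X euclidean J" "inj_on J (topspace X)"
    and \<psi>: "continuous_map euclidean X \<psi>" "inj \<psi>"
  obtains \<zeta> where "graph_embeds_in V E (subtopology X (topspace X - {\<psi> \<zeta>}))"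
proof -
  obtain \<phi> \<gamma> where \<phi>: "inj_on \<phi> V" "\<phi> ` V \<subseteq> topspace X"
    and \<gamma>: "\<And>e. e \<in> E \<Longrightarrow> pathin X (\<gamma> e) \<and> inj_on (\<gamma> e) {0..1} \<and> {\<gamma> e 0, \<gamma> e 1} = \<phi> ` e \<and> \<gamma> e ` {0<..<1} \<inter> \<phi> ` V = {}"
    and \<gamma>2: "\<And>e e'. e \<in> E \<Longrightarrow> e' \<in> E \<Longrightarrow> e \<noteq> e' \<Longrightarrow> \<gamma> e ` {0<..<1} \<inter> \<gamma> e' ` {0<..<1} = {}"
    using emb by (rule graph_embeds_inE) blast
  \<comment> \<open>The injection \<open>J\<close> stands for the Hausdorff property of the surface:
    it makes arcs closed and their inverses continuous.\<close>
  define f where "f = J \<circ> \<psi>"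
  define g where "g e = J \<circ> \<gamma> e" for e
  have \<psi>X: "\<psi> z \<in> topspace X" for z
    using \<psi>(1) by (simp add: continuous_map_def Pi_iff)
  have fc: "continuous_on A f" for A
    using continuous_map_compose[OF \<psi>(1) J(1)] unfolding f_def
    by (metis continuous_map_iff_continuous2 continuous_on_subset subset_UNIV)
  have fi: "inj f"
    unfolding f_def using \<psi>(2) J(2) \<psi>X by (meson comp_inj_on inj_on_subset image_subsetI)
  have \<gamma>X: "\<gamma> e ` {0..1} \<subseteq> topspace X" if "e \<in> E" for e
    using \<gamma>[OF that] unfolding pathin_def
    by (metis continuous_map_image_subset_topspace topspace_euclidean_subtopology)
  have gc: "continuous_on {0..1} (g e)" if "e \<in> E" for e
    using continuous_map_compose[of "top_of_set {0..1}" X "\<gamma> e" euclidean J] \<gamma>[OF that] J(1)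
    unfolding g_def pathin_def by simp
  have gi: "inj_on (g e) {0..1}" if "e \<in> E" for e
    unfolding g_def using \<gamma>[OF that] \<gamma>X[OF that] J(2) by (meson comp_inj_on inj_on_subset)
  define B where "B e = f -` (g e ` {0..1})" for e
  have Bcl: "closed (B e)" if "e \<in> E" for e
    unfolding B_def using gc[OF that]
    by (intro closed_vimage compact_imp_closed compact_continuous_image fc) auto
  have Bint: "interior (B e) = {}" if e: "e \<in> E" for e
  proof (rule ccontr)
    assume ne: "interior (B e) \<noteq> {}"
    let ?S = "interior (B e)" and ?h = "\<lambda>z. inv_into {0..1} (g e) (f z)"
    have S: "f ` ?S \<subseteq> g e ` {0..1}" using interior_subset[of "B e"] by (auto simp: B_def)
    have "continuous_on (g e ` {0..1}) (inv_into {0..1} (g e))"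
      by (rule continuous_on_inv[OF gc[OF e] compact_Icc]) (use gi[OF e] in auto)
    then have "continuous_on ?S ?h"
      by (rule continuous_on_compose2[OF _ fc S])
    moreover have "inj_on ?h ?S"
    proof (rule inj_onI)
      fix x y assume xy: "x \<in> ?S" "y \<in> ?S" "?h x = ?h y"
      then have "f x \<in> g e ` {0..1}" "f y \<in> g e ` {0..1}" using S by auto
      then have "f x = f y" using xy(3) by (metis f_inv_into_f)
      then show "x = y" using fi by (simp add: inj_eq)
    qed
    ultimately have "DIM(complex) \<le> DIM(real)"
      using ne by (intro invariance_of_dimension[of ?S ?h]) auto
    then show False by simp
  qed
  define P where "P = \<psi> -` (\<phi> ` V)"
  have "finite P" unfolding P_def using \<psi>(2) fin(1) by (intro finite_vimageI) auto
  have "interior (\<Union>e\<in>E. B e) = {}" by (rule interior_finite_UN_closed[OF fin(2) Bcl Bint])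
  then have "interior (P \<union> (\<Union>e\<in>E. B e)) = {}"
    using interior_closed_Un_empty_interior[of P "\<Union>e\<in>E. B e"] \<open>finite P\<close>
    by (simp add: finite_imp_closed empty_interior_finite)
  then have "P \<union> (\<Union>e\<in>E. B e) \<noteq> UNIV" using interior_UNIV UNIV_not_empty by metis
  then obtain \<zeta> where \<zeta>: "\<zeta> \<notin> P" "\<And>e. e \<in> E \<Longrightarrow> \<zeta> \<notin> B e" by blast
  have n1: "\<psi> \<zeta> \<notin> \<phi> ` V" using \<zeta>(1) by (simp add: P_def)
  have n2: "\<psi> \<zeta> \<notin> \<gamma> e ` {0..1}" if "e \<in> E" for e
    using \<zeta>(2)[OF that] by (auto simp: B_def f_def g_def)
  have "\<phi> ` V \<subseteq> topspace (subtopology X (topspace X - {\<psi> \<zeta>}))"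
    unfolding topspace_subtopology using \<phi>(2) n1 by blast
  moreover have "pathin (subtopology X (topspace X - {\<psi> \<zeta>})) (\<gamma> e)" if e: "e \<in> E" for e
  proof -
    have "\<gamma> e t \<in> topspace X - {\<psi> \<zeta>}" if "t \<in> {0..1}" for t
      using \<gamma>X[OF e] n2[OF e] that by (metis DiffI imageI singletonD subsetD)
    then show ?thesis using \<gamma>[OF e] by (simp add: pathin_subtopology)
  qed
  ultimately have "graph_embeds_in V E (subtopology X (topspace X - {\<psi> \<zeta>}))"
    unfolding graph_embeds_in_def
    by (intro exI[of _ \<phi>] exI[of _ \<gamma>] conjI ballI impI) (use \<phi>(1) \<gamma> \<gamma>2 in simp_all)
  then show thesis by (rule that)
qed

text \<open>The central projection of the plane to the open half sphere: the unit vector in the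
  direction of \<open>- 1\<close> on the axis and \<open>z\<close> orthogonal to it. It gives a disc
  both in the sphere and in the projective plane.\<close>

definition hem :: "complex \<Rightarrow> complex \<times> real" where
  "hem z = (let r = sqrt (1 + (norm z)\<^sup>2) in (Complex (- 1 / r) (Re z / r), Im z / r))"

lemma Re_hem: "Re (fst (hem z)) = - 1 / sqrt (1 + (norm z)\<^sup>2)"
  by (simp add: hem_def Let_def)

lemma perp_hem: "perp (hem z) = z / of_real (sqrt (1 + (norm z)\<^sup>2))"
  by (simp add: hem_def Let_def perp_def complex_eq_iff)

lemma hem_nz: "sqrt (1 + (norm z)\<^sup>2) > 0" for z :: complex
  by (simp add: add_pos_nonneg)

lemma Re_hem_neg: "Re (fst (hem z)) < 0"
  using hem_nz[of z] by (simp add: Re_hem)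

lemma hem_sphere: "hem z \<in> sphere 0 1"
proof -
  have "1 + (norm z)\<^sup>2 \<noteq> 0" using hem_nz[of z] by auto
  then show ?thesis
    unfolding sphere_perp Re_hem perp_hem using hem_nz[of z]
    by (simp add: norm_divide power_divide add_divide_distrib[symmetric])
qed

lemma inj_hem: "inj hem"
proof (rule injI)
  fix x y assume h: "hem x = hem y"
  have *: "z = perp (hem z) * of_real (- 1 / Re (fst (hem z)))" for z
    using hem_nz[of z] by (simp add: Re_hem perp_hem)
  show "x = y" using *[of x] *[of y] h by simp
qed

lemma continuous_on_hem: "continuous_on S hem"
  unfolding hem_def Let_def Complex_eq
  by (intro continuous_intros) (use hem_nz in \<open>force simp: less_le\<close>)+

lemma hem_class:
  assumes "k = 0 \<or> k = 1"
  shows "hem z \<in> holed_sphere k" "crosscap_class k (hem z) = {hem z}"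
proof -
  have 1: "hem z \<in> holed_sphere 1" using hem_sphere Re_hem_neg[of z] unfolding holed_sphere_1 by auto
  show "hem z \<in> holed_sphere k" using assms 1 hem_sphere by (auto simp: holed_sphere_0)
  show "crosscap_class k (hem z) = {hem z}"
  proof (cases "k = 0")
    case True then show ?thesis by (simp add: crosscap_class_0)
  next
    case False
    then have k: "k = 1" using assms by simp
    have "Re (fst (hem z)) \<noteq> 0" using Re_hem_neg[of z] by simp
    then show ?thesis unfolding k crosscap_class_1[OF 1] by (simp only: if_False)
  qed
qed

definition chart :: "nat \<Rightarrow> complex \<Rightarrow> (complex \<times> real) set" where
  "chart k z = crosscap_class k (hem z)"

lemma chart:
  assumes "k = 0 \<or> k = 1"
  shows "continuous_map euclidean (nonorientable_surface k) (chart k)" "inj (chart k)"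
proof -
  have "continuous_map euclidean (top_of_set (holed_sphere k)) hem"
    using hem_class(1)[OF assms] continuous_on_hem by (auto simp: continuous_map_in_subtopology)
  then have "continuous_map euclidean (nonorientable_surface k) (crosscap_class k \<circ> hem)"
    by (rule continuous_map_compose[OF _ quotient_imp_continuous_map[OF quotient_map_crosscap_class]])
  then show "continuous_map euclidean (nonorientable_surface k) (chart k)"
    by (simp add: chart_def[abs_def] o_def)
  show "inj (chart k)"
    using inj_hem unfolding inj_def chart_def hem_class(2)[OF assms] by simp
qed

lemma open_complement_chart:
  assumes "k = 0 \<or> k = 1"
  shows "openin (nonorientable_surface k) (topspace (nonorientable_surface k) - {chart k z})"
    and "{p \<in> holed_sphere k. crosscap_class k p \<in> topspace (nonorientable_surface k) - {chart k z}} = holed_sphere k - {hem z}"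
proof -
  have "crosscap_class k p = {hem z} \<longleftrightarrow> p = hem z" for p
  proof
    assume eq: "crosscap_class k p = {hem z}"
    have "p \<in> crosscap_class k p" by (simp add: crosscap_class_def)
    then show "p = hem z" unfolding eq by simp
  qed (simp add: hem_class(2)[OF assms])
  then show *: "{p \<in> holed_sphere k. crosscap_class k p \<in> topspace (nonorientable_surface k) - {chart k z}} = holed_sphere k - {hem z}"
    using hem_class(2)[OF assms] by (auto simp: topspace_nonorientable_surface chart_def)
  show "openin (nonorientable_surface k) (topspace (nonorientable_surface k) - {chart k z})"
    unfolding openin_nonorientable_surface *
    by (auto simp: topspace_nonorientable_surface intro!: openin_delete)
qed

text \<open>A finite graph on the sphere misses a point, the rest of the sphere is a plane, and the
  plane is a disc in the projective plane.\<close>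

lemma N0_imp_N1:
  assumes "graph_embeds_in V E (nonorientable_surface 0)" "finite V" "finite E"
  shows "graph_embeds_in V E (nonorientable_surface 1)"
proof -
  let ?X = "nonorientable_surface 0"
  have top: "openin ?X (topspace ?X)" by simp
  obtain J where J: "continuous_map ?X euclidean J" "\<And>p. p \<in> holed_sphere 0 \<Longrightarrow> J (crosscap_class 0 p) = p"
    by (rule descend_to_surface[OF top, of "\<lambda>p. p"]) (auto simp: continuous_on_id)
  have "inj_on J (topspace ?X)"
    by (rule inj_onI) (use J(2) in \<open>auto simp: topspace_nonorientable_surface\<close>)
  then obtain \<zeta> where e: "graph_embeds_in V E (subtopology ?X (topspace ?X - {chart 0 \<zeta>}))"
    using embedding_misses_point[OF assms J(1) _ chart] by blast
  \<comment> \<open>With this normal vector the hyperplane consists of the points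
    \<open>(z, 0)\<close>, so \<open>fst\<close> identifies it with the complex plane.\<close>
  have "(0::complex, 1::real) \<noteq> 0" by (simp add: zero_prod_def)
  then have "(sphere 0 1 - {hem \<zeta>}) homeomorphic {x. (0::complex, 1::real) \<bullet> x = 0}"
    by (intro homeomorphic_punctured_sphere_hyperplane hem_sphere) auto
  then obtain f g where fg: "homeomorphism (sphere 0 1 - {hem \<zeta>}) {x. (0::complex, 1::real) \<bullet> x = 0} f g"
    unfolding homeomorphic_def by blast
  have f: "continuous_on (sphere 0 1 - {hem \<zeta>}) f" "inj_on f (sphere 0 1 - {hem \<zeta>})"
      "f ` (sphere 0 1 - {hem \<zeta>}) = {x. (0::complex, 1::real) \<bullet> x = 0}"
    by (rule homeomorphism_cont1[OF fg], rule inj_on_inverseI[of _ g f], erule homeomorphism_apply1[OF fg],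
        rule homeomorphism_image1[OF fg])
  define F where "F = fst \<circ> f"
  have F: "continuous_on (sphere 0 1 - {hem \<zeta>}) F"
    unfolding F_def o_def using f(1) by (intro continuous_intros)
  have "snd (f p) = 0" if "p \<in> sphere 0 1 - {hem \<zeta>}" for p
    using f(3) that by (cases "f p") (force simp: inner_Pair)
  then have Fi: "inj_on F (sphere 0 1 - {hem \<zeta>})"
    using f(2) unfolding inj_on_def F_def by (metis comp_apply prod.expand)
  note o = open_complement_chart[of 0 \<zeta>, simplified]
  obtain h where h: "continuous_map (subtopology ?X (topspace ?X - {chart 0 \<zeta>})) euclidean h"
      "\<And>p. p \<in> holed_sphere 0 \<Longrightarrow> h (crosscap_class 0 p) = F p"
    by (rule descend_to_surface[OF o(1), of F]) (use F o(2) in \<open>auto simp: holed_sphere_0\<close>)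
  have "inj_on h (topspace (subtopology ?X (topspace ?X - {chart 0 \<zeta>})))"
  proof (rule inj_onI)
    have rep: "\<exists>p. p \<in> sphere 0 1 - {hem \<zeta>} \<and> x = crosscap_class 0 p"
      if "x \<in> topspace (subtopology ?X (topspace ?X - {chart 0 \<zeta>}))" for x
    proof -
      have x': "x \<in> topspace ?X - {chart 0 \<zeta>}" using that by simp
      then obtain p where p: "p \<in> holed_sphere 0" "x = crosscap_class 0 p"
        unfolding topspace_nonorientable_surface by blast
      then have "p \<in> holed_sphere 0 - {hem \<zeta>}" using x' o(2) by blast
      then show ?thesis using p(2) unfolding holed_sphere_0 by blast
    qed
    fix x y assume x: "x \<in> topspace (subtopology ?X (topspace ?X - {chart 0 \<zeta>}))"
      and y: "y \<in> topspace (subtopology ?X (topspace ?X - {chart 0 \<zeta>}))" and eq: "h x = h y"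
    obtain p where p: "p \<in> sphere 0 1 - {hem \<zeta>}" "x = crosscap_class 0 p" using rep[OF x] by blast
    obtain q where q: "q \<in> sphere 0 1 - {hem \<zeta>}" "y = crosscap_class 0 q" using rep[OF y] by blast
    have "F p = F q" using eq p q h(2)[of p] h(2)[of q] unfolding holed_sphere_0 by simp
    then have "p = q" by (rule inj_onD[OF Fi _ p(1) q(1)])
    then show "x = y" using p(2) q(2) by simp
  qed
  then have "graph_embeds_in V E (euclidean :: complex topology)"
    by (rule graph_embeds_in_map[OF e h(1)])
  then show ?thesis
    by (rule graph_embeds_in_map) (use chart[of 1] in auto)
qed

lemma sphere_scale_pos:
  assumes "p \<in> sphere 0 1" "q \<in> sphere 0 1" "Re (fst p) = l * Re (fst q)" "perp p = of_real l * perp q"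
  shows "\<bar>l\<bar> = 1"
proof -
  have "l\<^sup>2 * ((Re (fst q))\<^sup>2 + (norm (perp q))\<^sup>2) = 1"
    using assms(1) unfolding sphere_perp assms(3,4) by (simp add: norm_mult power_mult_distrib algebra_simps)
  then have "l\<^sup>2 = 1" using assms(2) unfolding sphere_perp by simp
  then show ?thesis by (simp add: power2_eq_1_iff abs_if) auto
qed

lemma antipodal_same_class_1:
  assumes "p \<in> holed_sphere 1" "q \<in> holed_sphere 1"
    and "Re (fst p) = - Re (fst q)" "perp p = - perp q"
  shows "crosscap_class 1 p = crosscap_class 1 q"
proof -
  have 0: "Re (fst p) = 0" "Re (fst q) = 0" using assms(1-3) unfolding holed_sphere_1 by auto
  have "p = (cnj (fst q), - snd q)" using 0 assms(4) by (simp add: point_eq_iff perp_turn)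
  moreover from this have "q = (cnj (fst p), - snd p)" by (simp add: prod_eq_iff)
  ultimately show ?thesis
    unfolding crosscap_class_1[OF assms(1)] crosscap_class_1[OF assms(2)] using 0 by (metis insert_commute)
qed

text \<open>Quadratic functions of the coordinates agree at antipodal points and determine a point
  up to its sign; this is a Veronese map of the projective plane. It supplies the injection for
  \<open>embedding_misses_point\<close>.\<close>

lemma surface_1_coordinate:
  obtains J :: "(complex \<times> real) set \<Rightarrow> real \<times> complex \<times> complex" where
    "continuous_map (nonorientable_surface 1) euclidean J" "inj_on J (topspace (nonorientable_surface 1))"
proof -
  define F where "F p = ((Re (fst p))\<^sup>2, of_real (Re (fst p)) * perp p, (perp p)\<^sup>2)" for p
  have top: "openin (nonorientable_surface 1) (topspace (nonorientable_surface 1))" by simp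
  have turn: "F (half_turn 1 j p) = F p" if "j < 1" "p \<in> cap_circle 1 j" for j p
  proof -
    have "j = 0" using that by simp
    then have "Re (fst p) = 0" "half_turn 1 j p = (cnj (fst p), - snd p)"
      using that half_turn_eq[of 1 0] cap_circle_1 by auto
    then show ?thesis by (simp add: F_def perp_turn)
  qed
  obtain J where J: "continuous_map (subtopology (nonorientable_surface 1) (topspace (nonorientable_surface 1))) euclidean J"
      "\<And>p. p \<in> holed_sphere 1 \<Longrightarrow> J (crosscap_class 1 p) = F p"
  proof (rule descend_to_surface[OF top, of F])
    show "continuous_on {p \<in> holed_sphere 1. crosscap_class 1 p \<in> topspace (nonorientable_surface 1)} F"
      unfolding F_def by (intro continuous_intros)
  qed (use turn in auto)
  have "inj_on J (topspace (nonorientable_surface 1))"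
  proof (rule inj_onI)
    fix x y assume "x \<in> topspace (nonorientable_surface 1)" "y \<in> topspace (nonorientable_surface 1)" and eq: "J x = J y"
    then obtain p q where p: "p \<in> holed_sphere 1" "x = crosscap_class 1 p"
      and q: "q \<in> holed_sphere 1" "y = crosscap_class 1 q"
      unfolding topspace_nonorientable_surface by blast
    have "F p = F q" using eq J(2) p q by simp
    then have F: "(Re (fst p))\<^sup>2 = (Re (fst q))\<^sup>2" "(perp p)\<^sup>2 = (perp q)\<^sup>2"
      "of_real (Re (fst p)) * perp p = of_real (Re (fst q)) * perp q" by (simp_all add: F_def)
    have neg: "Re (fst p) \<le> 0" "Re (fst q) \<le> 0" using p q unfolding holed_sphere_1 by auto
    then have Re: "Re (fst p) = Re (fst q)"
      using F(1) by (simp add: power2_eq_iff) linarith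
    show "x = y"
    proof (cases "perp p = perp q")
      case True
      then have "p = q" using Re by (simp add: point_eq_iff)
      then show ?thesis using p q by simp
    next
      case False
      then have m: "perp p = - perp q" using F(2) by (simp add: power2_eq_iff)
      then have "perp q \<noteq> 0" using False by auto
      then have "Re (fst q) = 0" using F(3) unfolding m Re
        by (metis False m minus_mult_right mult_cancel_left of_real_eq_0_iff mult_minus_right)
      then show ?thesis
        using antipodal_same_class_1[OF p(1) q(1)] Re m p(2) q(2) by simp
    qed
  qed
  then show thesis using that J(1) by simp
qed

text \<open>Projection along the missing line fibres the rest of the projective plane over a circle
  of lines, with the open half circle \<open>F2 > 0\<close> as fibre. So the Moebius band is half of
  the Klein bottle, and \<open>wind_Re_pos\<close> removes the winding numbers from the
  relation.\<close>

theorem parity_N1: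
  fixes V :: "'v::linorder set"
  assumes emb: "graph_embeds_in V E (nonorientable_surface 1)" and "finite V" "finite E"
    and "finite D" "\<And>u w. (u, w) \<in> D \<Longrightarrow> u \<in> V \<and> w \<in> V \<and> {u, w} \<in> E"
  obtains m n where "parity_system D m n" "\<forall>e\<in>D. n e = 0"
proof -
  let ?H = "holed_sphere 1" and ?N = "nonorientable_surface 1"
  obtain J :: "(complex \<times> real) set \<Rightarrow> real \<times> complex \<times> complex"
    where J: "continuous_map ?N euclidean J" "inj_on J (topspace ?N)"
    by (rule surface_1_coordinate)
  obtain \<zeta> where e: "graph_embeds_in V E (subtopology ?N (topspace ?N - {chart 1 \<zeta>}))"
    by (rule embedding_misses_point[OF assms(1-3) J chart]) auto
  let ?X = "subtopology ?N (topspace ?N - {chart 1 \<zeta>})"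
  define a where "a = hem \<zeta>"
  have a: "a \<in> sphere 0 1" "Re (fst a) < 0" using hem_sphere Re_hem_neg by (auto simp: a_def simp del: mem_sphere_0)
  have oc: "openin ?N (topspace ?N - {chart 1 \<zeta>})"
    "{p \<in> ?H. crosscap_class 1 p \<in> topspace ?N - {chart 1 \<zeta>}} = ?H - {a}"
    using open_complement_chart[of 1 \<zeta>] unfolding a_def by blast+
  text \<open>Linear coordinates in which the missing line is the axis \<open>u = 0\<close>.\<close>
  define u where "u p = perp p - of_real (Re (fst p) / Re (fst a)) * perp a" for p
  have u0: "u p \<noteq> 0" if p: "p \<in> ?H - {a}" for p
  proof
    assume "u p = 0"
    define l where "l = Re (fst p) / Re (fst a)"
    have l: "Re (fst p) = l * Re (fst a)" "perp p = of_real l * perp a"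
      using \<open>u p = 0\<close> a(2) by (auto simp: u_def l_def)
    have pS: "p \<in> sphere 0 1" "Re (fst p) \<le> 0" using p holed_sphere_1[of p] by auto
    have "\<bar>l\<bar> = 1" by (rule sphere_scale_pos[OF pS(1) a(1) l])
    moreover have "l \<ge> 0" using pS(2) a(2) by (simp add: l_def divide_nonpos_nonpos)
    ultimately have "p = a" using l by (simp add: point_eq_iff)
    then show False using p by simp
  qed
  define d where "d p = sqrt ((norm (u p))\<^sup>2 + (Re (fst p))\<^sup>2)" for p
  have d: "d p > 0" "(d p)\<^sup>2 = (norm (u p))\<^sup>2 + (Re (fst p))\<^sup>2" if "p \<in> ?H - {a}" for p
    using u0[OF that] by (auto simp: d_def add_pos_nonneg)
  define F1 where "F1 p = unit_sq (u p)" for p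
  define F2 where "F2 p = norm (u p) / d p" for p
  define F3 where "F3 p = of_real (Re (fst p) / (d p * norm (u p))) * u p" for p
  have uc: "continuous_on (?H - {a}) u" unfolding u_def using a(2) by (intro continuous_intros) auto
  have dc: "continuous_on (?H - {a}) d" unfolding d_def by (intro continuous_intros uc)
  have c1: "continuous_on (?H - {a}) F1" unfolding F1_def by (intro continuous_intros uc u0)
  have d0: "d p \<noteq> 0" if "p \<in> ?H - {a}" for p using d(1)[OF that] by simp
  have c2: "continuous_on (?H - {a}) F2" unfolding F2_def by (intro continuous_intros uc dc ballI d0)
  have c3: "continuous_on (?H - {a}) F3"
    unfolding F3_def by (intro continuous_intros uc dc) (use d0 u0 in auto)
  have turn: "F1 (half_turn 1 j p) = F1 p" "F2 (half_turn 1 j p) = F2 p" "F3 (half_turn 1 j p) = F3 p"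
    if "j < 1" "p \<in> cap_circle 1 j" for p j
  proof -
    have "j = 0" using that by simp
    then have *: "Re (fst p) = 0" "half_turn 1 j p = (cnj (fst p), - snd p)"
      using that half_turn_eq[of 1 0] cap_circle_1 by auto
    then have "u (half_turn 1 j p) = - u p" by (simp add: u_def perp_turn)
    moreover have "Re (fst (half_turn 1 j p)) = 0" using * by simp
    ultimately show "F1 (half_turn 1 j p) = F1 p" "F2 (half_turn 1 j p) = F2 p" "F3 (half_turn 1 j p) = F3 p"
      using *(1) by (simp_all add: F1_def F2_def F3_def d_def unit_sq_def)
  qed
  have desc: "\<exists>f. continuous_map ?X euclidean f \<and> (\<forall>p\<in>?H. f (crosscap_class 1 p) = F p)"
    if Fc: "continuous_on (?H - {a}) F" and Ft: "\<And>p j. j < 1 \<Longrightarrow> p \<in> cap_circle 1 j \<Longrightarrow> F (half_turn 1 j p) = F p"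
    for F :: "complex \<times> real \<Rightarrow> 'c::topological_space"
  proof -
    have "continuous_on {p \<in> ?H. crosscap_class 1 p \<in> topspace ?N - {chart 1 \<zeta>}} F"
      unfolding oc(2) by (rule Fc)
    then obtain f where "continuous_map ?X euclidean f" "\<And>p. p \<in> ?H \<Longrightarrow> f (crosscap_class 1 p) = F p"
      by (rule descend_to_surface[OF oc(1)]) (use Ft in auto)
    then show ?thesis by blast
  qed
  obtain f1 where f1: "continuous_map ?X euclidean f1" "\<And>p. p \<in> ?H \<Longrightarrow> f1 (crosscap_class 1 p) = F1 p"
    using desc[OF c1 turn(1)] by blast
  obtain f2 where f2: "continuous_map ?X euclidean f2" "\<And>p. p \<in> ?H \<Longrightarrow> f2 (crosscap_class 1 p) = F2 p"
    using desc[OF c2 turn(2)] by blast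
  obtain f3 where f3: "continuous_map ?X euclidean f3" "\<And>p. p \<in> ?H \<Longrightarrow> f3 (crosscap_class 1 p) = F3 p"
    using desc[OF c3 turn(3)] by blast
  have rep: "\<exists>p. p \<in> ?H - {a} \<and> x = crosscap_class 1 p" if x: "x \<in> topspace ?X" for x
  proof -
    have x': "x \<in> topspace ?N - {chart 1 \<zeta>}" using x by simp
    then obtain p where p: "p \<in> ?H" "x = crosscap_class 1 p" unfolding topspace_nonorientable_surface by blast
    then have "p \<in> ?H - {a}" using x' oc(2) by blast
    then show ?thesis using p(2) by blast
  qed
  have nF3: "norm (F3 p) = \<bar>Re (fst p)\<bar> / d p" if "p \<in> ?H - {a}" for p
    using d(1)[OF that] u0[OF that] by (simp add: F3_def norm_mult norm_divide)
  have same: "crosscap_class 1 p = crosscap_class 1 q"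
    if p: "p \<in> ?H - {a}" and q: "q \<in> ?H - {a}" and eq: "F1 p = F1 q" "F2 p = F2 q" "F3 p = F3 q" for p q
  proof -
    define l where "l = d p / d q"
    have l0: "l > 0" "d p = l * d q" using d(1)[OF p] d(1)[OF q] by (auto simp: l_def)
    have nu: "norm (u p) = l * norm (u q)"
      using eq(2) d(1)[OF p] d(1)[OF q] by (simp add: F2_def l_def field_simps)
    have "unit_sq (of_real l * u q) = unit_sq (u q)"
      using l0(1) by (simp add: unit_sq_def norm_mult power_mult_distrib)
    then have "u p = of_real l * u q \<or> u p = - (of_real l * u q)"
      using unit_sq_eq[of "u p" "of_real l * u q"] u0[OF p] u0[OF q] l0(1) eq(1) nu
      by (simp add: F1_def norm_mult)
    \<comment> \<open>It will follow that \<open>p\<close> is \<open>s * l\<close> times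
      \<open>q\<close>; both have norm 1, so \<open>l = 1\<close>. The sign - 1 is possible only on
      the boundary of the half sphere, where antipodal points are identified.\<close>
    then obtain s :: real where s: "s = 1 \<or> s = - 1" "u p = of_real (s * l) * u q"
      by (metis mult_1 mult_minus1 of_real_minus mult_minus_left)
    have "of_real (Re (fst p) / (d p * norm (u p)) * (s * l)) * u q = of_real (Re (fst q) / (d q * norm (u q))) * u q"
      using eq(3) unfolding F3_def s(2) by (simp add: norm_mult mult_ac)
    then have "Re (fst p) / (d p * norm (u p)) * (s * l) = Re (fst q) / (d q * norm (u q))"
      using u0[OF q] by (metis mult_right_cancel of_real_eq_iff)
    then have "Re (fst p) * s = l * Re (fst q)"
      using l0 nu d(1)[OF q] u0[OF q] by (simp add: field_simps)
    then have Re: "Re (fst p) = (s * l) * Re (fst q)" using s(1) by auto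
    have pp: "perp p = of_real (s * l) * perp q"
      using s(2) unfolding u_def Re by (simp add: algebra_simps)
    have pqS: "p \<in> sphere 0 1" "q \<in> sphere 0 1" using p q holed_sphere_1 by auto
    have "\<bar>s * l\<bar> = 1" by (rule sphere_scale_pos[OF pqS Re pp])
    then have l: "l = 1" using l0(1) s(1) by (auto simp: abs_mult)
    show ?thesis
    proof (cases "s = 1")
      case True
      then have "p = q" using Re pp l by (simp add: point_eq_iff)
      then show ?thesis by simp
    next
      case False
      then have "s = - 1" using s(1) by simp
      then show ?thesis using Re pp l p q by (intro antipodal_same_class_1) auto
    qed
  qed
  show thesis
  proof (rule embedding_parity[OF e f1(1) f2(1) f3(1) _ _ _ _ assms(4)])
    fix x assume "x \<in> topspace ?X"
    then obtain p where p: "p \<in> ?H - {a}" "x = crosscap_class 1 p" using rep by blast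
    have pH: "p \<in> ?H" using p by simp
    note v = f1(2)[OF pH, folded p(2)] f2(2)[OF pH, folded p(2)] f3(2)[OF pH, folded p(2)]
    show "norm (f1 x) = 1" unfolding v F1_def by (rule norm_unit_sq[OF u0[OF p(1)]])
    show "(f2 x)\<^sup>2 + (norm (f3 x))\<^sup>2 = 1"
      unfolding v nF3[OF p(1)] using d[OF p(1)] u0[OF p(1)]
      by (simp add: F2_def power_divide add_divide_distrib[symmetric])
    have "(F3 p)\<^sup>2 = of_real ((\<bar>Re (fst p)\<bar> / d p)\<^sup>2) * F1 p"
      using u0[OF p(1)] by (simp add: F3_def F1_def unit_sq_def power_mult_distrib power_divide)
    then show "(f3 x)\<^sup>2 = of_real ((norm (f3 x))\<^sup>2) * f1 x"
      unfolding v nF3[OF p(1)] .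
  next
    fix x y assume x: "x \<in> topspace ?X" and y: "y \<in> topspace ?X"
      and eq: "f1 x = f1 y" "f2 x = f2 y" "f3 x = f3 y"
    obtain p where p: "p \<in> ?H - {a}" "x = crosscap_class 1 p" using rep[OF x] by blast
    obtain q where q: "q \<in> ?H - {a}" "y = crosscap_class 1 q" using rep[OF y] by blast
    have H: "p \<in> ?H" "q \<in> ?H" using p q by auto
    show "x = y"
      using same[OF p(1) q(1)] eq f1(2)[OF H(1)] f1(2)[OF H(2)] f2(2)[OF H(1)] f2(2)[OF H(2)]
        f3(2)[OF H(1)] f3(2)[OF H(2)] unfolding p(2) q(2) by metis
  next
    show "v \<in> V \<and> w \<in> V \<and> {v, w} \<in> E" if "(v, w) \<in> D" for v w
      by (rule assms(5)[OF that])
  next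
    fix m n assume ps: "parity_system D m n" and "(\<And>x. x \<in> topspace ?X \<Longrightarrow> f2 x > 0) \<Longrightarrow> \<forall>e\<in>D. n e = 0"
    moreover have "f2 x > 0" if x: "x \<in> topspace ?X" for x
    proof -
      obtain p where p: "p \<in> ?H - {a}" "x = crosscap_class 1 p" using rep[OF x] by blast
      then have "f2 x = F2 p" using f2(2) by simp
      then show ?thesis using d(1)[OF p(1)] u0[OF p(1)] by (simp add: F2_def)
    qed
    ultimately show thesis using that by blast
  qed
qed

section \<open>Parity obstructions\<close>

lemma bit_cancel: "x + x = 0" "x + (x + y) = y" "x + 0 = x" "0 + x = x" for x y :: bit
  by (cases x; cases y; simp)+

lemma of_bool_less_swap: "a \<noteq> b \<Longrightarrow> of_bool (b < a) = (1 + of_bool (a < b) :: bit)" for a b :: "'v::linorder"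
  by (cases "a < b") auto

text \<open>
  The parity relation with coefficients in the field with two elements. In the basis used
  here the intersection form of the Klein bottle is the standard scalar product.
\<close>

locale bit_drawing =
  fixes adj :: "'v::linorder \<Rightarrow> 'v \<Rightarrow> bool" and Y :: "'v \<Rightarrow> 'v \<Rightarrow> 'v \<Rightarrow> bit" and s t :: "'v \<Rightarrow> 'v \<Rightarrow> bit"
  assumes rel: "adj a b \<Longrightarrow> adj c d \<Longrightarrow> distinct [a, b, c, d] \<Longrightarrow>
      Y a c d + Y b c d + Y c a b + Y d a b
        + of_bool (a < c) + of_bool (a < d) + of_bool (b < c) + of_bool (b < d)
        + s a b * s c d + t a b * t c d = 0"
    and s_commute: "s a b = s b a" and t_commute: "t a b = t b a"
begin

definition cyc :: "('v \<Rightarrow> 'v \<Rightarrow> bit) \<Rightarrow> 'v \<Rightarrow> 'v \<Rightarrow> 'v \<Rightarrow> bit" where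
  "cyc f a b c = f a b + f b c + f a c"

text \<open>Add the relations for the nine pairs of edges. Each term \<open>Y v f\<close> occurs for
  both edges of the triangle at \<open>v\<close>, and each order term occurs four times, so only the
  intersection number of the two triangles remains.\<close>

lemma disjoint_triangles:
  assumes "adj a b" "adj b c" "adj a c" "adj d e" "adj e f" "adj d f" "distinct [a, b, c, d, e, f]"
  shows "cyc s a b c * cyc s d e f + cyc t a b c * cyc t d e f = 0"
proof -
  note r = rel[of a b d e] rel[of a b e f] rel[of a b d f] rel[of b c d e] rel[of b c e f] rel[of b c d f]
    rel[of a c d e] rel[of a c e f] rel[of a c d f]
  define R where "R = (\<lambda>a b c d. Y a c d + Y b c d + Y c a b + Y d a b
        + of_bool (a < c) + of_bool (a < d) + of_bool (b < c) + of_bool (b < d)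
        + s a b * s c d + t a b * t c d)"
  have "R a b d e = 0" "R a b e f = 0" "R a b d f = 0" "R b c d e = 0" "R b c e f = 0" "R b c d f = 0"
    "R a c d e = 0" "R a c e f = 0" "R a c d f = 0"
    unfolding R_def by (rule r; use assms in auto)+
  then have "R a b d e + R a b e f + R a b d f + R b c d e + R b c e f + R b c d f
    + R a c d e + R a c e f + R a c d f = 0"
    by (simp only: bit_cancel)
  then show ?thesis
    unfolding R_def cyc_def
    by (simp only: distrib_left distrib_right add.assoc add.commute add.left_commute bit_cancel)
qed

text \<open>Add the relations for the 15 pairs of disjoint edges. Each term \<open>Y v f\<close>
  occurs twice, and the order terms leave 1, as the diagonals of a convex pentagon have five
  crossings. The products regroup into products of triangles through \<open>r\<close>, which
  generate the cycle space.\<close>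

lemma K5:
  assumes "adj r a" "adj r b" "adj r c" "adj r d" "adj a b" "adj a c" "adj a d" "adj b c" "adj b d" "adj c d"
    and "distinct [r, a, b, c, d]"
  shows "cyc s r a b * cyc s r c d + cyc t r a b * cyc t r c d
    + (cyc s r a c * cyc s r b d + cyc t r a c * cyc t r b d)
    + (cyc s r a d * cyc s r b c + cyc t r a d * cyc t r b c) = 1"
proof -
  define R where "R = (\<lambda>a b c d. Y a c d + Y b c d + Y c a b + Y d a b
        + of_bool (a < c) + of_bool (a < d) + of_bool (b < c) + of_bool (b < d)
        + s a b * s c d + t a b * t c d)"
  note r = rel[of a b c d] rel[of a c b d] rel[of a d b c] rel[of r a b c] rel[of r a b d] rel[of r a c d]
    rel[of r b a c] rel[of r b a d] rel[of r b c d] rel[of r c a b] rel[of r c a d] rel[of r c b d]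
    rel[of r d a b] rel[of r d a c] rel[of r d b c]
  have "R a b c d = 0" "R a c b d = 0" "R a d b c = 0" "R r a b c = 0" "R r a b d = 0" "R r a c d = 0"
    "R r b a c = 0" "R r b a d = 0" "R r b c d = 0" "R r c a b = 0" "R r c a d = 0" "R r c b d = 0"
    "R r d a b = 0" "R r d a c = 0" "R r d b c = 0"
    unfolding R_def by (rule r; use assms in auto)+
  then have "R a b c d + R a c b d + R a d b c + R r a b c + R r a b d + R r a c d
    + R r b a c + R r b a d + R r b c d + R r c a b + R r c a d + R r c b d
    + R r d a b + R r d a c + R r d b c = 0"
    by (simp only: bit_cancel)
  moreover have "of_bool (a < r) = (1 + of_bool (r < a) :: bit)" "of_bool (b < r) = (1 + of_bool (r < b) :: bit)"
    "of_bool (c < r) = (1 + of_bool (r < c) :: bit)" "of_bool (d < r) = (1 + of_bool (r < d) :: bit)"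
    "of_bool (b < a) = (1 + of_bool (a < b) :: bit)" "of_bool (c < a) = (1 + of_bool (a < c) :: bit)"
    "of_bool (d < a) = (1 + of_bool (a < d) :: bit)" "of_bool (c < b) = (1 + of_bool (b < c) :: bit)"
    "of_bool (d < b) = (1 + of_bool (b < d) :: bit)" "of_bool (d < c) = (1 + of_bool (c < d) :: bit)"
    using assms(11) by (auto intro!: of_bool_less_swap simp del: of_bool_less_eq_iff)
  ultimately have "s a b * s c d + t a b * t c d + (s a c * s b d + t a c * t b d) + (s a d * s b c + t a d * t b c)
    + (s r a * s b c + t r a * t b c) + (s r a * s b d + t r a * t b d) + (s r a * s c d + t r a * t c d)
    + (s r b * s a c + t r b * t a c) + (s r b * s a d + t r b * t a d) + (s r b * s c d + t r b * t c d)
    + (s r c * s a b + t r c * t a b) + (s r c * s a d + t r c * t a d) + (s r c * s b d + t r c * t b d)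
    + (s r d * s a b + t r d * t a b) + (s r d * s a c + t r d * t a c) + (s r d * s b c + t r d * t b c) + 1 = 0"
    unfolding R_def
    by (simp only: add.assoc add.commute add.left_commute bit_cancel)
  then have "cyc s r a b * cyc s r c d + cyc t r a b * cyc t r c d
    + (cyc s r a c * cyc s r b d + cyc t r a c * cyc t r b d)
    + (cyc s r a d * cyc s r b c + cyc t r a d * cyc t r b c) + 1 = 0"
    unfolding cyc_def
    by (simp only: distrib_left distrib_right add.assoc add.commute add.left_commute mult.commute bit_cancel)
  then show ?thesis by (metis bit_cancel(2,3))
qed

end

section \<open>Reduction to a finite propositional problem\<close>

definition edges_of :: "('v::linorder \<Rightarrow> 'v \<Rightarrow> bool) \<Rightarrow> 'v set set" where
  "edges_of P = {{u, v} | u v. u < v \<and> P u v}"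

lemma edges_of_iff: "u < v \<Longrightarrow> {u, v} \<in> edges_of P \<longleftrightarrow> P u v"
  unfolding edges_of_def by (auto simp: doubleton_eq_iff)

text \<open>A triangle is the sum of the three triangles that its edges form with the vertex 0;
  exclusive or is addition modulo 2.\<close>

definition odd_triangle :: "(nat \<Rightarrow> nat \<Rightarrow> bool) \<Rightarrow> nat \<times> nat \<times> nat \<Rightarrow> bool" where
  "odd_triangle A = (\<lambda>(a, b, c). (A a b \<noteq> A b c) \<noteq> A a c)"

text \<open>The standard scalar product of the classes of two triangles through 0, as in the
  summands of \<open>K5\<close>.\<close>

definition odd_meeting :: "(nat \<Rightarrow> nat \<Rightarrow> bool) \<Rightarrow> (nat \<Rightarrow> nat \<Rightarrow> bool) \<Rightarrow> (nat \<times> nat) \<Rightarrow> (nat \<times> nat) \<Rightarrow> bool" where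
  "odd_meeting A B = (\<lambda>(a, b) (c, d). (A a b \<and> A c d) \<noteq> (B a b \<and> B c d))"

definition triangle_of :: "(nat \<Rightarrow> nat \<Rightarrow> bool) \<Rightarrow> nat \<times> nat \<times> nat \<Rightarrow> bool" where
  "triangle_of P = (\<lambda>(a, b, c). a < b \<and> b < c \<and> P a b \<and> P b c \<and> P a c)"

text \<open>
  \<open>A\<close> and \<open>B\<close> are the classes of the triangles through the vertex \<open>0\<close>, one for each basis
  vector. Such a triangle is given by its edge opposite to \<open>0\<close>.
\<close>

definition triangle_parities :: "(nat \<Rightarrow> nat \<Rightarrow> bool) \<Rightarrow> (nat \<Rightarrow> nat \<Rightarrow> bool) \<Rightarrow> (nat \<Rightarrow> nat \<Rightarrow> bool) \<Rightarrow> bool" where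
  "triangle_parities P A B \<longleftrightarrow>
    (\<forall>v. \<not> A 0 v \<and> \<not> B 0 v) \<and>
    (\<forall>a b c d. 0 < a \<and> triangle_of P (a, b, c) \<and> triangle_of P (b, c, d) \<and> P a d \<and>
        P 0 a \<and> P 0 b \<and> P 0 c \<and> P 0 d \<longrightarrow>
      (odd_meeting A B (a, b) (c, d) \<noteq> odd_meeting A B (a, c) (b, d)) \<noteq> odd_meeting A B (a, d) (b, c)) \<and>
    (\<forall>a b c d e f. triangle_of P (a, b, c) \<and> triangle_of P (d, e, f) \<and> {a, b, c} \<inter> {d, e, f} = {} \<and>
        (\<forall>v\<in>{a, b, c, d, e, f} - {0}. P 0 v) \<longrightarrow>
      (odd_triangle A (a, b, c) \<and> odd_triangle A (d, e, f)) =
      (odd_triangle B (a, b, c) \<and> odd_triangle B (d, e, f)))"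

lemma parity_system_triangles:
  assumes "parity_system {(u, v). u < v \<and> {u, v} \<in> edges_of P} m n"
  obtains A B where "triangle_parities P A B"
    "(\<And>u v. u < v \<Longrightarrow> P u v \<Longrightarrow> n (u, v) = 0) \<Longrightarrow> triangle_parities P A (\<lambda>u v. False)"
proof -
  let ?D = "{(u, v). u < v \<and> {u, v} \<in> edges_of P}"
  obtain Y where Y: "\<And>a b c d. (a, b) \<in> ?D \<Longrightarrow> (c, d) \<in> ?D \<Longrightarrow> indep (a, b) (c, d) \<Longrightarrow>
      even (Y a (c, d) + Y b (c, d) + Y c (a, b) + Y d (a, b)
        + of_bool (a < c) + of_bool (a < d) + of_bool (b < c) + of_bool (b < d)
        + m (a, b) * m (c, d) + m (a, b) * n (c, d) + n (a, b) * m (c, d))"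
    using assms unfolding parity_system_def by blast
  define o2 where "o2 u v = (min u v, max u v)" for u v :: nat
  define adj where "adj u v \<longleftrightarrow> o2 u v \<in> ?D" for u v
  define y where "y v c d = (of_int (Y v (o2 c d)) :: bit)" for v c d
  \<comment> \<open>Change of basis: modulo 2, \<open>(m + n) * (m' + n') + n * n'\<close> equals
    \<open>m * m' + m * n' + n * m'\<close>.\<close>
  define s where "s u v = (of_int (m (o2 u v) + n (o2 u v)) :: bit)" for u v
  define t where "t u v = (of_int (n (o2 u v)) :: bit)" for u v
  have even0: "of_int k = (0::bit)" if "even k" for k :: int
    using that by (auto elim!: evenE)
  interpret bit_drawing adj y s t
  proof
    show "s a b = s b a" "t a b = t b a" for a b
      by (simp_all only: s_def t_def o2_def min.commute max.commute)
    have sorted: "y a c d + y b c d + y c a b + y d a b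
        + of_bool (a < c) + of_bool (a < d) + of_bool (b < c) + of_bool (b < d)
        + s a b * s c d + t a b * t c d = 0"
      if "(a, b) \<in> ?D" "(c, d) \<in> ?D" "distinct [a, b, c, d]" for a b c d
    proof -
      have o: "o2 a b = (a, b)" "o2 c d = (c, d)" using that by (auto simp: o2_def)
      have "of_int (Y a (c, d) + Y b (c, d) + Y c (a, b) + Y d (a, b)
        + of_bool (a < c) + of_bool (a < d) + of_bool (b < c) + of_bool (b < d)
        + m (a, b) * m (c, d) + m (a, b) * n (c, d) + n (a, b) * m (c, d)) = (0::bit)"
        by (rule even0, rule Y) (use that in \<open>auto simp: indep_def\<close>)
      then show ?thesis
        unfolding y_def s_def t_def o
        by (simp only: of_int_add of_int_mult of_int_of_bool distrib_left distrib_right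
            add.assoc add.commute add.left_commute bit_cancel)
    qed
    show "y a c d + y b c d + y c a b + y d a b
        + of_bool (a < c) + of_bool (a < d) + of_bool (b < c) + of_bool (b < d)
        + s a b * s c d + t a b * t c d = 0"
      if "adj a b" "adj c d" "distinct [a, b, c, d]" for a b c d
    proof -
      have sym: "y v a b = y v b a" "s a b = s b a" "t a b = t b a" for v a b
        by (simp_all only: y_def s_def t_def o2_def min.commute max.commute)
      note sy = sym(1)[of _ d c] sym(2,3)[of d c] sym(1)[of _ b a] sym(2,3)[of b a]
      have D: "(a, b) \<in> ?D \<or> (b, a) \<in> ?D" "(c, d) \<in> ?D \<or> (d, c) \<in> ?D"
        using that(1,2) unfolding adj_def o2_def min_def max_def by (auto split: if_splits)
      from D show ?thesis
      proof (elim disjE)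
        assume "(a, b) \<in> ?D" "(c, d) \<in> ?D"
        then show ?thesis by (rule sorted[OF _ _ that(3)])
      next
        assume h: "(a, b) \<in> ?D" "(d, c) \<in> ?D"
        have "distinct [a, b, d, c]" using that(3) by auto
        from sorted[OF h this] show ?thesis
          by (simp only: sy add.assoc add.commute add.left_commute)
      next
        assume h: "(b, a) \<in> ?D" "(c, d) \<in> ?D"
        have "distinct [b, a, c, d]" using that(3) by auto
        from sorted[OF h this] show ?thesis
          by (simp only: sy add.assoc add.commute add.left_commute)
      next
        assume h: "(b, a) \<in> ?D" "(d, c) \<in> ?D"
        have "distinct [b, a, d, c]" using that(3) by auto
        from sorted[OF h this] show ?thesis
          by (simp only: sy add.assoc add.commute add.left_commute)
      qed
    qed
  qed
  have adj: "adj u v" if "P u v" "u < v" for u v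
    using that by (simp add: adj_def o2_def edges_of_iff)
  have adj0: "adj 0 v" if "P 0 v" "0 < v" for v using adj that by blast
  \<comment> \<open>For \<open>u = 0\<close> the triangle degenerates and its class would be
    \<open>s 0 0\<close>, about which nothing is known. The conjunct \<open>u \<noteq> 0\<close>
    replaces it by the value that \<open>odd_triangle\<close> needs.\<close>
  define A where "A u v \<longleftrightarrow> u \<noteq> 0 \<and> cyc s 0 u v = 1" for u v
  define B where "B u v \<longleftrightarrow> u \<noteq> 0 \<and> cyc t 0 u v = 1" for u v
  have xor: "(x + z = (1::bit)) = ((x = 1) \<noteq> (z = 1))" "(x * z = (1::bit)) = (x = 1 \<and> z = 1)" for x z
    by (cases x; cases z; simp)+
  have A0: "\<not> A 0 v" "\<not> B 0 v" for v by (simp_all add: A_def B_def)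
  have AB: "A u v = (cyc s 0 u v = 1)" "B u v = (cyc t 0 u v = 1)" if "0 < u" for u v
    using that by (simp_all add: A_def B_def)
  have tri: "odd_triangle A (a, b, c) = (cyc s a b c = 1)" "odd_triangle B (a, b, c) = (cyc t a b c = 1)"
    if "a < b" "b < c" for a b c
  proof -
    have c3: "cyc f 0 a b + cyc f 0 b c + cyc f 0 a c = cyc f a b c" for f
      unfolding cyc_def by (simp only: add.assoc add.commute add.left_commute bit_cancel)
    have "0 < b" using that by simp
    show "odd_triangle A (a, b, c) = (cyc s a b c = 1)"
    proof (cases "a = 0")
      case True then show ?thesis using A0 AB \<open>0 < b\<close> by (simp add: odd_triangle_def)
    next
      case False
      then show ?thesis
        unfolding c3[of s, symmetric] xor odd_triangle_def using AB \<open>0 < b\<close> by simp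
    qed
    show "odd_triangle B (a, b, c) = (cyc t a b c = 1)"
    proof (cases "a = 0")
      case True then show ?thesis using A0 AB \<open>0 < b\<close> by (simp add: odd_triangle_def)
    next
      case False
      then show ?thesis
        unfolding c3[of t, symmetric] xor odd_triangle_def using AB \<open>0 < b\<close> by simp
    qed
  qed
  have *: "triangle_parities P A B"
    unfolding triangle_parities_def
  proof (intro conjI allI impI)
    fix a b c d
    assume h: "0 < a \<and> triangle_of P (a, b, c) \<and> triangle_of P (b, c, d) \<and> P a d \<and> P 0 a \<and> P 0 b \<and> P 0 c \<and> P 0 d"
    then have o: "0 < a" "a < b" "b < c" "c < d" "0 < b" "0 < c" by (auto simp: triangle_of_def)
    have "cyc s 0 a b * cyc s 0 c d + cyc t 0 a b * cyc t 0 c d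
      + (cyc s 0 a c * cyc s 0 b d + cyc t 0 a c * cyc t 0 b d)
      + (cyc s 0 a d * cyc s 0 b c + cyc t 0 a d * cyc t 0 b c) = 1"
      by (rule K5) (use h o in \<open>auto simp: triangle_of_def intro!: adj adj0\<close>)
    then show "(odd_meeting A B (a, b) (c, d) \<noteq> odd_meeting A B (a, c) (b, d)) \<noteq> odd_meeting A B (a, d) (b, c)"
      unfolding xor odd_meeting_def prod.case AB[OF o(1)] AB[OF o(5)] AB[OF o(6)] .
  next
    fix a b c d e f
    assume h: "triangle_of P (a, b, c) \<and> triangle_of P (d, e, f) \<and> {a, b, c} \<inter> {d, e, f} = {} \<and>
        (\<forall>v\<in>{a, b, c, d, e, f} - {0}. P 0 v)"
    then have o: "a < b" "b < c" "d < e" "e < f" by (auto simp: triangle_of_def)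
    have "cyc s a b c * cyc s d e f + cyc t a b c * cyc t d e f = 0"
      by (rule disjoint_triangles) (use h o in \<open>auto simp: triangle_of_def intro!: adj\<close>)
    then have "\<not> (cyc s a b c * cyc s d e f + cyc t a b c * cyc t d e f = 1)" by simp
    then show "(odd_triangle A (a, b, c) \<and> odd_triangle A (d, e, f)) = (odd_triangle B (a, b, c) \<and> odd_triangle B (d, e, f))"
      unfolding xor tri[OF o(1,2)] tri[OF o(3,4)] by simp
  qed (simp_all add: A0)
  moreover have "triangle_parities P A (\<lambda>u v. False)" if n: "\<And>u v. u < v \<Longrightarrow> P u v \<Longrightarrow> n (u, v) = 0"
  proof -
    have t0: "t u v = 0" if "P u v" "u < v" for u v using n[OF that(2,1)] that(2) by (simp add: t_def o2_def)
    have B0: "\<not> B u v" if "P u v" "0 < u" "u < v" "P 0 u" "P 0 v" for u v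
      using that t0[of u v] t0[of 0 u] t0[of 0 v] by (simp add: B_def cyc_def)
    show ?thesis
      unfolding triangle_parities_def
    proof (intro conjI allI impI)
      fix a b c d
      assume h: "0 < a \<and> triangle_of P (a, b, c) \<and> triangle_of P (b, c, d) \<and> P a d \<and> P 0 a \<and> P 0 b \<and> P 0 c \<and> P 0 d"
      then have "(odd_meeting A B (a, b) (c, d) \<noteq> odd_meeting A B (a, c) (b, d)) \<noteq> odd_meeting A B (a, d) (b, c)"
        by (rule *[unfolded triangle_parities_def, THEN conjunct2, THEN conjunct1, rule_format])
      moreover have "\<not> B a b" "\<not> B a c" "\<not> B a d"
        using h B0[of a b] B0[of a c] B0[of a d] by (auto simp: triangle_of_def)
      ultimately show "(odd_meeting A (\<lambda>u v. False) (a, b) (c, d) \<noteq> odd_meeting A (\<lambda>u v. False) (a, c) (b, d)) \<noteq> odd_meeting A (\<lambda>u v. False) (a, d) (b, c)"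
        by (simp add: odd_meeting_def)
    next
      fix a b c d e f
      assume h: "triangle_of P (a, b, c) \<and> triangle_of P (d, e, f) \<and> {a, b, c} \<inter> {d, e, f} = {} \<and>
          (\<forall>v\<in>{a, b, c, d, e, f} - {0}. P 0 v)"
      then have "(odd_triangle A (a, b, c) \<and> odd_triangle A (d, e, f)) = (odd_triangle B (a, b, c) \<and> odd_triangle B (d, e, f))"
        by (rule *[unfolded triangle_parities_def, THEN conjunct2, THEN conjunct2, rule_format])
      moreover have "\<not> odd_triangle B (a, b, c)"
      proof -
        have "cyc t a b c = 0" using h t0 by (simp add: triangle_of_def cyc_def)
        then show ?thesis using tri(2) h by (simp add: triangle_of_def)
      qed
      ultimately show "(odd_triangle A (a, b, c) \<and> odd_triangle A (d, e, f)) = (odd_triangle (\<lambda>u v. False) (a, b, c) \<and> odd_triangle (\<lambda>u v. False) (d, e, f))"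
        by (simp add: odd_triangle_def)
    qed (simp_all add: A0)
  qed
  ultimately show thesis by (rule that)
qed

definition K7 :: "nat \<Rightarrow> nat \<Rightarrow> bool" where
  "K7 u v \<longleftrightarrow> v < 7"

text \<open>Two copies of the complete graph on six vertices that share a triangle, and one further edge.\<close>

definition K6K6 :: "nat \<Rightarrow> nat \<Rightarrow> bool" where
  "K6K6 u v \<longleftrightarrow> v < 6 \<or> (u < 3 \<or> 6 \<le> u) \<and> 6 \<le> v \<and> v < 9 \<or> u = 3 \<and> v = 6"

definition K5K5 :: "nat \<Rightarrow> nat \<Rightarrow> bool" where
  "K5K5 u v \<longleftrightarrow> v < 5 \<or> (u = 0 \<or> 5 \<le> u) \<and> 5 \<le> v \<and> v < 9"

lemma not_equal_False: "(False \<noteq> x) = x" "(x \<noteq> False) = x"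
  by simp_all

text \<open>Listing concrete instances leaves a propositional problem whose atoms are values of
  \<open>A\<close> and \<open>B\<close>.\<close>

lemma triangle_parities_K5:
  assumes "triangle_parities P A B"
    and "list_all (\<lambda>(a, b, c, d). 0 < a \<and> triangle_of P (a, b, c) \<and> triangle_of P (b, c, d) \<and> P a d \<and>
        P 0 a \<and> P 0 b \<and> P 0 c \<and> P 0 d) xs"
  shows "list_all (\<lambda>(a, b, c, d). (odd_meeting A B (a, b) (c, d) \<noteq> odd_meeting A B (a, c) (b, d))
      \<noteq> odd_meeting A B (a, d) (b, c)) xs"
  using assms(2)
proof (rule list.pred_mono_strong, clarify)
  fix a b c d
  assume "0 < a" "triangle_of P (a, b, c)" "triangle_of P (b, c, d)" "P a d" "P 0 a" "P 0 b" "P 0 c" "P 0 d"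
    "(odd_meeting A B (a, b) (c, d) \<noteq> odd_meeting A B (a, c) (b, d)) = odd_meeting A B (a, d) (b, c)"
  then show False
    using assms(1)[unfolded triangle_parities_def, THEN conjunct2, THEN conjunct1, rule_format, of a b c d] by blast
qed

lemma triangle_parities_disjoint:
  assumes "triangle_parities P A B"
    and "list_all (\<lambda>(a, b, c, d, e, f). triangle_of P (a, b, c) \<and> triangle_of P (d, e, f) \<and> {a, b, c} \<inter> {d, e, f} = {} \<and>
        (\<forall>v\<in>{a, b, c, d, e, f} - {0}. P 0 v)) xs"
  shows "list_all (\<lambda>(a, b, c, d, e, f). (odd_triangle A (a, b, c) \<and> odd_triangle A (d, e, f)) =
      (odd_triangle B (a, b, c) \<and> odd_triangle B (d, e, f))) xs"
  using assms(2)
proof (rule list.pred_mono_strong)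
  fix x
  assume "case x of (a, b, c, d, e, f) \<Rightarrow> triangle_of P (a, b, c) \<and> triangle_of P (d, e, f) \<and> {a, b, c} \<inter> {d, e, f} = {} \<and>
        (\<forall>v\<in>{a, b, c, d, e, f} - {0}. P 0 v)"
  then show "case x of (a, b, c, d, e, f) \<Rightarrow> (odd_triangle A (a, b, c) \<and> odd_triangle A (d, e, f)) =
      (odd_triangle B (a, b, c) \<and> odd_triangle B (d, e, f))"
    using assms(1)[unfolded triangle_parities_def, THEN conjunct2, THEN conjunct2, rule_format] by (cases x) simp
qed

text \<open>In each of the two complete graphs some triangle that avoids 0 is odd: otherwise
  \<open>A\<close> would be a coboundary on the other four vertices, and the sum in the five-vertex
  condition would be even. Some triangle through 0 is odd as well. An odd triangle that avoids 0 in
  one graph and an odd triangle through 0 in the other are disjoint, which the second condition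
  forbids.\<close>

lemma K5K5_parities: "\<not> triangle_parities K5K5 A (\<lambda>u v. False)"
proof
  assume h: "triangle_parities K5K5 A (\<lambda>u v. False)"
  have k: "list_all (\<lambda>(a, b, c, d). (odd_meeting A (\<lambda>u v. False) (a, b) (c, d) \<noteq> odd_meeting A (\<lambda>u v. False) (a, c) (b, d))
      \<noteq> odd_meeting A (\<lambda>u v. False) (a, d) (b, c)) [
      (1, 2, 3, 4), (5, 6, 7, 8)]"
    by (rule triangle_parities_K5[OF h]) (simp add: triangle_of_def K5K5_def)
  have t: "list_all (\<lambda>(a, b, c, d, e, f). (odd_triangle A (a, b, c) \<and> odd_triangle A (d, e, f)) =
      (odd_triangle (\<lambda>u v. False) (a, b, c) \<and> odd_triangle (\<lambda>u v. False) (d, e, f))) [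
      (0, 1, 2, 5, 6, 7), (0, 1, 2, 5, 6, 8), (0, 1, 2, 5, 7, 8), (0, 1, 2, 6, 7, 8),
      (0, 1, 3, 5, 6, 7), (0, 1, 3, 5, 6, 8), (0, 1, 3, 5, 7, 8), (0, 1, 3, 6, 7, 8),
      (0, 1, 4, 5, 6, 7), (0, 1, 4, 5, 6, 8), (0, 1, 4, 5, 7, 8), (0, 1, 4, 6, 7, 8),
      (0, 2, 3, 5, 6, 7), (0, 2, 3, 5, 6, 8), (0, 2, 3, 5, 7, 8), (0, 2, 3, 6, 7, 8),
      (0, 2, 4, 5, 6, 7), (0, 2, 4, 5, 6, 8), (0, 2, 4, 5, 7, 8), (0, 2, 4, 6, 7, 8),
      (0, 3, 4, 5, 6, 7), (0, 3, 4, 5, 6, 8), (0, 3, 4, 5, 7, 8), (0, 3, 4, 6, 7, 8),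
      (0, 5, 6, 1, 2, 3), (0, 5, 6, 1, 2, 4), (0, 5, 6, 1, 3, 4), (0, 5, 6, 2, 3, 4),
      (0, 5, 7, 1, 2, 3), (0, 5, 7, 1, 2, 4), (0, 5, 7, 1, 3, 4), (0, 5, 7, 2, 3, 4),
      (0, 5, 8, 1, 2, 3), (0, 5, 8, 1, 2, 4), (0, 5, 8, 1, 3, 4), (0, 5, 8, 2, 3, 4),
      (0, 6, 7, 1, 2, 3), (0, 6, 7, 1, 2, 4), (0, 6, 7, 1, 3, 4), (0, 6, 7, 2, 3, 4),
      (0, 6, 8, 1, 2, 3), (0, 6, 8, 1, 2, 4), (0, 6, 8, 1, 3, 4), (0, 6, 8, 2, 3, 4),
      (0, 7, 8, 1, 2, 3), (0, 7, 8, 1, 2, 4), (0, 7, 8, 1, 3, 4), (0, 7, 8, 2, 3, 4),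
      (1, 2, 3, 5, 6, 7), (1, 2, 3, 5, 6, 8), (1, 2, 3, 5, 7, 8), (1, 2, 3, 6, 7, 8),
      (1, 2, 4, 5, 6, 7), (1, 2, 4, 5, 6, 8), (1, 2, 4, 5, 7, 8), (1, 2, 4, 6, 7, 8),
      (1, 3, 4, 5, 6, 7), (1, 3, 4, 5, 6, 8), (1, 3, 4, 5, 7, 8), (1, 3, 4, 6, 7, 8),
      (2, 3, 4, 5, 6, 7), (2, 3, 4, 5, 6, 8), (2, 3, 4, 5, 7, 8), (2, 3, 4, 6, 7, 8)]"
    by (rule triangle_parities_disjoint[OF h]) (simp add: triangle_of_def K5K5_def)
  have z: "A 0 v = False"  for v using h by (simp_all add: triangle_parities_def)
  show False
    using k t unfolding list.pred_inject prod.case odd_meeting_def odd_triangle_def z not_equal_False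
    by satx
qed

text \<open>The lists contain the 15 complete subgraphs on five vertices through 0 and all 70 pairs
  of disjoint triangles.\<close>

lemma K7_parities: "\<not> triangle_parities K7 A B"
proof
  assume h: "triangle_parities K7 A B"
  have k: "list_all (\<lambda>(a, b, c, d). (odd_meeting A B (a, b) (c, d) \<noteq> odd_meeting A B (a, c) (b, d))
      \<noteq> odd_meeting A B (a, d) (b, c)) [
      (1, 2, 3, 4), (1, 2, 3, 5), (1, 2, 3, 6), (1, 2, 4, 5), (1, 2, 4, 6), (1, 2, 5, 6),
      (1, 3, 4, 5), (1, 3, 4, 6), (1, 3, 5, 6), (1, 4, 5, 6), (2, 3, 4, 5), (2, 3, 4, 6),
      (2, 3, 5, 6), (2, 4, 5, 6), (3, 4, 5, 6)]"
    by (rule triangle_parities_K5[OF h]) (simp add: triangle_of_def K7_def)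
  have t: "list_all (\<lambda>(a, b, c, d, e, f). (odd_triangle A (a, b, c) \<and> odd_triangle A (d, e, f)) =
      (odd_triangle B (a, b, c) \<and> odd_triangle B (d, e, f))) [
      (0, 1, 2, 3, 4, 5), (0, 1, 2, 3, 4, 6), (0, 1, 2, 3, 5, 6), (0, 1, 2, 4, 5, 6),
      (0, 1, 3, 2, 4, 5), (0, 1, 3, 2, 4, 6), (0, 1, 3, 2, 5, 6), (0, 1, 3, 4, 5, 6),
      (0, 1, 4, 2, 3, 5), (0, 1, 4, 2, 3, 6), (0, 1, 4, 2, 5, 6), (0, 1, 4, 3, 5, 6),
      (0, 1, 5, 2, 3, 4), (0, 1, 5, 2, 3, 6), (0, 1, 5, 2, 4, 6), (0, 1, 5, 3, 4, 6),
      (0, 1, 6, 2, 3, 4), (0, 1, 6, 2, 3, 5), (0, 1, 6, 2, 4, 5), (0, 1, 6, 3, 4, 5),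
      (0, 2, 3, 1, 4, 5), (0, 2, 3, 1, 4, 6), (0, 2, 3, 1, 5, 6), (0, 2, 3, 4, 5, 6),
      (0, 2, 4, 1, 3, 5), (0, 2, 4, 1, 3, 6), (0, 2, 4, 1, 5, 6), (0, 2, 4, 3, 5, 6),
      (0, 2, 5, 1, 3, 4), (0, 2, 5, 1, 3, 6), (0, 2, 5, 1, 4, 6), (0, 2, 5, 3, 4, 6),
      (0, 2, 6, 1, 3, 4), (0, 2, 6, 1, 3, 5), (0, 2, 6, 1, 4, 5), (0, 2, 6, 3, 4, 5),
      (0, 3, 4, 1, 2, 5), (0, 3, 4, 1, 2, 6), (0, 3, 4, 1, 5, 6), (0, 3, 4, 2, 5, 6),
      (0, 3, 5, 1, 2, 4), (0, 3, 5, 1, 2, 6), (0, 3, 5, 1, 4, 6), (0, 3, 5, 2, 4, 6),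
      (0, 3, 6, 1, 2, 4), (0, 3, 6, 1, 2, 5), (0, 3, 6, 1, 4, 5), (0, 3, 6, 2, 4, 5),
      (0, 4, 5, 1, 2, 3), (0, 4, 5, 1, 2, 6), (0, 4, 5, 1, 3, 6), (0, 4, 5, 2, 3, 6),
      (0, 4, 6, 1, 2, 3), (0, 4, 6, 1, 2, 5), (0, 4, 6, 1, 3, 5), (0, 4, 6, 2, 3, 5),
      (0, 5, 6, 1, 2, 3), (0, 5, 6, 1, 2, 4), (0, 5, 6, 1, 3, 4), (0, 5, 6, 2, 3, 4),
      (1, 2, 3, 4, 5, 6), (1, 2, 4, 3, 5, 6), (1, 2, 5, 3, 4, 6), (1, 2, 6, 3, 4, 5),
      (1, 3, 4, 2, 5, 6), (1, 3, 5, 2, 4, 6), (1, 3, 6, 2, 4, 5), (1, 4, 5, 2, 3, 6),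
      (1, 4, 6, 2, 3, 5), (1, 5, 6, 2, 3, 4)]"
    by (rule triangle_parities_disjoint[OF h]) (simp add: triangle_of_def K7_def)
  have z: "A 0 v = False" "B 0 v = False" for v using h by (simp_all add: triangle_parities_def)
  show False
    using k t unfolding list.pred_inject prod.case odd_meeting_def odd_triangle_def z not_equal_False
    by satx
qed

text \<open>The edge from 3 to 6 is indispensable. Without it the graph triangulates the Klein
  bottle: take two projective planes triangulated by the complete graph on six vertices, remove a
  face from each and glue along its boundary. This gives 27 edges on nine vertices, the largest
  number that Euler's formula permits; the further edge is the 28th.\<close>

lemma K6K6_parities: "\<not> triangle_parities K6K6 A B"
proof
  assume h: "triangle_parities K6K6 A B"
  have k: "list_all (\<lambda>(a, b, c, d). (odd_meeting A B (a, b) (c, d) \<noteq> odd_meeting A B (a, c) (b, d))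
      \<noteq> odd_meeting A B (a, d) (b, c)) [
      (1, 2, 3, 4), (1, 2, 3, 5), (1, 2, 3, 6), (1, 2, 4, 5), (1, 2, 6, 7), (1, 2, 6, 8),
      (1, 2, 7, 8), (1, 3, 4, 5), (1, 6, 7, 8), (2, 3, 4, 5), (2, 6, 7, 8)]"
    by (rule triangle_parities_K5[OF h]) (simp add: triangle_of_def K6K6_def)
  have t: "list_all (\<lambda>(a, b, c, d, e, f). (odd_triangle A (a, b, c) \<and> odd_triangle A (d, e, f)) =
      (odd_triangle B (a, b, c) \<and> odd_triangle B (d, e, f))) [
      (0, 1, 2, 3, 4, 5), (0, 1, 2, 6, 7, 8), (0, 1, 3, 2, 4, 5), (0, 1, 3, 2, 6, 7),
      (0, 1, 3, 2, 6, 8), (0, 1, 3, 2, 7, 8), (0, 1, 3, 6, 7, 8), (0, 1, 4, 2, 3, 5),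
      (0, 1, 4, 2, 3, 6), (0, 1, 4, 2, 6, 7), (0, 1, 4, 2, 6, 8), (0, 1, 4, 2, 7, 8),
      (0, 1, 4, 6, 7, 8), (0, 1, 5, 2, 3, 4), (0, 1, 5, 2, 3, 6), (0, 1, 5, 2, 6, 7),
      (0, 1, 5, 2, 6, 8), (0, 1, 5, 2, 7, 8), (0, 1, 5, 6, 7, 8), (0, 1, 6, 2, 3, 4),
      (0, 1, 6, 2, 3, 5), (0, 1, 6, 2, 4, 5), (0, 1, 6, 2, 7, 8), (0, 1, 6, 3, 4, 5),
      (0, 1, 7, 2, 3, 4), (0, 1, 7, 2, 3, 5), (0, 1, 7, 2, 3, 6), (0, 1, 7, 2, 4, 5),
      (0, 1, 7, 2, 6, 8), (0, 1, 7, 3, 4, 5), (0, 1, 8, 2, 3, 4), (0, 1, 8, 2, 3, 5),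
      (0, 1, 8, 2, 3, 6), (0, 1, 8, 2, 4, 5), (0, 1, 8, 2, 6, 7), (0, 1, 8, 3, 4, 5),
      (0, 2, 3, 1, 4, 5), (0, 2, 3, 1, 6, 7), (0, 2, 3, 1, 6, 8), (0, 2, 3, 1, 7, 8),
      (0, 2, 3, 6, 7, 8), (0, 2, 4, 1, 3, 5), (0, 2, 4, 1, 3, 6), (0, 2, 4, 1, 6, 7),
      (0, 2, 4, 1, 6, 8), (0, 2, 4, 1, 7, 8), (0, 2, 4, 6, 7, 8), (0, 2, 5, 1, 3, 4),
      (0, 2, 5, 1, 3, 6), (0, 2, 5, 1, 6, 7), (0, 2, 5, 1, 6, 8), (0, 2, 5, 1, 7, 8),
      (0, 2, 5, 6, 7, 8), (0, 2, 6, 1, 3, 4), (0, 2, 6, 1, 3, 5), (0, 2, 6, 1, 4, 5),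
      (0, 2, 6, 1, 7, 8), (0, 2, 6, 3, 4, 5), (0, 2, 7, 1, 3, 4), (0, 2, 7, 1, 3, 5),
      (0, 2, 7, 1, 3, 6), (0, 2, 7, 1, 4, 5), (0, 2, 7, 1, 6, 8), (0, 2, 7, 3, 4, 5),
      (0, 2, 8, 1, 3, 4), (0, 2, 8, 1, 3, 5), (0, 2, 8, 1, 3, 6), (0, 2, 8, 1, 4, 5),
      (0, 2, 8, 1, 6, 7), (0, 2, 8, 3, 4, 5), (0, 3, 4, 1, 2, 5), (0, 3, 4, 1, 2, 6),
      (0, 3, 4, 1, 2, 7), (0, 3, 4, 1, 2, 8), (0, 3, 4, 1, 6, 7), (0, 3, 4, 1, 6, 8),
      (0, 3, 4, 1, 7, 8), (0, 3, 4, 2, 6, 7), (0, 3, 4, 2, 6, 8), (0, 3, 4, 2, 7, 8),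
      (0, 3, 4, 6, 7, 8), (0, 3, 5, 1, 2, 4), (0, 3, 5, 1, 2, 6), (0, 3, 5, 1, 2, 7),
      (0, 3, 5, 1, 2, 8), (0, 3, 5, 1, 6, 7), (0, 3, 5, 1, 6, 8), (0, 3, 5, 1, 7, 8),
      (0, 3, 5, 2, 6, 7), (0, 3, 5, 2, 6, 8), (0, 3, 5, 2, 7, 8), (0, 3, 5, 6, 7, 8),
      (0, 3, 6, 1, 2, 4), (0, 3, 6, 1, 2, 5), (0, 3, 6, 1, 2, 7), (0, 3, 6, 1, 2, 8),
      (0, 3, 6, 1, 4, 5), (0, 3, 6, 1, 7, 8), (0, 3, 6, 2, 4, 5), (0, 3, 6, 2, 7, 8),
      (0, 4, 5, 1, 2, 3), (0, 4, 5, 1, 2, 6), (0, 4, 5, 1, 2, 7), (0, 4, 5, 1, 2, 8),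
      (0, 4, 5, 1, 3, 6), (0, 4, 5, 1, 6, 7), (0, 4, 5, 1, 6, 8), (0, 4, 5, 1, 7, 8),
      (0, 4, 5, 2, 3, 6), (0, 4, 5, 2, 6, 7), (0, 4, 5, 2, 6, 8), (0, 4, 5, 2, 7, 8),
      (0, 4, 5, 6, 7, 8), (0, 6, 7, 1, 2, 3), (0, 6, 7, 1, 2, 4), (0, 6, 7, 1, 2, 5),
      (0, 6, 7, 1, 2, 8), (0, 6, 7, 1, 3, 4), (0, 6, 7, 1, 3, 5), (0, 6, 7, 1, 4, 5),
      (0, 6, 7, 2, 3, 4), (0, 6, 7, 2, 3, 5), (0, 6, 7, 2, 4, 5), (0, 6, 7, 3, 4, 5),
      (0, 6, 8, 1, 2, 3), (0, 6, 8, 1, 2, 4), (0, 6, 8, 1, 2, 5), (0, 6, 8, 1, 2, 7),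
      (0, 6, 8, 1, 3, 4), (0, 6, 8, 1, 3, 5), (0, 6, 8, 1, 4, 5), (0, 6, 8, 2, 3, 4),
      (0, 6, 8, 2, 3, 5), (0, 6, 8, 2, 4, 5), (0, 6, 8, 3, 4, 5), (0, 7, 8, 1, 2, 3),
      (0, 7, 8, 1, 2, 4), (0, 7, 8, 1, 2, 5), (0, 7, 8, 1, 2, 6), (0, 7, 8, 1, 3, 4),
      (0, 7, 8, 1, 3, 5), (0, 7, 8, 1, 3, 6), (0, 7, 8, 1, 4, 5), (0, 7, 8, 2, 3, 4),
      (0, 7, 8, 2, 3, 5), (0, 7, 8, 2, 3, 6), (0, 7, 8, 2, 4, 5), (0, 7, 8, 3, 4, 5),
      (1, 2, 3, 6, 7, 8), (1, 2, 4, 6, 7, 8), (1, 2, 5, 6, 7, 8), (1, 2, 6, 3, 4, 5),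
      (1, 2, 7, 3, 4, 5), (1, 2, 8, 3, 4, 5), (1, 3, 4, 2, 6, 7), (1, 3, 4, 2, 6, 8),
      (1, 3, 4, 2, 7, 8), (1, 3, 4, 6, 7, 8), (1, 3, 5, 2, 6, 7), (1, 3, 5, 2, 6, 8),
      (1, 3, 5, 2, 7, 8), (1, 3, 5, 6, 7, 8), (1, 3, 6, 2, 4, 5), (1, 3, 6, 2, 7, 8),
      (1, 4, 5, 2, 3, 6), (1, 4, 5, 2, 6, 7), (1, 4, 5, 2, 6, 8), (1, 4, 5, 2, 7, 8),
      (1, 4, 5, 6, 7, 8), (1, 6, 7, 2, 3, 4), (1, 6, 7, 2, 3, 5), (1, 6, 7, 2, 4, 5),
      (1, 6, 7, 3, 4, 5), (1, 6, 8, 2, 3, 4), (1, 6, 8, 2, 3, 5), (1, 6, 8, 2, 4, 5),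
      (1, 6, 8, 3, 4, 5), (1, 7, 8, 2, 3, 4), (1, 7, 8, 2, 3, 5), (1, 7, 8, 2, 3, 6),
      (1, 7, 8, 2, 4, 5), (1, 7, 8, 3, 4, 5), (2, 3, 4, 6, 7, 8), (2, 3, 5, 6, 7, 8),
      (2, 4, 5, 6, 7, 8), (2, 6, 7, 3, 4, 5), (2, 6, 8, 3, 4, 5), (2, 7, 8, 3, 4, 5),
      (3, 4, 5, 6, 7, 8)]"
    by (rule triangle_parities_disjoint[OF h]) (simp add: triangle_of_def K6K6_def)
  have z: "A 0 v = False" "B 0 v = False" for v using h by (simp_all add: triangle_parities_def)
  show False
    using k t unfolding list.pred_inject prod.case odd_meeting_def odd_triangle_def z not_equal_False
    by satx
qed

section \<open>Graphs without an embedding\<close>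

lemma graph_embeds_in_subgraph:
  assumes "graph_embeds_in V E X" "inj_on f V'" "f ` V' \<subseteq> V" "\<And>e. e \<in> E' \<Longrightarrow> e \<subseteq> V' \<and> f ` e \<in> E"
  shows "graph_embeds_in V' E' X"
proof -
  obtain \<phi> \<gamma> where \<phi>: "inj_on \<phi> V" "\<phi> ` V \<subseteq> topspace X"
    and \<gamma>: "\<And>e. e \<in> E \<Longrightarrow> pathin X (\<gamma> e) \<and> inj_on (\<gamma> e) {0..1} \<and> {\<gamma> e 0, \<gamma> e 1} = \<phi> ` e \<and> \<gamma> e ` {0<..<1} \<inter> \<phi> ` V = {}"
    and \<gamma>2: "\<And>e e'. e \<in> E \<Longrightarrow> e' \<in> E \<Longrightarrow> e \<noteq> e' \<Longrightarrow> \<gamma> e ` {0<..<1} \<inter> \<gamma> e' ` {0<..<1} = {}"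
    using assms(1) by (rule graph_embeds_inE) blast
  have sub: "(\<phi> \<circ> f) ` V' \<subseteq> \<phi> ` V" using assms(3) by (auto simp: image_comp[symmetric])
  show ?thesis
    unfolding graph_embeds_in_def
  proof (intro exI[of _ "\<phi> \<circ> f"] exI[of _ "\<lambda>e. \<gamma> (f ` e)"] conjI ballI impI)
    show "inj_on (\<phi> \<circ> f) V'" using \<phi>(1) assms(2,3) by (meson comp_inj_on inj_on_subset)
    show "(\<phi> \<circ> f) ` V' \<subseteq> topspace X" using sub \<phi>(2) by blast
    fix e assume e: "e \<in> E'"
    then have fe: "f ` e \<in> E" using assms(4) by blast
    show "pathin X (\<gamma> (f ` e))" "inj_on (\<gamma> (f ` e)) {0..1}" using \<gamma>[OF fe] by auto
    show "{\<gamma> (f ` e) 0, \<gamma> (f ` e) 1} = (\<phi> \<circ> f) ` e" using \<gamma>[OF fe] by (simp add: image_comp)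
    have "\<gamma> (f ` e) ` {0<..<1} \<inter> \<phi> ` V = {}" using \<gamma>[OF fe] by simp
    then show "\<gamma> (f ` e) ` {0<..<1} \<inter> (\<phi> \<circ> f) ` V' = {}" using sub by blast
    fix e' assume e': "e' \<in> E'" "e \<noteq> e'"
    have "f ` e \<noteq> f ` e'"
      using assms(4)[OF e] assms(4)[OF e'(1)] e'(2) inj_on_image_eq_iff[OF assms(2)] by blast
    then show "\<gamma> (f ` e) ` {0<..<1} \<inter> \<gamma> (f ` e') ` {0<..<1} = {}"
      using \<gamma>2 fe assms(4)[OF e'(1)] by blast
  qed
qed

lemma directed_edges:
  assumes "\<And>u v. u < v \<Longrightarrow> P u v \<Longrightarrow> v < N"
  shows "finite {(u, v :: nat). u < v \<and> {u, v} \<in> edges_of P}"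
    and "(u, v) \<in> {(u, v). u < v \<and> {u, v} \<in> edges_of P} \<Longrightarrow> u \<in> {..<N} \<and> v \<in> {..<N} \<and> {u, v} \<in> edges_of P"
proof -
  have "{(u, v). u < v \<and> {u, v} \<in> edges_of P} \<subseteq> {..<N} \<times> {..<N}"
    using assms by (force simp: edges_of_iff)
  then show "finite {(u, v). u < v \<and> {u, v} \<in> edges_of P}"
    by (rule finite_subset) simp
  show "(u, v) \<in> {(u, v). u < v \<and> {u, v} \<in> edges_of P} \<Longrightarrow> u \<in> {..<N} \<and> v \<in> {..<N} \<and> {u, v} \<in> edges_of P"
    using assms[of u v] by (auto simp: edges_of_iff)
qed

lemma finite_edges_of:
  assumes "\<And>u v. u < v \<Longrightarrow> P u v \<Longrightarrow> v < (N::nat)"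
  shows "finite (edges_of P)"
proof -
  have "edges_of P \<subseteq> Pow {..<N}" using assms by (force simp: edges_of_def)
  then show ?thesis by (rule finite_subset) simp
qed

lemma embeds_in_N2_triangle_parities:
  assumes "graph_embeds_in {..<N} (edges_of P) (nonorientable_surface 2)"
    and "\<And>u v. u < v \<Longrightarrow> P u v \<Longrightarrow> v < N"
  obtains A B where "triangle_parities P A B"
proof -
  obtain m n where "parity_system {(u, v). u < v \<and> {u, v} \<in> edges_of P} m n"
    by (rule parity_N2[OF assms(1) directed_edges[of P N, OF assms(2)]])
  then show thesis by (rule parity_system_triangles) (rule that)
qed

lemma embeds_in_N1_triangle_parities:
  assumes "graph_embeds_in {..<N} (edges_of P) (nonorientable_surface 1)"
    and "\<And>u v. u < v \<Longrightarrow> P u v \<Longrightarrow> v < N"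
  obtains A where "triangle_parities P A (\<lambda>u v. False)"
proof -
  let ?D = "{(u, v). u < v \<and> {u, v} \<in> edges_of P}"
  obtain m n where mn: "parity_system ?D m n" "\<forall>e\<in>?D. n e = 0"
    by (rule parity_N1[OF assms(1) _ finite_edges_of[of P N] directed_edges[of P N]]) (use assms(2) in auto)
  from mn(1) show thesis
  proof (rule parity_system_triangles)
    fix A B
    assume "(\<And>u v. u < v \<Longrightarrow> P u v \<Longrightarrow> n (u, v) = 0) \<Longrightarrow> triangle_parities P A (\<lambda>u v. False)"
    then have "triangle_parities P A (\<lambda>u v. False)" using mn(2) by (simp add: edges_of_iff)
    then show thesis by (rule that)
  qed
qed

theorem K7_not_in_N2: "\<not> graph_embeds_in {..<7} (edges_of K7) (nonorientable_surface 2)"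
  by (rule notI, erule embeds_in_N2_triangle_parities) (auto simp: K7_parities, simp add: K7_def)

theorem K6K6_not_in_N2: "\<not> graph_embeds_in {..<9} (edges_of K6K6) (nonorientable_surface 2)"
  by (rule notI, erule embeds_in_N2_triangle_parities) (auto simp: K6K6_parities, auto simp: K6K6_def)

theorem K5K5_not_in_N1: "\<not> graph_embeds_in {..<9} (edges_of K5K5) (nonorientable_surface 1)"
  by (rule notI, erule embeds_in_N1_triangle_parities) (auto simp: K5K5_parities, auto simp: K5K5_def)

theorem K5K5_not_in_N0: "\<not> graph_embeds_in {..<9} (edges_of K5K5) (nonorientable_surface 0)"
proof
  assume "graph_embeds_in {..<9} (edges_of K5K5) (nonorientable_surface 0)"
  moreover have "finite (edges_of K5K5)"
    by (rule finite_edges_of[of _ 9]) (auto simp: K5K5_def)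
  ultimately show False using K5K5_not_in_N1 N0_imp_N1 finite_lessThan by blast
qed

section \<open>Straight drawings in the projective plane\<close>

text \<open>
  A function on the half of a symmetric cone where the first coordinate is at most \<open>0\<close> is extended
  to an even function on the cone.
\<close>

definition even_ext :: "(complex \<times> real \<Rightarrow> 'b) \<Rightarrow> complex \<times> real \<Rightarrow> 'b" where
  "even_ext \<kappa> v = (if Re (fst v) \<le> 0 then \<kappa> v else \<kappa> (- v))"

lemma continuous_map_even_ext:
  assumes C: "\<And>v. v \<in> C \<Longrightarrow> - v \<in> C"
    and cont: "continuous_map (top_of_set {v \<in> C. Re (fst v) \<le> 0}) X \<kappa>"
    and even: "\<And>v. v \<in> C \<Longrightarrow> Re (fst v) = 0 \<Longrightarrow> \<kappa> (- v) = \<kappa> v"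
  shows "continuous_map (top_of_set C) X (even_ext \<kappa>)"
proof -
  have "continuous_map (top_of_set C) X (\<lambda>v. if Re (fst v) \<le> 0 then \<kappa> v else \<kappa> (- v))"
  proof (rule continuous_map_cases_le)
    show "continuous_map (top_of_set C) euclideanreal (\<lambda>v. Re (fst v))"
      by (auto intro!: continuous_intros)
    show "continuous_map (subtopology (top_of_set C) {x \<in> topspace (top_of_set C). Re (fst x) \<le> 0}) X \<kappa>"
      using cont by (simp add: subtopology_subtopology Int_absorb1 Collect_conj_eq)
    have "continuous_map (top_of_set {v \<in> C. 0 \<le> Re (fst v)}) (top_of_set {v \<in> C. Re (fst v) \<le> 0}) uminus"
      using C by (auto simp: continuous_map_in_subtopology intro!: continuous_intros)
    then have "continuous_map (top_of_set {v \<in> C. 0 \<le> Re (fst v)}) X (\<kappa> \<circ> uminus)"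
      by (rule continuous_map_compose) (rule cont)
    then show "continuous_map (subtopology (top_of_set C) {x \<in> topspace (top_of_set C). 0 \<le> Re (fst x)}) X (\<lambda>v. \<kappa> (- v))"
      by (simp add: subtopology_subtopology Int_absorb1 Collect_conj_eq o_def)
  qed (use even in auto)
  then show ?thesis by (simp add: even_ext_def[abs_def])
qed

lemma even_ext_minus:
  assumes "\<And>v. v \<in> C \<Longrightarrow> Re (fst v) = 0 \<Longrightarrow> \<kappa> (- v) = \<kappa> v" "v \<in> C"
  shows "even_ext \<kappa> (- v) = even_ext \<kappa> v"
  using assms by (auto simp: even_ext_def)

lemma even_ext_cases:
  obtains c :: real where "c = 1 \<or> c = - 1" "even_ext \<kappa> v = \<kappa> (c *\<^sub>R v)" "Re (fst (c *\<^sub>R v)) \<le> 0"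
  by (cases "Re (fst v) \<le> 0") (use that[of 1] that[of "- 1"] in \<open>auto simp: even_ext_def\<close>)

definition parallel :: "'a::real_vector \<Rightarrow> 'a \<Rightarrow> bool" where
  "parallel v w \<longleftrightarrow> (\<exists>c. v = c *\<^sub>R w)"

text \<open>The point of the unit sphere with first coordinate \<open>x\<close> in the direction \<open>d\<close> from the axis.\<close>

definition sphere_point :: "real \<Rightarrow> complex \<Rightarrow> complex \<times> real" where
  "sphere_point x d = (Complex x (sqrt (1 - x\<^sup>2) * Re d), sqrt (1 - x\<^sup>2) * Im d)"

lemma sphere_point:
  "Re (fst (sphere_point x d)) = x" "perp (sphere_point x d) = of_real (sqrt (1 - x\<^sup>2)) * d"
  by (simp_all add: sphere_point_def perp_def complex_eq_iff)

text \<open>The projective plane as the space of lines through the origin: a line is sent to the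
  class of its unit vector in the half sphere from which the surface is built.\<close>

definition to_N1 :: "complex \<times> real \<Rightarrow> (complex \<times> real) set" where
  "to_N1 = even_ext (\<lambda>v. crosscap_class 1 (v /\<^sub>R norm v))"

lemma scaled_in_holed_sphere_1:
  assumes "v \<noteq> 0" "Re (fst v) \<le> 0"
  shows "v /\<^sub>R norm v \<in> holed_sphere 1"
  using assms unfolding holed_sphere_1 by (auto simp: mult_nonneg_nonpos)

lemma class_1_minus:
  assumes "p \<in> holed_sphere 1" "Re (fst p) = 0"
  shows "crosscap_class 1 (- p) = crosscap_class 1 p"
proof (rule antipodal_same_class_1)
  show "- p \<in> holed_sphere 1" using assms unfolding holed_sphere_1 by auto
qed (use assms in \<open>auto simp: perp_def complex_eq_iff\<close>)

lemma to_N1_even: "v \<noteq> 0 \<Longrightarrow> Re (fst v) = 0 \<Longrightarrow>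
    crosscap_class 1 ((- v) /\<^sub>R norm (- v)) = crosscap_class 1 (v /\<^sub>R norm v)"
  using class_1_minus[of "v /\<^sub>R norm v"] scaled_in_holed_sphere_1[of v] by simp

lemma continuous_map_to_N1: "continuous_map (top_of_set (- {0})) (nonorientable_surface 1) to_N1"
  unfolding to_N1_def
proof (rule continuous_map_even_ext)
  have "continuous_on {v \<in> - {0}. Re (fst v) \<le> 0} (\<lambda>v. v /\<^sub>R norm v)"
    by (intro continuous_intros) auto
  then have "continuous_map (top_of_set {v \<in> - {0}. Re (fst v) \<le> 0}) (top_of_set (holed_sphere 1)) (\<lambda>v. v /\<^sub>R norm v)"
    using scaled_in_holed_sphere_1 by (auto simp: continuous_map_in_subtopology simp del: One_nat_def)
  then have "continuous_map (top_of_set {v \<in> - {0}. Re (fst v) \<le> 0}) (nonorientable_surface 1) (crosscap_class 1 \<circ> (\<lambda>v. v /\<^sub>R norm v))"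
    by (rule continuous_map_compose[OF _ quotient_imp_continuous_map[OF quotient_map_crosscap_class]])
  then show "continuous_map (top_of_set {v \<in> - {0}. Re (fst v) \<le> 0}) (nonorientable_surface 1) (\<lambda>v. crosscap_class 1 (v /\<^sub>R norm v))"
    by (simp add: o_def)
qed (use to_N1_even in auto)

lemma to_N1_minus: "v \<noteq> 0 \<Longrightarrow> to_N1 (- v) = to_N1 v"
  unfolding to_N1_def by (rule even_ext_minus[of "- {0}"]) (use to_N1_even in auto)

lemma same_class_1:
  assumes "p \<in> holed_sphere 1" "crosscap_class 1 p = crosscap_class 1 q" "q \<in> holed_sphere 1"
  shows "p = q \<or> p = - q \<and> Re (fst q) = 0"
proof -
  have "p \<in> crosscap_class 1 p" by (simp add: crosscap_class_def)
  then have "p \<in> crosscap_class 1 q" unfolding assms(2) .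
  then show ?thesis
    unfolding crosscap_class_1[OF assms(3)] by (auto split: if_splits simp: prod_eq_iff complex_eq_iff)
qed

lemma to_N1_eq:
  assumes "v \<noteq> 0" "w \<noteq> 0" "to_N1 v = to_N1 w"
  shows "parallel v w"
proof -
  let ?\<kappa> = "\<lambda>v. crosscap_class 1 (v /\<^sub>R norm v)"
  obtain c where c: "c = 1 \<or> c = - 1" "to_N1 v = ?\<kappa> (c *\<^sub>R v)" "Re (fst (c *\<^sub>R v)) \<le> 0"
    unfolding to_N1_def by (rule even_ext_cases)
  obtain d where d: "d = 1 \<or> d = - 1" "to_N1 w = ?\<kappa> (d *\<^sub>R w)" "Re (fst (d *\<^sub>R w)) \<le> 0"
    unfolding to_N1_def by (rule even_ext_cases)
  let ?v = "c *\<^sub>R v" and ?w = "d *\<^sub>R w"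
  have nz: "?v \<noteq> 0" "?w \<noteq> 0" using assms c(1) d(1) by auto
  have "?v /\<^sub>R norm ?v = ?w /\<^sub>R norm ?w \<or> ?v /\<^sub>R norm ?v = - (?w /\<^sub>R norm ?w)"
    using same_class_1[OF scaled_in_holed_sphere_1[OF nz(1) c(3)] _ scaled_in_holed_sphere_1[OF nz(2) d(3)]]
      assms(3) c(2) d(2) by metis
  then obtain k where "?v /\<^sub>R norm ?v = k *\<^sub>R w"
    by (metis scaleR_scaleR scaleR_minus_left)
  then have "norm ?v *\<^sub>R (?v /\<^sub>R norm ?v) = (norm ?v * k) *\<^sub>R w" by (simp only: scaleR_scaleR)
  moreover have "norm x *\<^sub>R (x /\<^sub>R norm x) = x" if "x \<noteq> 0" for x :: "complex \<times> real" using that by simp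
  ultimately have "?v = (norm ?v * k) *\<^sub>R w" using nz(1) by metis
  then have "c *\<^sub>R ?v = (c * (norm ?v * k)) *\<^sub>R w" by (metis scaleR_scaleR)
  moreover have "c *\<^sub>R ?v = v" using c(1) by auto
  ultimately show ?thesis unfolding parallel_def by metis
qed

text \<open>
  \<open>sd\<close> selects one of two maps for each vertex, and an edge is drawn with the map of its larger end.
\<close>

lemma straight_drawing:
  fixes \<rho> :: "bool \<Rightarrow> complex \<times> real \<Rightarrow> 'b" and p :: "nat \<Rightarrow> complex \<times> real"
    and \<sigma> :: "nat \<Rightarrow> nat \<Rightarrow> real" and sd :: "nat \<Rightarrow> bool"
  assumes cont: "\<And>i. continuous_map (top_of_set C) X (\<rho> i)"
    and minus: "\<And>i v. v \<in> C \<Longrightarrow> - v \<in> C \<and> \<rho> i (- v) = \<rho> i v"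
    and eq: "\<And>i v w. v \<in> C \<Longrightarrow> w \<in> C \<Longrightarrow> \<rho> i v = \<rho> i w \<Longrightarrow> parallel v w"
    and cross: "\<And>u v. u \<in> V \<Longrightarrow> v \<in> V \<Longrightarrow> sd u \<noteq> sd v \<Longrightarrow> disjnt (\<rho> (sd u) ` C') (\<rho> (sd v) ` C)" and C': "C' \<subseteq> C"
    and vert: "\<And>v. v \<in> V \<Longrightarrow> v \<noteq> 0 \<Longrightarrow> p v \<in> C'" and zero: "\<And>v. v \<in> V \<Longrightarrow> p 0 \<in> C \<and> \<rho> (sd v) (p 0) = \<rho> (sd 0) (p 0)"
    and sign: "\<And>u v. \<sigma> u v = 1 \<or> \<sigma> u v = - 1"
    and E: "\<And>u v. u < v \<Longrightarrow> E u v \<Longrightarrow> u \<in> V \<and> v \<in> V \<and> (u = 0 \<or> sd u = sd v)"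
    and seg: "\<And>u v a b. u < v \<Longrightarrow> E u v \<Longrightarrow> a > 0 \<Longrightarrow> b > 0 \<Longrightarrow> a *\<^sub>R p u + (b * \<sigma> u v) *\<^sub>R p v \<in> C'"
    and vv: "\<And>u v. u \<in> V \<Longrightarrow> v \<in> V \<Longrightarrow> u \<noteq> v \<Longrightarrow> (u = 0 \<or> v = 0 \<or> sd u = sd v) \<Longrightarrow> \<not> parallel (p u) (p v)"
    and ev: "\<And>u v w a b. u < v \<Longrightarrow> E u v \<Longrightarrow> w \<in> V \<Longrightarrow> (w = 0 \<or> sd w = sd v) \<Longrightarrow> a > 0 \<Longrightarrow> b > 0 \<Longrightarrow>
        \<not> parallel (a *\<^sub>R p u + (b * \<sigma> u v) *\<^sub>R p v) (p w)"
    and ee: "\<And>u v u' v' a b a' b'. u < v \<Longrightarrow> E u v \<Longrightarrow> u' < v' \<Longrightarrow> E u' v' \<Longrightarrow> (u, v) \<noteq> (u', v') \<Longrightarrow> sd v = sd v' \<Longrightarrow>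
        a > 0 \<Longrightarrow> b > 0 \<Longrightarrow> a' > 0 \<and> b' > 0 \<or> a' < 0 \<and> b' < 0 \<Longrightarrow>
        a *\<^sub>R p u + (b * \<sigma> u v) *\<^sub>R p v \<noteq> a' *\<^sub>R p u' + (b' * \<sigma> u' v') *\<^sub>R p v'"
  shows "graph_embeds_in V (edges_of E) X"
proof -
  define s where "s u v t = (1 - t) *\<^sub>R p u + (t * \<sigma> u v) *\<^sub>R p v" for u v t
  define \<phi> where "\<phi> v = \<rho> (sd v) (p v)" for v
  define \<gamma> where "\<gamma> e t = \<rho> (sd (Max e)) (s (Min e) (Max e) t)" for e t
  have \<gamma>: "\<gamma> {u, v} t = \<rho> (sd v) (s u v t)" if "u < v" for u v t
    using that by (simp add: \<gamma>_def)
  have pC: "p v \<in> C" if "v \<in> V" for v using vert zero C' that by (cases "v = 0") auto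
  have p0: "p v \<noteq> 0" if "v \<in> V" "w \<in> V" "v \<noteq> w" "v = 0 \<or> w = 0 \<or> sd v = sd w" for v w
    using vv[OF that] by (auto simp: parallel_def intro: exI[of _ 0])
  have sC': "s u v t \<in> C'" if "u < v" "E u v" "t \<in> {0<..<1}" for u v t
    using seg[OF that(1,2), of "1 - t" t] that(3) by (simp add: s_def)
  have s1: "\<rho> i (s u v 1) = \<rho> i (p v)" "s u v 1 \<in> C" if "v \<in> V" for i u v
    using sign[of u v] minus[OF pC[OF that]] pC[OF that] by (auto simp: s_def)
  have s0: "s u v 0 = p u" for u v by (simp add: s_def)
  have sC: "s u v t \<in> C" if "u < v" "E u v" "t \<in> {0..1}" for u v t
  proof -
    consider "t = 0" | "t = 1" | "t \<in> {0<..<1}" using \<open>t \<in> {0..1}\<close> by force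
    then show ?thesis
      using sC'[OF that(1,2)] C' s1(2) s0 E[OF that(1,2)] pC by cases auto
  qed
  have \<phi>0: "\<phi> v = \<rho> (sd w) (p v)" if "v \<in> V" "w \<in> V" "v = 0 \<or> sd v = sd w" for v w
    using that zero[of w] by (auto simp: \<phi>_def)
  have snp: "s u v t \<noteq> 0" if "u < v" "E u v" "t \<in> {0<..<1}" for u v t
  proof
    assume "s u v t = 0"
    then have "parallel ((1 - t) *\<^sub>R p u + (t * \<sigma> u v) *\<^sub>R p v) (p v)"
      by (auto simp: s_def parallel_def intro: exI[of _ 0])
    then show False using ev[OF that(1,2), of v "1 - t" t] E[OF that(1,2)] that(3) by auto
  qed
  have inj\<phi>: "inj_on \<phi> V"
  proof (rule inj_onI, rule ccontr)
    fix u v assume u: "u \<in> V" and v: "v \<in> V" and eq\<phi>: "\<phi> u = \<phi> v" and ne: "u \<noteq> v"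
    show False
    proof (cases "u = 0 \<or> v = 0 \<or> sd u = sd v")
      case True
      then obtain i where "\<phi> u = \<rho> i (p u)" "\<phi> v = \<rho> i (p v)" using \<phi>0 u v by (metis \<phi>_def)
      then show False using eq[OF pC[OF u] pC[OF v], of i] vv[OF u v ne True] eq\<phi> by simp
    next
      case False
      then show False
        using cross[OF u v] vert[OF u] vert[OF v] C' eq\<phi> by (auto simp: \<phi>_def disjnt_iff)
    qed
  qed
  have ed: "\<exists>u v. e = {u, v} \<and> u < v \<and> E u v" if "e \<in> edges_of E" for e
    using that by (auto simp: edges_of_def)
  have iv: "\<gamma> {u, v} t \<noteq> \<phi> w" if uv: "u < v" "E u v" "t \<in> {0<..<1}" and w: "w \<in> V" for u v w t
  proof
    assume h: "\<gamma> {u, v} t = \<phi> w"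
    have V: "v \<in> V" using E[OF uv(1,2)] by simp
    show False
    proof (cases "w = 0 \<or> sd w = sd v")
      case True
      then have "\<rho> (sd v) (s u v t) = \<rho> (sd v) (p w)" using h \<gamma>[OF uv(1)] \<phi>0[OF w V] by simp
      then have "parallel (s u v t) (p w)"
        using eq[OF _ pC[OF w]] sC'[OF uv] C' by blast
      then show False
        using ev[OF uv(1,2) w True, of "1 - t" t] uv(3) by (simp add: s_def)
    next
      case False
      then show False
        using cross[OF V w] vert[OF w] sC'[OF uv] C' h \<gamma>[OF uv(1)] by (auto simp: \<phi>_def disjnt_iff)
    qed
  qed
  have ii: "\<gamma> {u, v} t \<noteq> \<gamma> {u', v'} t'"
    if uv: "u < v" "E u v" "t \<in> {0<..<1}" and uv': "u' < v'" "E u' v'" "t' \<in> {0<..<1}" and ne: "(u, v) \<noteq> (u', v')"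
    for u v u' v' t t'
  proof
    assume h: "\<gamma> {u, v} t = \<gamma> {u', v'} t'"
    have V: "v \<in> V" "v' \<in> V" using E uv uv' by auto
    show False
    proof (cases "sd v = sd v'")
      case True
      then have "\<rho> (sd v) (s u v t) = \<rho> (sd v) (s u' v' t')" using h \<gamma> uv uv' by simp
      then obtain c where c: "s u v t = c *\<^sub>R s u' v' t'"
        using eq[of "s u v t" "s u' v' t'"] sC'[OF uv] sC'[OF uv'] C' unfolding parallel_def by blast
      \<comment> \<open>The factor \<open>c\<close> may be negative, since opposite vectors give the
        same point. This is why \<open>ee\<close> allows both signs for the second pair of
        coefficients.\<close>
      have "c \<noteq> 0" using c snp[OF uv] by auto
      then have "c * (1 - t') > 0 \<and> c * t' > 0 \<or> c * (1 - t') < 0 \<and> c * t' < 0"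
        using uv'(3) by (cases "c > 0") (auto simp: mult_neg_pos)
      then have "(1 - t) *\<^sub>R p u + (t * \<sigma> u v) *\<^sub>R p v \<noteq>
          (c * (1 - t')) *\<^sub>R p u' + (c * t' * \<sigma> u' v') *\<^sub>R p v'"
        using ee[OF uv(1,2) uv'(1,2) ne True, of "1 - t" t "c * (1 - t')" "c * t'"] uv(3) by simp
      then show False using c by (simp add: s_def scaleR_add_right mult.assoc)
    next
      case False
      then show False
        using cross[OF V] sC'[OF uv] sC'[OF uv'] C' h \<gamma>[OF uv(1)] \<gamma>[OF uv'(1)] by (auto simp: disjnt_iff)
    qed
  qed
  show ?thesis
    unfolding graph_embeds_in_def
  proof (intro exI[of _ \<phi>] exI[of _ \<gamma>] conjI ballI impI)
    show "inj_on \<phi> V" by (rule inj\<phi>)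
    have top: "\<rho> i ` C \<subseteq> topspace X" for i
      using continuous_map_image_subset_topspace[OF cont[of i]] by simp
    then show "\<phi> ` V \<subseteq> topspace X" using pC by (auto simp: \<phi>_def)
    fix e assume "e \<in> edges_of E"
    then obtain u v where e: "e = {u, v}" and uv: "u < v" "E u v" using ed by blast
    note V = E[OF uv]
    have "continuous_map (top_of_set {0..1}) (top_of_set C) (s u v)"
      unfolding s_def[abs_def] using sC[OF uv] by (auto simp: s_def continuous_map_in_subtopology intro!: continuous_intros)
    then have "pathin X (\<rho> (sd v) \<circ> s u v)"
      unfolding pathin_def by (rule continuous_map_compose[OF _ cont])
    moreover have "\<gamma> {u, v} = \<rho> (sd v) \<circ> s u v" by (rule ext) (simp add: \<gamma>[OF uv(1)])
    ultimately show "pathin X (\<gamma> e)" unfolding e by simp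
    show "inj_on (\<gamma> e) {0..1}"
    proof (rule inj_onI)
      fix t t' assume t: "t \<in> {0..1::real}" "t' \<in> {0..1::real}" and "\<gamma> e t = \<gamma> e t'"
      then have "parallel (s u v t) (s u v t')"
        unfolding e \<gamma>[OF uv(1)] by (intro eq[OF sC[OF uv] sC[OF uv]])
      then obtain c where "s u v t = c *\<^sub>R s u v t'" unfolding parallel_def by blast
      then have c: "(1 - t - c * (1 - t')) *\<^sub>R p u = ((c * t' - t) * \<sigma> u v) *\<^sub>R p v"
        by (simp add: s_def algebra_simps)
      have ne: "u \<noteq> v" and sduv: "v = 0 \<or> u = 0 \<or> sd v = sd u" using uv(1) V by auto
      have ct: "c * t' = t"
      proof (rule ccontr)
        assume "c * t' \<noteq> t"
        then have k: "(c * t' - t) * \<sigma> u v \<noteq> 0" using sign[of u v] by auto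
        then have "p v = ((1 - t - c * (1 - t')) / ((c * t' - t) * \<sigma> u v)) *\<^sub>R p u"
          using c by (metis (no_types, lifting) divide_inverse_commute scaleR_one left_inverse scaleR_scaleR)
        then show False using vv[of v u] V ne sduv unfolding parallel_def by blast
      qed
      then have "(1 - t - c * (1 - t')) *\<^sub>R p u = 0" using c by simp
      moreover have "p u \<noteq> 0" using p0[of u v] V ne sduv by auto
      ultimately have "1 - t = c * (1 - t')" by simp
      then have "c = 1" using ct by (simp add: algebra_simps)
      then show "t = t'" using ct by simp
    qed
    have "\<gamma> e 0 = \<phi> u" unfolding e \<gamma>[OF uv(1)] s0 using \<phi>0[of u v] V by simp
    moreover have "\<gamma> e 1 = \<phi> v" unfolding e \<gamma>[OF uv(1)] using s1(1) V by (simp add: \<phi>_def)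
    ultimately show "{\<gamma> e 0, \<gamma> e 1} = \<phi> ` e" by (simp add: e)
    show "\<gamma> e ` {0<..<1} \<inter> \<phi> ` V = {}" unfolding e using iv[OF uv] by blast
    fix e' assume e'E: "e' \<in> edges_of E" "e \<noteq> e'"
    then obtain u' v' where e': "e' = {u', v'}" and uv': "u' < v'" "E u' v'" using ed by blast
    have "(u, v) \<noteq> (u', v')" using e'E(2) e e' by auto
    then show "\<gamma> e ` {0<..<1} \<inter> \<gamma> e' ` {0<..<1} = {}" unfolding e e' using ii[OF uv _ uv'] by blast
  qed
qed

type_synonym ivec = "int \<times> int \<times> int"

definition real_vec :: "ivec \<Rightarrow> complex \<times> real" where
  "real_vec = (\<lambda>(x, y, z). (Complex (of_int x) (of_int y), of_int z))"

definition det3 :: "ivec \<Rightarrow> ivec \<Rightarrow> ivec \<Rightarrow> int" where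
  "det3 = (\<lambda>(a, b, c) (d, e, f) (g, h, i). a * (e * i - f * h) - b * (d * i - f * g) + c * (d * h - e * g))"

text \<open>Apply to both sides the linear form \<open>det3 _ r s\<close>, extended to real vectors;
  it vanishes on \<open>r\<close> and \<open>s\<close>.\<close>

lemma det3_relation:
  assumes "a *\<^sub>R real_vec p + b *\<^sub>R real_vec q = c *\<^sub>R real_vec r + d *\<^sub>R real_vec s"
  shows "a * of_int (det3 p r s) + b * of_int (det3 q r s) = 0"
proof -
  obtain p1 p2 p3 q1 q2 q3 r1 r2 r3 s1 s2 s3 where [simp]: "p = (p1, p2, p3)" "q = (q1, q2, q3)"
    "r = (r1, r2, r3)" "s = (s1, s2, s3)" by (metis prod_cases3)
  have 1: "a * p1 + b * q1 = c * r1 + d * s1" "a * p2 + b * q2 = c * r2 + d * s2" "a * p3 + b * q3 = c * r3 + d * s3"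
    using assms by (simp_all add: real_vec_def complex_eq_iff)
  have "a * of_int (det3 p r s) + b * of_int (det3 q r s) =
      (a * p1 + b * q1) * (r2 * s3 - r3 * s2) - (a * p2 + b * q2) * (r1 * s3 - r3 * s1) + (a * p3 + b * q3) * (r1 * s2 - r2 * s1)"
    by (simp add: det3_def algebra_simps)
  also have "\<dots> = 0" unfolding 1 by (simp add: algebra_simps)
  finally show ?thesis .
qed

text \<open>Meant for the values of a linear form at the ends of a segment: both ends lie weakly on
  one side of its zero line and not both on it, so no inner point of the segment meets that
  line.\<close>

definition apart :: "int \<Rightarrow> int \<Rightarrow> bool" where
  "apart x y \<longleftrightarrow> 0 \<le> x * y \<and> (x \<noteq> 0 \<or> y \<noteq> 0)"

lemma apart_combination:
  assumes "apart x y" "a > 0 \<and> b > 0 \<or> a < 0 \<and> b < 0"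
  shows "a * of_int x + b * of_int y \<noteq> (0::real)"
proof -
  have *: "a * of_int x + b * of_int y \<noteq> (0::real)" if "a > 0" "b > 0" for a b :: real
  proof -
    consider "0 \<le> x" "0 \<le> y" "x > 0 \<or> y > 0" | "x \<le> 0" "y \<le> 0" "x < 0 \<or> y < 0"
      using assms(1) by (force simp: apart_def zero_le_mult_iff)
    then show ?thesis
    proof cases
      case 1
      then have "a * of_int x \<ge> 0" "b * of_int y \<ge> 0" "a * of_int x > 0 \<or> b * of_int y > 0" using that by auto
      then show ?thesis by linarith
    next
      case 2
      then have "a * of_int x \<le> 0" "b * of_int y \<le> 0" "a * of_int x < 0 \<or> b * of_int y < 0"
        using that by (auto simp: mult_le_0_iff mult_less_0_iff)
      then show ?thesis by linarith
    qed
  qed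
  show ?thesis using assms(2) *[of a b] *[of "- a" "- b"] by auto
qed

definition scale3 :: "int \<Rightarrow> ivec \<Rightarrow> ivec" where
  "scale3 k = (\<lambda>(x, y, z). (k * x, k * y, k * z))"

lemma real_vec_scale3: "real_vec (scale3 k v) = of_int k *\<^sub>R real_vec v"
  by (cases v) (simp add: real_vec_def scale3_def complex_eq_iff)

text \<open>
  The segments from \<open>p\<close> to \<open>q\<close> and from \<open>r\<close> to \<open>s\<close> do not meet in the projective plane if one of
  them lies on one side of the line of the other.
\<close>

definition uncrossed :: "ivec \<Rightarrow> ivec \<Rightarrow> ivec \<Rightarrow> ivec \<Rightarrow> bool" where
  "uncrossed p q r s \<longleftrightarrow> apart (det3 p r s) (det3 q r s) \<or> apart (det3 r p q) (det3 s p q)"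

lemma uncrossed:
  assumes "uncrossed p q r s" "a > 0" "b > 0" "c > 0 \<and> d > 0 \<or> c < 0 \<and> d < 0"
  shows "a *\<^sub>R real_vec p + b *\<^sub>R real_vec q \<noteq> c *\<^sub>R real_vec r + d *\<^sub>R real_vec s"
  using assms det3_relation[of a p b q c r d s] det3_relation[of c r d s a p b q]
    apart_combination[of "det3 p r s" "det3 q r s" a b] apart_combination[of "det3 r p q" "det3 s p q" c d]
  unfolding uncrossed_def by metis

text \<open>The points are given by homogeneous coordinates, no three of them on a line. Two points
  of the projective plane are joined by two segments, and the sign \<open>k\<close> of an edge
  selects one of them.\<close>

locale integer_drawing =
  fixes L :: "ivec list" and ds :: "(nat \<times> nat \<times> int) list"
  assumes general: "\<And>i j k. i < j \<Longrightarrow> j < k \<Longrightarrow> k < length L \<Longrightarrow> det3 (L ! i) (L ! j) (L ! k) \<noteq> 0"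
    and large: "length L \<ge> 3"
    and edges: "\<And>i j k. (i, j, k) \<in> set ds \<Longrightarrow> i < j \<and> j < length L \<and> (k = 1 \<or> k = - 1)"
    and apart: "\<And>i j k i' j' k'. (i, j, k) \<in> set ds \<Longrightarrow> (i', j', k') \<in> set ds \<Longrightarrow> (i, j) \<noteq> (i', j') \<Longrightarrow>
      uncrossed (L ! i) (scale3 k (L ! j)) (L ! i') (scale3 k' (L ! j'))"
begin

lemma det_nz:
  assumes "distinct [i, j, k]" "i < length L" "j < length L" "k < length L"
  shows "det3 (L ! i) (L ! j) (L ! k) \<noteq> 0"
proof -
  have swap: "det3 q p r = - det3 p q r" "det3 p r q = - det3 p q r" for p q r
    by (cases p; cases q; cases r; simp add: det3_def algebra_simps)+
  have "i < j \<and> j < k \<or> i < k \<and> k < j \<or> j < i \<and> i < k \<or> j < k \<and> k < i \<or> k < i \<and> i < j \<or> k < j \<and> j < i"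
    using assms(1) by auto
  then show ?thesis
    using general[of i j k] general[of i k j] general[of j i k] general[of j k i] general[of k i j] general[of k j i] assms
      swap(1)[of "L ! j" "L ! i" "L ! k"] swap(2)[of "L ! i" "L ! k" "L ! j"] swap(2)[of "L ! j" "L ! k" "L ! i"]
      swap(1)[of "L ! i" "L ! k" "L ! j"] swap(1)[of "L ! k" "L ! j" "L ! i"] swap(1)[of "L ! k" "L ! i" "L ! j"]
      swap(2)[of "L ! k" "L ! i" "L ! j"] swap(2)[of "L ! j" "L ! i" "L ! k"]
    by (smt (verit))
qed

lemma third:
  assumes "i < length L" "j < length L"
  obtains x where "x < length L" "x \<noteq> i" "x \<noteq> j"
proof -
  have "\<not> {..<length L} \<subseteq> {i, j}"
  proof
    assume "{..<length L} \<subseteq> {i, j}"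
    then have "card {..<length L} \<le> card {i, j}" by (intro card_mono) auto
    also have "\<dots> \<le> 2" by (simp add: card_insert_if)
    finally show False using large by simp
  qed
  then show thesis using that by blast
qed

lemma not_parallel:
  assumes "i < length L" "j < length L" "i \<noteq> j"
  shows "\<not> parallel (real_vec (L ! i)) (real_vec (L ! j))"
proof
  assume "parallel (real_vec (L ! i)) (real_vec (L ! j))"
  then obtain c where c: "real_vec (L ! i) = c *\<^sub>R real_vec (L ! j)" by (auto simp: parallel_def)
  obtain x where x: "x < length L" "x \<noteq> i" "x \<noteq> j" using third[OF assms(1,2)] .
  have "1 *\<^sub>R real_vec (L ! i) + 0 *\<^sub>R real_vec (L ! i) = c *\<^sub>R real_vec (L ! j) + 0 *\<^sub>R real_vec (L ! x)" using c by simp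
  from det3_relation[OF this] show False using det_nz[of i j x] assms x by auto
qed

lemma edge_not_parallel:
  assumes e: "(i, j, k) \<in> set ds" and w: "w < length L" and ab: "a > 0" "b > 0"
  shows "\<not> parallel (a *\<^sub>R real_vec (L ! i) + (b * of_int k) *\<^sub>R real_vec (L ! j)) (real_vec (L ! w))"
proof
  note ij = edges[OF e]
  assume "parallel (a *\<^sub>R real_vec (L ! i) + (b * of_int k) *\<^sub>R real_vec (L ! j)) (real_vec (L ! w))"
  then obtain c where c: "a *\<^sub>R real_vec (L ! i) + (b * of_int k) *\<^sub>R real_vec (L ! j) = c *\<^sub>R real_vec (L ! w)"
    by (auto simp: parallel_def)
  have rel: "a * of_int (det3 (L ! i) (L ! w) (L ! x)) + (b * of_int k) * of_int (det3 (L ! j) (L ! w) (L ! x)) = 0" for x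
    using det3_relation[of a "L ! i" "b * of_int k" "L ! j" c "L ! w" 0 "L ! x"] c by simp
  have d0: "det3 p p q = 0" "det3 p q p = 0" for p q
    by (cases p; cases q; simp add: det3_def algebra_simps)+
  show False
  proof (cases "w = i")
    case True
    obtain x where x: "x < length L" "x \<noteq> i" "x \<noteq> j" using third[of i j] ij by auto
    then show ?thesis using rel[of x] True d0 det_nz[of j i x] ij ab by auto
  next
    case False
    show ?thesis
    proof (cases "w = j")
      case True
      obtain x where x: "x < length L" "x \<noteq> i" "x \<noteq> j" using third[of i j] ij by auto
      then show ?thesis using rel[of x] True d0 det_nz[of i j x] ij ab by auto
    next
      case False
      then show ?thesis using rel[of j] \<open>w \<noteq> i\<close> d0 det_nz[of i w j] ij ab w by auto
    qed
  qed
qed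

lemma edges_uncrossed:
  assumes "(i, j, k) \<in> set ds" "(i', j', k') \<in> set ds" "(i, j) \<noteq> (i', j')"
    and "a > 0" "b > 0" "a' > 0 \<and> b' > 0 \<or> a' < 0 \<and> b' < 0"
  shows "a *\<^sub>R real_vec (L ! i) + (b * of_int k) *\<^sub>R real_vec (L ! j) \<noteq> a' *\<^sub>R real_vec (L ! i') + (b' * of_int k') *\<^sub>R real_vec (L ! j')"
  using uncrossed[OF apart[OF assms(1-3)] assms(4-6)] by (simp add: real_vec_scale3)

end

text \<open>The first six points carry a complete graph. The triangle of the coordinate vectors is
  the positive octant and contains none of the next three points, so the vector
  \<open>(1, 2, 2)\<close> can be placed inside it. The last point is
  \<open>(1, 2, 2) + (1, 1, 0)\<close> and lies inside the triangle of the vertices 0, 1 and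
  6.\<close>

definition G8_points :: "ivec list" where
  "G8_points = [(1, 0, 0), (0, 1, 0), (0, 0, 1), (-2, 1, -1), (1, -2, -1), (1, 1, -2), (1, 2, 2), (2, 3, 2)]"

definition G8_edges :: "(nat \<times> nat \<times> int) list" where
  "G8_edges = [(0, 1, 1), (0, 2, 1), (0, 3, -1), (0, 4, 1), (0, 5, 1), (1, 2, 1), (1, 3, 1), (1, 4, -1), (1, 5, 1),
    (2, 3, -1), (2, 4, -1), (2, 5, -1), (3, 4, -1), (3, 5, 1), (4, 5, 1),
    (0, 6, 1), (1, 6, 1), (2, 6, 1), (0, 7, 1), (1, 7, 1), (6, 7, 1)]"

lemma drawing_check:
  assumes "list_all (\<lambda>i. list_all (\<lambda>j. list_all (\<lambda>k. i < j \<and> j < k \<longrightarrow> det3 (L ! i) (L ! j) (L ! k) \<noteq> 0)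
      [0..<length L]) [0..<length L]) [0..<length L]"
    and "length L \<ge> 3"
    and "list_all (\<lambda>(i, j, k). i < j \<and> j < length L \<and> (k = 1 \<or> k = - 1)) ds"
    and "list_all (\<lambda>(i, j, k). list_all (\<lambda>(i', j', k'). (i, j) = (i', j') \<or>
      uncrossed (L ! i) (scale3 k (L ! j)) (L ! i') (scale3 k' (L ! j'))) ds) ds"
  shows "integer_drawing L ds"
proof
  show "det3 (L ! i) (L ! j) (L ! k) \<noteq> 0" if "i < j" "j < k" "k < length L" for i j k
    using assms(1) that by (auto simp: list_all_iff)
  show "length L \<ge> 3" by fact
  show "i < j \<and> j < length L \<and> (k = 1 \<or> k = - 1)" if "(i, j, k) \<in> set ds" for i j k
    using assms(3) that by (auto simp: list_all_iff)
  show "uncrossed (L ! i) (scale3 k (L ! j)) (L ! i') (scale3 k' (L ! j'))"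
    if "(i, j, k) \<in> set ds" "(i', j', k') \<in> set ds" "(i, j) \<noteq> (i', j')" for i j k i' j' k'
    using assms(4) that by (fastforce simp: list_all_iff)
qed

lemma G8_drawing: "integer_drawing G8_points G8_edges"
  by (rule drawing_check; code_simp)

context integer_drawing
begin

definition joined :: "nat \<Rightarrow> nat \<Rightarrow> bool" where
  "joined u v \<longleftrightarrow> (\<exists>k. (u, v, k) \<in> set ds)"

definition edge_sign :: "nat \<Rightarrow> nat \<Rightarrow> int" where
  "edge_sign u v = (if (u, v, 1) \<in> set ds then 1 else - 1)"

lemma joined_edge: "joined u v \<Longrightarrow> (u, v, edge_sign u v) \<in> set ds"
  unfolding joined_def edge_sign_def using edges by auto

lemma embeds_in_N1: "graph_embeds_in {..<length L} (edges_of joined) (nonorientable_surface 1)"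
proof (rule straight_drawing[where \<rho> = "\<lambda>i. to_N1" and p = "\<lambda>v. real_vec (L ! v)" and \<sigma> = "\<lambda>u v. of_int (edge_sign u v)"
      and sd = "\<lambda>v. True" and C = "- {0}" and C' = "- {0}"])
  have length_pos: "0 < length L" using large by linarith
  have np: "real_vec (L ! v) \<noteq> 0" if v: "v < length L" for v
  proof
    assume "real_vec (L ! v) = 0"
    moreover obtain x where "x < length L" "x \<noteq> v" by (rule third[OF v v])
    ultimately show False using not_parallel[of v x] v by (auto simp: parallel_def intro: exI[of _ 0])
  qed
  show "v \<in> {..<length L} \<Longrightarrow> v \<noteq> 0 \<Longrightarrow> real_vec (L ! v) \<in> - {0}"
    "v \<in> {..<length L} \<Longrightarrow> real_vec (L ! 0) \<in> - {0} \<and> to_N1 (real_vec (L ! 0)) = to_N1 (real_vec (L ! 0))" for v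
    using np[OF length_pos] np[of v] by auto
  show "a *\<^sub>R real_vec (L ! u) + (b * of_int (edge_sign u v)) *\<^sub>R real_vec (L ! v) \<in> - {0}"
    if "u < v" "joined u v" "a > 0" "b > 0" for u v a b
    using edge_not_parallel[OF joined_edge[OF that(2)] length_pos that(3,4)]
    by (auto simp: parallel_def dest: spec[of _ 0])
  show "u \<in> {..<length L} \<and> v \<in> {..<length L} \<and> (u = 0 \<or> True = True)" if "joined u v" for u v
    using edges joined_edge[OF that] by fastforce
qed (use continuous_map_to_N1 to_N1_minus to_N1_eq not_parallel edge_not_parallel joined_edge edges_uncrossed in
    \<open>auto simp: edge_sign_def\<close>)

end

text \<open>Its maximal cliques are \<open>{0..5}\<close>, \<open>{0, 1, 2, 6}\<close> and
  \<open>{0, 1, 6, 7}\<close>. The first and the third receive two cliques that share one or two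
  elements; the first and the second receive the ring with three corners of two elements.\<close>

definition G8 :: "nat \<Rightarrow> nat \<Rightarrow> bool" where
  "G8 u v \<longleftrightarrow> v < 6 \<or> v = 6 \<and> u < 3 \<or> v = 7 \<and> (u < 2 \<or> u = 6)"

theorem G8_in_N1: "graph_embeds_in {..<8} (edges_of G8) (nonorientable_surface 1)"
proof -
  interpret integer_drawing G8_points G8_edges by (rule G8_drawing)
  have check: "list_all (\<lambda>v. list_all (\<lambda>u. u < v \<and> G8 u v \<longrightarrow> (u, v) \<in> set (map (\<lambda>(a, b, k). (a, b)) G8_edges)) [0..<8]) [0..<8]"
    by code_simp
  have "{u, v} \<in> edges_of joined" if uv: "u < v" "G8 u v" for u v
  proof -
    have "v \<in> set [0..<8]" "u \<in> set [0..<8]" using uv by (auto simp: G8_def)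
    then have "(u, v) \<in> set (map (\<lambda>(a, b, k). (a, b)) G8_edges)" using check uv unfolding list_all_iff by metis
    then have "joined u v" by (auto simp: joined_def)
    then show ?thesis using uv(1) by (simp add: edges_of_iff)
  qed
  then have "edges_of G8 \<subseteq> edges_of joined" unfolding edges_of_def[of G8] by blast
  moreover have "e \<subseteq> {..<8}" if "e \<in> edges_of G8" for e using that by (auto simp: edges_of_def G8_def)
  moreover have "length G8_points = 8" by (simp add: G8_points_def)
  ultimately show ?thesis
    by (intro graph_embeds_in_subgraph[OF embeds_in_N1, of id]) auto
qed

section \<open>Two drawings on the two halves of the Klein bottle\<close>

text \<open>For \<open>Re (fst v) \<le> 0\<close> the height
  \<open>1 + Re (fst v) / norm (perp v)\<close> runs from 0 on the boundary of the cone to 1 where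
  \<open>Re (fst v) = 0\<close>. The boundary goes to the circle that separates the two halves of
  the Klein bottle, and the core of the Moebius band goes to the cap circle.\<close>

definition half_N2 :: "bool \<Rightarrow> complex \<times> real \<Rightarrow> (complex \<times> real) set" where
  "half_N2 i = even_ext (\<lambda>v. crosscap_class 2
     (sphere_point ((if i then - 1 else 1) * (sqrt 2 / 2) * (1 + Re (fst v) / norm (perp v)))
        (perp v / of_real (norm (perp v)))))"

text \<open>In the projective plane this is the complement of an open disc, hence a Moebius
  band.\<close>

definition flat_cone :: "(complex \<times> real) set" where
  "flat_cone = {v. v \<noteq> 0 \<and> \<bar>Re (fst v)\<bar> \<le> norm (perp v)}"

lemma flat_cone_perp: "v \<in> flat_cone \<Longrightarrow> perp v \<noteq> 0"
proof
  assume v: "v \<in> flat_cone" and "perp v = 0"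
  then have "Re (fst v) = 0" using v by (simp add: flat_cone_def)
  then have "v = 0" using \<open>perp v = 0\<close> by (simp add: perp_def complex_eq_iff prod_eq_iff)
  then show False using v by (simp add: flat_cone_def)
qed

lemma perp_minus: "perp (- v) = - perp v"
  by (simp add: perp_def complex_eq_iff)

lemma perp_scaleR: "perp (c *\<^sub>R v) = of_real c * perp v"
  by (simp add: perp_def complex_eq_iff)

lemma flat_cone_minus: "v \<in> flat_cone \<Longrightarrow> - v \<in> flat_cone"
  by (simp add: flat_cone_def perp_minus)

lemma sphere_point_in_holed_sphere_2:
  assumes "\<bar>x\<bar> \<le> sqrt 2 / 2" "norm d = 1"
  shows "sphere_point x d \<in> holed_sphere 2"
proof -
  have "x\<^sup>2 \<le> (sqrt 2 / 2)\<^sup>2" using assms(1) by (metis abs_ge_zero power2_abs power_mono)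
  then have "x\<^sup>2 \<le> 1" by (simp add: power_divide)
  then have "sphere_point x d \<in> sphere 0 1"
    unfolding sphere_perp sphere_point using assms(2) by (simp add: norm_mult)
  then show ?thesis using assms(1) unfolding holed_sphere_2 sphere_point by simp
qed

lemma same_class_2:
  assumes "\<bar>x\<bar> \<le> sqrt 2 / 2" "norm d = 1" "\<bar>y\<bar> \<le> sqrt 2 / 2" "norm e = 1"
    and "crosscap_class 2 (sphere_point x d) = crosscap_class 2 (sphere_point y e)"
  shows "x = y \<and> (d = e \<or> d = - e \<and> \<bar>x\<bar> = sqrt 2 / 2)"
proof -
  let ?p = "sphere_point x d" and ?q = "sphere_point y e"
  have q: "?q \<in> holed_sphere 2" by (rule sphere_point_in_holed_sphere_2[OF assms(3,4)])
  have "?p \<in> crosscap_class 2 ?p" by (simp add: crosscap_class_def)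
  then have "?p \<in> crosscap_class 2 ?q" unfolding assms(5) .
  then have "?p = ?q \<or> ?p = (cnj (fst ?q), - snd ?q) \<and> \<bar>Re (fst ?q)\<bar> = sqrt 2 / 2"
    unfolding crosscap_class_2[OF q] by (auto split: if_splits)
  then have *: "x = y \<and> (perp ?p = perp ?q \<or> perp ?p = - perp ?q \<and> \<bar>y\<bar> = sqrt 2 / 2)"
    by (metis perp_turn point_eq_iff sphere_point(1) complex_cnj(1) fst_conv cnj.sel(1))
  have "x\<^sup>2 \<le> (sqrt 2 / 2)\<^sup>2" using assms(1) by (metis abs_ge_zero power2_abs power_mono)
  then have "sqrt (1 - x\<^sup>2) \<noteq> 0" by (simp add: power_divide)
  then have r: "complex_of_real (sqrt (1 - x\<^sup>2)) \<noteq> 0" by (simp only: of_real_eq_0_iff not_False_eq_True)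
  have xy: "x = y" using * by simp
  from * have "perp ?p = perp ?q \<or> perp ?p = - perp ?q \<and> \<bar>y\<bar> = sqrt 2 / 2" ..
  then show ?thesis
  proof
    assume "perp ?p = perp ?q"
    then have "d = e" using r unfolding sphere_point(2) xy by (metis mult_left_cancel)
    then show ?thesis using xy by simp
  next
    assume h: "perp ?p = - perp ?q \<and> \<bar>y\<bar> = sqrt 2 / 2"
    then have "of_real (sqrt (1 - y\<^sup>2)) * d = of_real (sqrt (1 - y\<^sup>2)) * (- e)"
      unfolding sphere_point(2) xy by simp
    then have "d = - e" using r unfolding xy by (metis mult_left_cancel)
    then show ?thesis using xy h by simp
  qed
qed

lemma class_2_minus:
  assumes "\<bar>x\<bar> = sqrt 2 / 2" "norm d = 1"
  shows "crosscap_class 2 (sphere_point x (- d)) = crosscap_class 2 (sphere_point x d)"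
proof -
  let ?p = "sphere_point x (- d)" and ?q = "sphere_point x d"
  have p: "?p \<in> holed_sphere 2" and q: "?q \<in> holed_sphere 2"
    using assms by (auto intro!: sphere_point_in_holed_sphere_2)
  have pq: "(cnj (fst ?q), - snd ?q) = ?p" "(cnj (fst ?p), - snd ?p) = ?q"
    by (simp_all add: sphere_point_def complex_eq_iff)
  have "crosscap_class 2 ?p = {?p, ?q}"
    using crosscap_class_2[OF p] assms(1) unfolding sphere_point(1) pq by simp
  moreover have "crosscap_class 2 ?q = {?q, ?p}"
    using crosscap_class_2[OF q] assms(1) unfolding sphere_point(1) pq by simp
  ultimately show ?thesis by (simp add: insert_commute)
qed

lemma height_bound:
  assumes "v \<in> flat_cone" "Re (fst v) \<le> 0"
  shows "0 \<le> 1 + Re (fst v) / norm (perp v)" "1 + Re (fst v) / norm (perp v) \<le> 1"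
    "\<bar>(if i then - 1 else 1) * (sqrt 2 / 2) * (1 + Re (fst v) / norm (perp v))\<bar> \<le> sqrt 2 / 2"
proof -
  have "norm (perp v) > 0" using flat_cone_perp[OF assms(1)] by simp
  then show 1: "0 \<le> 1 + Re (fst v) / norm (perp v)" "1 + Re (fst v) / norm (perp v) \<le> 1"
    using assms by (auto simp: flat_cone_def field_simps divide_nonpos_pos)
  then show "\<bar>(if i then - 1 else 1) * (sqrt 2 / 2) * (1 + Re (fst v) / norm (perp v))\<bar> \<le> sqrt 2 / 2"
    using mult_left_mono[OF 1(2), of "sqrt 2 / 2"] by (simp add: abs_mult)
qed

lemma half_N2_even:
  assumes "v \<in> flat_cone" "Re (fst v) = 0"
  shows "crosscap_class 2 (sphere_point ((if i then - 1 else 1) * (sqrt 2 / 2) * (1 + Re (fst (- v)) / norm (perp (- v))))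
        (perp (- v) / of_real (norm (perp (- v)))))
    = crosscap_class 2 (sphere_point ((if i then - 1 else 1) * (sqrt 2 / 2) * (1 + Re (fst v) / norm (perp v)))
        (perp v / of_real (norm (perp v))))"
  using class_2_minus[of "(if i then - 1 else 1) * (sqrt 2 / 2)" "perp v / of_real (norm (perp v))"]
    flat_cone_perp[OF assms(1)] assms(2)
  by (simp add: perp_minus norm_divide)

lemma continuous_map_half_N2: "continuous_map (top_of_set flat_cone) (nonorientable_surface 2) (half_N2 i)"
  unfolding half_N2_def
proof (rule continuous_map_even_ext)
  let ?C = "{v \<in> flat_cone. Re (fst v) \<le> 0}"
  let ?f = "\<lambda>v. sphere_point ((if i then - 1 else 1) * (sqrt 2 / 2) * (1 + Re (fst v) / norm (perp v)))
        (perp v / of_real (norm (perp v)))"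
  have "continuous_on ?C ?f"
    unfolding sphere_point_def Complex_eq using flat_cone_perp by (intro continuous_intros) auto
  moreover have "?f v \<in> holed_sphere 2" if "v \<in> ?C" for v
    using height_bound(3)[of v i] that flat_cone_perp[of v]
    by (intro sphere_point_in_holed_sphere_2) (auto simp: norm_divide)
  ultimately have "continuous_map (top_of_set ?C) (top_of_set (holed_sphere 2)) ?f"
    by (auto simp: continuous_map_in_subtopology)
  then have "continuous_map (top_of_set ?C) (nonorientable_surface 2) (crosscap_class 2 \<circ> ?f)"
    by (rule continuous_map_compose[OF _ quotient_imp_continuous_map[OF quotient_map_crosscap_class]])
  then show "continuous_map (top_of_set ?C) (nonorientable_surface 2) (\<lambda>v. crosscap_class 2 (?f v))"
    by (simp add: o_def)
qed (use half_N2_even flat_cone_minus in auto)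

lemma half_N2_minus: "v \<in> flat_cone \<Longrightarrow> half_N2 i (- v) = half_N2 i v"
  unfolding half_N2_def by (rule even_ext_minus[of flat_cone]) (use half_N2_even in auto)

lemma signed_eq:
  fixes a b c :: real
  assumes "(if i then - 1 else 1) * c * a = (if j then - 1 else 1) * c * b" "c \<noteq> 0"
  shows "i \<noteq> j \<Longrightarrow> a = - b" and "i = j \<Longrightarrow> a = b"
proof -
  assume "i \<noteq> j"
  then have "c * a = c * (- b)" using assms(1) by (cases i; cases j; simp)
  then show "a = - b" using assms(2) by (simp only: mult_cancel_left) simp
next
  assume "i = j"
  then show "a = b" using assms by (cases i; cases j; simp)
qed

text \<open>The position along the axis and the line of \<open>perp\<close> determine a vector of
  the cone up to a factor. Points of different halves can agree only at height 0, which keeps the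
  interiors of the two drawings apart.\<close>

lemma half_N2_eq:
  assumes v: "v \<in> flat_cone" and w: "w \<in> flat_cone" and eq: "half_N2 i v = half_N2 j w"
  shows "parallel v w" and "i \<noteq> j \<Longrightarrow> \<bar>Re (fst v)\<bar> = norm (perp v)"
proof -
  let ?x = "\<lambda>i v. (if i then - 1 else 1) * (sqrt 2 / 2) * (1 + Re (fst v) / norm (perp v))"
  let ?d = "\<lambda>v. perp v / of_real (norm (perp v))"
  obtain c where c: "c = 1 \<or> c = - 1" "half_N2 i v = crosscap_class 2 (sphere_point (?x i (c *\<^sub>R v)) (?d (c *\<^sub>R v)))"
      "Re (fst (c *\<^sub>R v)) \<le> 0"
    unfolding half_N2_def by (rule even_ext_cases)
  obtain c' where c': "c' = 1 \<or> c' = - 1" "half_N2 j w = crosscap_class 2 (sphere_point (?x j (c' *\<^sub>R w)) (?d (c' *\<^sub>R w)))"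
      "Re (fst (c' *\<^sub>R w)) \<le> 0"
    unfolding half_N2_def by (rule even_ext_cases)
  let ?v = "c *\<^sub>R v" and ?w = "c' *\<^sub>R w"
  have vw: "?v \<in> flat_cone" "?w \<in> flat_cone" using c(1) c'(1) v w flat_cone_minus[OF v] flat_cone_minus[OF w] by auto
  have nz: "norm (perp ?v) > 0" "norm (perp ?w) > 0" using flat_cone_perp vw by auto
  have s: "?x i ?v = ?x j ?w \<and> (?d ?v = ?d ?w \<or> ?d ?v = - ?d ?w \<and> \<bar>?x i ?v\<bar> = sqrt 2 / 2)"
  proof (rule same_class_2)
    show "\<bar>?x i ?v\<bar> \<le> sqrt 2 / 2" "\<bar>?x j ?w\<bar> \<le> sqrt 2 / 2"
      using height_bound(3)[OF vw(1) c(3)] height_bound(3)[OF vw(2) c'(3)] .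
    show "norm (?d ?v) = 1" "norm (?d ?w) = 1" using nz by (simp_all add: norm_divide)
    show "crosscap_class 2 (sphere_point (?x i ?v) (?d ?v)) = crosscap_class 2 (sphere_point (?x j ?w) (?d ?w))"
      using c(2) c'(2) eq by simp
  qed
  have hb: "0 \<le> 1 + Re (fst ?v) / norm (perp ?v)" "0 \<le> 1 + Re (fst ?w) / norm (perp ?w)"
    using height_bound(1)[OF vw(1) c(3)] height_bound(1)[OF vw(2) c'(3)] .
  have s2: "sqrt 2 / 2 \<noteq> (0::real)" by simp
  note se = signed_eq[OF conjunct1[OF s] s2]
  have x0: "1 + Re (fst ?v) / norm (perp ?v) = 0" "1 + Re (fst ?w) / norm (perp ?w) = 0" if "i \<noteq> j"
    using se(1)[OF that] hb by linarith+
  have "\<bar>Re (fst ?v)\<bar> = norm (perp ?v)" if "i \<noteq> j"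
  proof -
    have "Re (fst ?v) / norm (perp ?v) = - 1" using x0(1)[OF that] by linarith
    then have "Re (fst ?v) = - norm (perp ?v)" using nz(1) by (simp only: divide_eq_eq split: if_splits)
    then show ?thesis by simp
  qed
  then show "\<bar>Re (fst v)\<bar> = norm (perp v)" if "i \<noteq> j"
    using that c(1) by (auto simp: perp_minus)
  have r: "Re (fst ?v) / norm (perp ?v) = Re (fst ?w) / norm (perp ?w)"
    using se(2) x0 by (cases "i = j") linarith+
  obtain k where k: "perp ?v = of_real k * perp ?w" "Re (fst ?v) = k * Re (fst ?w)"
  proof (cases "?d ?v = ?d ?w")
    case True
    let ?k = "norm (perp ?v) / norm (perp ?w)"
    show ?thesis
    proof (rule that[of ?k])
      show "perp ?v = of_real ?k * perp ?w" using True nz by (simp add: field_simps)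
      show "Re (fst ?v) = ?k * Re (fst ?w)" using r nz by (simp add: field_simps)
    qed
  next
    case False
    then have m: "?d ?v = - ?d ?w" "\<bar>?x i ?v\<bar> = sqrt 2 / 2" using s by auto
    have "1 + Re (fst ?v) / norm (perp ?v) = 1"
    proof -
      have "\<bar>?x i ?v\<bar> = (sqrt 2 / 2) * (1 + Re (fst ?v) / norm (perp ?v))"
        using hb(1) by (simp only: abs_mult abs_of_nonneg) simp
      then have "(sqrt 2 / 2) * (1 + Re (fst ?v) / norm (perp ?v)) = (sqrt 2 / 2) * 1" using m(2) by linarith
      then show ?thesis using s2 by (simp only: mult_cancel_left) simp
    qed
    then have "Re (fst ?v) = 0" "Re (fst ?w) = 0" using r nz by auto
    note z = this
    have "perp ?v = of_real (- (norm (perp ?v) / norm (perp ?w))) * perp ?w" using m(1) nz by (simp add: field_simps)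
    then show ?thesis by (rule that) (simp only: z mult_zero_right)
  qed
  then have "?v = k *\<^sub>R ?w" by (simp add: point_eq_iff perp_scaleR)
  then have "c *\<^sub>R ?v = (c * k * c') *\<^sub>R w" by (metis scaleR_scaleR mult.assoc)
  moreover have "c *\<^sub>R ?v = v" using c(1) by auto
  ultimately show "parallel v w" unfolding parallel_def by metis
qed

text \<open>The quadratic form of the cone is 0 at the first point and positive at the other four.
  So the vertex that the two graphs share lies on the boundary of the Moebius band and the rest of
  the drawing inside.\<close>

definition K5_points :: "ivec list" where
  "K5_points = [(1, 1, 0), (0, 2, 1), (0, -2, -2), (1, 1, -2), (1, -1, 1)]"

definition K5_edges :: "(nat \<times> nat \<times> int) list" where
  "K5_edges = [(0, 1, 1), (0, 2, -1), (0, 3, 1), (0, 4, -1), (1, 2, -1), (1, 3, -1), (1, 4, -1), (2, 3, 1), (2, 4, -1), (3, 4, -1)]"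

lemma K5_drawing: "integer_drawing K5_points K5_edges"
  by (rule drawing_check; code_simp)

definition cone_form :: "ivec \<Rightarrow> ivec \<Rightarrow> int" where
  "cone_form = (\<lambda>(a, b, c) (d, e, f). b * e + c * f - a * d)"

definition open_cone :: "(complex \<times> real) set" where
  "open_cone = {v. \<bar>Re (fst v)\<bar> < norm (perp v)}"

lemma open_cone_flat: "open_cone \<subseteq> flat_cone"
  by (auto simp: open_cone_def flat_cone_def perp_def zero_prod_def Complex_eq_0)

lemma open_cone_iff: "v \<in> open_cone \<longleftrightarrow> (norm (perp v))\<^sup>2 - (Re (fst v))\<^sup>2 > 0"
proof -
  have "\<bar>Re (fst v)\<bar> < norm (perp v) \<longleftrightarrow> \<bar>Re (fst v)\<bar>\<^sup>2 < (norm (perp v))\<^sup>2"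
    by (metis abs_ge_zero norm_ge_zero pos2 power_mono_iff not_less)
  then show ?thesis by (simp add: open_cone_def)
qed

text \<open>Expand the quadratic form: all three terms are nonnegative, and the one with
  \<open>q\<close> is positive. The end \<open>p\<close> may lie on the boundary of the
  cone.\<close>

lemma combination_in_open_cone:
  assumes "0 \<le> cone_form p p" "0 < cone_form q q" "0 \<le> k * cone_form p q" "k = 1 \<or> k = - 1" "a \<ge> 0" "b > 0"
  shows "a *\<^sub>R real_vec p + (b * of_int k) *\<^sub>R real_vec q \<in> open_cone"
proof -
  obtain p1 p2 p3 q1 q2 q3 where [simp]: "p = (p1, p2, p3)" "q = (q1, q2, q3)" by (metis prod_cases3)
  let ?v = "a *\<^sub>R real_vec p + (b * of_int k) *\<^sub>R real_vec q"
  have k2: "of_int k * of_int k = (1::real)" using assms(4) by auto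
  have n: "(norm (perp ?v))\<^sup>2 = (a * p2 + b * of_int k * q2)\<^sup>2 + (a * p3 + b * of_int k * q3)\<^sup>2"
    "Re (fst ?v) = a * p1 + b * of_int k * q1"
    by (simp_all add: perp_def real_vec_def cmod_power2)
  have "(norm (perp ?v))\<^sup>2 - (Re (fst ?v))\<^sup>2 = a\<^sup>2 * of_int (cone_form p p)
      + 2 * a * b * of_int (k * cone_form p q) + b\<^sup>2 * (of_int k * of_int k) * of_int (cone_form q q)"
    unfolding n by (simp add: cone_form_def power2_eq_square algebra_simps)
  also have "\<dots> > 0"
  proof -
    have "a\<^sup>2 * x + 2 * a * b * y + b\<^sup>2 * 1 * z > 0" if "x \<ge> 0" "y \<ge> 0" "z > 0" for x y z :: real
      using that assms(5,6) by (intro add_nonneg_pos add_nonneg_nonneg) auto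
    moreover have "0 \<le> real_of_int (cone_form p p)" "0 \<le> real_of_int (k * cone_form p q)"
      "0 < real_of_int (cone_form q q)"
      using assms(1-3) by (simp_all only: of_int_0_le_iff of_int_0_less_iff)
    ultimately show ?thesis unfolding k2 by blast
  qed
  finally show ?thesis unfolding open_cone_iff .
qed

theorem K5K5_in_N2: "graph_embeds_in {..<9} (edges_of K5K5) (nonorientable_surface 2)"
proof -
  interpret integer_drawing K5_points K5_edges by (rule K5_drawing)
  \<comment> \<open>The vertices 5 to 8 reuse the points 1 to 4: both copies have the same drawing,
    and \<open>sd\<close> puts them into different halves.\<close>
  define idx where "idx v = (if v < 5 then v else v - 4)" for v :: nat
  have len: "length K5_points = 5" by (simp add: K5_points_def)
  have idx: "idx v < length K5_points" if "v < 9" for v using that len by (auto simp: idx_def)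
  have pos: "0 < cone_form (K5_points ! i) (K5_points ! i)" if "0 < i" "i < 5" for i
  proof -
    have "i \<in> {1, 2, 3, 4}" using that by auto
    then show ?thesis by (auto simp: K5_points_def cone_form_def)
  qed
  have nonneg: "0 \<le> cone_form (K5_points ! i) (K5_points ! i)" if "i < 5" for i
    using pos[of i] that by (cases "i = 0") (auto simp: K5_points_def cone_form_def)
  have form: "0 \<le> k * cone_form (K5_points ! i) (K5_points ! j)" if "(i, j, k) \<in> set K5_edges" for i j k
  proof -
    have "list_all (\<lambda>(i, j, k). 0 \<le> k * cone_form (K5_points ! i) (K5_points ! j)) K5_edges" by code_simp
    then show ?thesis using that by (auto simp: list_all_iff)
  qed
  have all: "\<exists>k. (i, j, k) \<in> set K5_edges" if "i < j" "j < 5" for i j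
  proof -
    have "list_all (\<lambda>j. list_all (\<lambda>i. list_ex (\<lambda>(a, b, k). a = i \<and> b = j) K5_edges) [0..<j]) [0..<5]" by code_simp
    then have "list_ex (\<lambda>(a, b, k). a = i \<and> b = j) K5_edges" using that by (simp add: list_all_iff)
    then show ?thesis by (auto simp: list_ex_iff)
  qed
  have edge: "(idx u, idx v, edge_sign (idx u) (idx v)) \<in> set K5_edges" if "u < v" "K5K5 u v" for u v
    by (rule joined_edge, unfold joined_def, rule all) (use that in \<open>auto simp: idx_def K5K5_def\<close>)
  have sign: "edge_sign u v = 1 \<or> edge_sign u v = - 1" for u v by (simp add: edge_sign_def)
  have p0: "K5_points ! 0 = (1, 1, 0)" by (simp add: K5_points_def)
  show ?thesis
  proof (rule straight_drawing[where \<rho> = half_N2 and p = "\<lambda>v. real_vec (K5_points ! idx v)"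
        and \<sigma> = "\<lambda>u v. of_int (edge_sign (idx u) (idx v))"
        and sd = "\<lambda>v. v < 5" and C = flat_cone and C' = open_cone])
    show "continuous_map (top_of_set flat_cone) (nonorientable_surface 2) (half_N2 i)" for i
      by (rule continuous_map_half_N2)
    show "- v \<in> flat_cone \<and> half_N2 i (- v) = half_N2 i v" if "v \<in> flat_cone" for i v
      using flat_cone_minus half_N2_minus that by blast
    show "parallel v w" if "v \<in> flat_cone" "w \<in> flat_cone" "half_N2 i v = half_N2 i w" for i v w
      using half_N2_eq(1)[OF that] .
    show "disjnt (half_N2 (u < 5) ` open_cone) (half_N2 (v < 5) ` flat_cone)" if "(u < 5) \<noteq> (v < 5)" for u v :: nat
      unfolding disjnt_iff
    proof (intro allI notI)
      fix x assume "x \<in> half_N2 (u < 5) ` open_cone \<and> x \<in> half_N2 (v < 5) ` flat_cone"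
      then obtain y z where yz: "y \<in> open_cone" "z \<in> flat_cone" "half_N2 (u < 5) y = half_N2 (v < 5) z" by force
      then have "\<bar>Re (fst y)\<bar> = norm (perp y)" using half_N2_eq(2)[OF _ yz(2,3) that] open_cone_flat by blast
      then show False using yz(1) by (simp add: open_cone_def)
    qed
    show "open_cone \<subseteq> flat_cone" by (rule open_cone_flat)
    show "real_vec (K5_points ! idx v) \<in> open_cone" if "v \<in> {..<9}" "v \<noteq> 0" for v
    proof -
      have "0 < idx v" "idx v < 5" using that by (auto simp: idx_def)
      then show ?thesis
        using combination_in_open_cone[of "K5_points ! idx v" "K5_points ! idx v" 1 0 1] pos[of "idx v"] by simp
    qed
    \<comment> \<open>The shared vertex has height 0, where the two maps into the halves
      agree.\<close>
    show "real_vec (K5_points ! idx 0) \<in> flat_cone \<and>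
        half_N2 (v < 5) (real_vec (K5_points ! idx 0)) = half_N2 (0 < (5::nat)) (real_vec (K5_points ! idx 0))" for v :: nat
      by (simp add: p0 idx_def flat_cone_def real_vec_def perp_def half_N2_def even_ext_def zero_prod_def cmod_def complex_eq_iff)
    show "real_of_int (edge_sign (idx u) (idx v)) = 1 \<or> real_of_int (edge_sign (idx u) (idx v)) = - 1" for u v
      using sign[of "idx u" "idx v"] by auto
    show "u \<in> {..<9} \<and> v \<in> {..<9} \<and> (u = 0 \<or> (u < 5) = (v < 5))" if "u < v" "K5K5 u v" for u v
      using that by (auto simp: K5K5_def)
    show "a *\<^sub>R real_vec (K5_points ! idx u) + (b * real_of_int (edge_sign (idx u) (idx v))) *\<^sub>R real_vec (K5_points ! idx v) \<in> open_cone"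
      if "u < v" "K5K5 u v" "a > 0" "b > 0" for u v a b
    proof -
      note e = edges[OF edge[OF that(1,2)]]
      show ?thesis
        by (rule combination_in_open_cone)
          (use that e len pos[of "idx v"] nonneg[of "idx u"] form[OF edge[OF that(1,2)]] sign in auto)
    qed
    show "\<not> parallel (real_vec (K5_points ! idx u)) (real_vec (K5_points ! idx v))"
      if "u \<in> {..<9}" "v \<in> {..<9}" "u \<noteq> v" "u = 0 \<or> v = 0 \<or> (u < 5) = (v < 5)" for u v
      by (rule not_parallel) (use that idx in \<open>auto simp: idx_def split: if_splits\<close>)
    show "\<not> parallel (a *\<^sub>R real_vec (K5_points ! idx u) + (b * real_of_int (edge_sign (idx u) (idx v))) *\<^sub>R real_vec (K5_points ! idx v))
        (real_vec (K5_points ! idx w))"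
      if "u < v" "K5K5 u v" "w \<in> {..<9}" "a > 0" "b > 0" for u v w a b
      by (rule edge_not_parallel[OF edge[OF that(1,2)] _ that(4,5)]) (use that idx in auto)
    show "a *\<^sub>R real_vec (K5_points ! idx u) + (b * real_of_int (edge_sign (idx u) (idx v))) *\<^sub>R real_vec (K5_points ! idx v) \<noteq>
        a' *\<^sub>R real_vec (K5_points ! idx u') + (b' * real_of_int (edge_sign (idx u') (idx v'))) *\<^sub>R real_vec (K5_points ! idx v')"
      if h: "u < v" "K5K5 u v" "u' < v'" "K5K5 u' v'" "(u, v) \<noteq> (u', v')" "(v < 5) = (v' < 5)"
        "a > 0" "b > 0" "a' > 0 \<and> b' > 0 \<or> a' < 0 \<and> b' < 0" for u v u' v' a b a' b'
    proof (rule edges_uncrossed[OF edge[OF h(1,2)] edge[OF h(3,4)] _ h(7-9)])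
      show "(idx u, idx v) \<noteq> (idx u', idx v')"
        using h(1-6) by (auto simp: idx_def K5K5_def split: if_splits)
    qed
  qed
qed

section \<open>Idempotents of finite commutative rings\<close>

locale finite_cring = cring R for R (structure) +
  assumes finite_carrier: "finite (carrier R)"
begin

definition idem :: "'a \<Rightarrow> bool" where
  "idem e \<longleftrightarrow> e \<in> carrier R \<and> e \<otimes> e = e"

text \<open>For an idempotent \<open>e\<close> this is the ideal generated by \<open>e\<close>,
  which is a ring with unity \<open>e\<close>. Factors of \<open>R\<close> are kept as subsets, so
  the graph need not be carried over to a product ring.\<close>

definition corner :: "'a \<Rightarrow> 'a set" where
  "corner e = {x \<in> carrier R. e \<otimes> x = x}"

lemma idem_closed [simp]: "idem e \<Longrightarrow> e \<in> carrier R"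
  by (simp add: idem_def)

lemma corner_closed: "x \<in> corner e \<Longrightarrow> x \<in> carrier R"
  by (simp add: corner_def)

lemma finite_corner [simp]: "finite (corner e)"
  using finite_carrier by (rule finite_subset[rotated]) (auto simp: corner_def)

lemma mult_in_corner [simp]:
  assumes "idem e" "x \<in> carrier R" shows "e \<otimes> x \<in> corner e"
proof -
  have "e \<otimes> (e \<otimes> x) = (e \<otimes> e) \<otimes> x" using assms by (simp add: m_assoc)
  then show ?thesis using assms by (simp add: corner_def idem_def)
qed

lemma idem_in_corner [simp]: "idem e \<Longrightarrow> e \<in> corner e"
  by (simp add: corner_def idem_def)

lemma zero_in_corner [simp]: "e \<in> carrier R \<Longrightarrow> \<zero> \<in> corner e"
  by (simp add: corner_def)

lemma add_in_corner [simp]: "e \<in> carrier R \<Longrightarrow> x \<in> corner e \<Longrightarrow> y \<in> corner e \<Longrightarrow> x \<oplus> y \<in> corner e"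
  by (simp add: corner_def r_distr)

lemma minus_in_corner [simp]: "e \<in> carrier R \<Longrightarrow> x \<in> corner e \<Longrightarrow> \<ominus> x \<in> corner e"
  by (simp add: corner_def r_minus)

lemma corner_mult [simp]:
  assumes "e \<in> carrier R" "x \<in> corner e" "y \<in> carrier R" shows "x \<otimes> y \<in> corner e"
proof -
  have "e \<otimes> (x \<otimes> y) = (e \<otimes> x) \<otimes> y" using assms corner_closed[OF assms(2)] by (simp add: m_assoc)
  then show ?thesis using assms by (simp add: corner_def)
qed

lemma corner_subgroup:
  assumes "e \<in> carrier R" shows "subgroup (corner e) (add_monoid R)"
proof (rule add.subgroupI)
  show "corner e \<noteq> {}" using zero_in_corner[OF assms] by blast
qed (use assms in \<open>auto simp: corner_closed\<close>)

lemma subgroup_card_dvd: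
  assumes A: "subgroup A (add_monoid R)" and H: "subgroup H (add_monoid R)" "H \<subseteq> A"
  shows "card H dvd card A"
proof -
  interpret A: group "add_monoid R\<lparr>carrier := A\<rparr>"
    by (rule subgroup.subgroup_is_group[OF A a_group])
  have "subgroup H (add_monoid R\<lparr>carrier := A\<rparr>)"
    by (rule add.subgroup_incl[OF H(1) A H(2)])
  from A.lagrange[OF this] show ?thesis
    by (metis dvd_triv_right partial_object.select_convs(1) order_def partial_object.update_convs(1) partial_object.surjective)
qed

lemma multiples_subgroup: "a \<in> carrier R \<Longrightarrow> subgroup ((\<lambda>x. a \<otimes> x) ` carrier R) (add_monoid R)"
proof (rule add.subgroupI)
  assume a: "a \<in> carrier R"
  show "(\<lambda>x. a \<otimes> x) ` carrier R \<subseteq> carrier R" using a by auto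
  show "(\<lambda>x. a \<otimes> x) ` carrier R \<noteq> {}" by auto
  fix y assume "y \<in> (\<lambda>x. a \<otimes> x) ` carrier R"
  then obtain x where x: "x \<in> carrier R" "y = a \<otimes> x" by blast
  show "\<ominus> y \<in> (\<lambda>x. a \<otimes> x) ` carrier R"
    using a x r_minus[of a x] by (metis a_inv_closed imageI)
  fix y' assume "y' \<in> (\<lambda>x. a \<otimes> x) ` carrier R"
  then obtain x' where x': "x' \<in> carrier R" "y' = a \<otimes> x'" by blast
  show "y \<oplus> y' \<in> (\<lambda>x. a \<otimes> x) ` carrier R"
    using a x x' r_distr[of x x' a] by (metis a_closed imageI)
qed

section \<open>Non-units and the edges of the graph\<close>

definition nonunit :: "'a \<Rightarrow> bool" where
  "nonunit z \<longleftrightarrow> z \<in> carrier R \<and> z \<notin> Units R"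

lemma nonunitI: "z \<in> carrier R \<Longrightarrow> w \<in> carrier R \<Longrightarrow> w \<noteq> \<zero> \<Longrightarrow> z \<otimes> w = \<zero> \<Longrightarrow> nonunit z"
  unfolding nonunit_def
  by (metis Units_closed Units_inv_closed Units_l_inv l_one m_assoc r_null)

lemma unitI: "z \<in> carrier R \<Longrightarrow> w \<in> carrier R \<Longrightarrow> z \<otimes> w = \<one> \<Longrightarrow> z \<in> Units R"
  unfolding Units_def using m_comm[of z w] by auto

lemma nonunit_mult:
  assumes "nonunit z" "x \<in> carrier R" shows "nonunit (z \<otimes> x)"
proof -
  have z: "z \<in> carrier R" "z \<notin> Units R" using assms(1) by (auto simp: nonunit_def)
  have "z \<otimes> x \<notin> Units R"
  proof
    assume u: "z \<otimes> x \<in> Units R"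
    then have "z \<otimes> (x \<otimes> inv (z \<otimes> x)) = \<one>"
      using z(1) assms(2) by (simp flip: m_assoc)
    moreover have "x \<otimes> inv (z \<otimes> x) \<in> carrier R" using assms(2) u by simp
    ultimately show False using unitI[OF z(1)] z(2) by blast
  qed
  then show ?thesis using z(1) assms(2) by (simp add: nonunit_def)
qed

lemma uir_vertices_iff: "x \<in> uir_vertices R \<longleftrightarrow> nonunit x"
  by (simp add: uir_vertices_def nonunit_def)

definition multiple_of :: "'a \<Rightarrow> 'a \<Rightarrow> bool" where
  "multiple_of z x \<longleftrightarrow> (\<exists>a\<in>carrier R. x = z \<otimes> a)"

lemma Idl_subset_iff:
  assumes "x \<in> carrier R" "z \<in> carrier R"
  shows "Idl {x} \<subseteq> Idl {z} \<longleftrightarrow> multiple_of z x"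
proof
  assume "Idl {x} \<subseteq> Idl {z}"
  then have "x \<in> PIdl z" using genideal_self'[OF assms(1)] cgenideal_eq_genideal[OF assms(2)] by auto
  then show "multiple_of z x" unfolding cgenideal_def multiple_of_def using m_comm assms(2) by auto
next
  assume "multiple_of z x"
  then have "x \<in> PIdl z" unfolding cgenideal_def multiple_of_def using m_comm assms(2) by auto
  then show "Idl {x} \<subseteq> Idl {z}"
    using genideal_minimal[OF cgenideal_ideal[OF assms(2)]] cgenideal_eq_genideal[OF assms(2)] by auto
qed

lemma uir_edges_iff:
  "E \<in> uir_edges R \<longleftrightarrow> (\<exists>x y z. E = {x, y} \<and> x \<noteq> y \<and> nonunit x \<and> nonunit y \<and> nonunit z \<and> multiple_of z x \<and> multiple_of z y)"
proof -
  have "(\<exists>z\<in>carrier R - Units R. Idl {x} \<subseteq> Idl {z} \<and> Idl {y} \<subseteq> Idl {z}) \<longleftrightarrow>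
      (\<exists>z. nonunit z \<and> multiple_of z x \<and> multiple_of z y)" if "nonunit x" "nonunit y" for x y
    using that Idl_subset_iff[of x] Idl_subset_iff[of y] unfolding nonunit_def by (metis DiffD1 DiffD2 DiffI)
  note iff = this
  show ?thesis
  proof
    assume "E \<in> uir_edges R"
    then obtain x y where "E = {x, y}" "nonunit x" "nonunit y" "x \<noteq> y"
      "\<exists>z\<in>carrier R - Units R. Idl {x} \<subseteq> Idl {z} \<and> Idl {y} \<subseteq> Idl {z}"
      unfolding uir_edges_def uir_vertices_iff mem_Collect_eq by (elim exE conjE)
    then show "\<exists>x y z. E = {x, y} \<and> x \<noteq> y \<and> nonunit x \<and> nonunit y \<and> nonunit z \<and> multiple_of z x \<and> multiple_of z y"
      unfolding iff[OF \<open>nonunit x\<close> \<open>nonunit y\<close>] by (elim exE conjE) (intro exI conjI)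
  next
    assume "\<exists>x y z. E = {x, y} \<and> x \<noteq> y \<and> nonunit x \<and> nonunit y \<and> nonunit z \<and> multiple_of z x \<and> multiple_of z y"
    then obtain x y z where *: "E = {x, y}" "x \<noteq> y" "nonunit x" "nonunit y"
      and z: "nonunit z" "multiple_of z x" "multiple_of z y" by (elim exE conjE)
    have "\<exists>z. nonunit z \<and> multiple_of z x \<and> multiple_of z y" using z by (intro exI conjI)
    then show "E \<in> uir_edges R"
      unfolding uir_edges_def uir_vertices_iff mem_Collect_eq iff[OF *(3,4), symmetric] using *
      by (intro exI conjI)
  qed
qed

lemma edgeI:
  assumes "x \<noteq> y" "nonunit z" "multiple_of z x" "multiple_of z y"
  shows "{x, y} \<in> uir_edges R"
proof -
  have "nonunit x" "nonunit y" using assms nonunit_mult unfolding multiple_of_def by auto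
  then show ?thesis unfolding uir_edges_iff using assms by blast
qed

lemma corner_multiple: "x \<in> corner e \<Longrightarrow> multiple_of e x"
  unfolding corner_def multiple_of_def by (metis (mono_tags, lifting) mem_Collect_eq)

section \<open>Idempotents, idempotent powers and local corners\<close>

lemma complement:
  assumes "idem e" shows "idem (\<one> \<ominus> e)" "e \<otimes> (\<one> \<ominus> e) = \<zero>" "(\<one> \<ominus> e) \<otimes> e = \<zero>" "e \<oplus> (\<one> \<ominus> e) = \<one>"
proof -
  have e: "e \<in> carrier R" "e \<otimes> e = e" using assms by (auto simp: idem_def)
  show 1: "e \<otimes> (\<one> \<ominus> e) = \<zero>" using e by algebra
  then show "(\<one> \<ominus> e) \<otimes> e = \<zero>" using e m_comm[of e "\<one> \<ominus> e"] by simp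
  show "e \<oplus> (\<one> \<ominus> e) = \<one>" using e by algebra
  have "(\<one> \<ominus> e) \<otimes> (\<one> \<ominus> e) = \<one> \<ominus> e"
    using e by algebra
  then show "idem (\<one> \<ominus> e)" using e by (simp add: idem_def)
qed

text \<open>The powers of \<open>x\<close> are eventually periodic. An exponent that is a multiple
  of the period and lies in the periodic range can be doubled without a change.\<close>

lemma power_idem:
  assumes x: "x \<in> carrier R"
  obtains k :: nat where "k > 0" "idem (x [^] k)"
proof -
  have "finite (range (\<lambda>n::nat. x [^] n))"
    using finite_carrier by (rule finite_subset[rotated]) (use x in auto)
  then have "\<not> inj (\<lambda>n::nat. x [^] n)" using finite_imageD infinite_UNIV_nat by blast
  then obtain i j :: nat where ij: "i < j" "x [^] i = x [^] j"
    unfolding inj_def by (metis linorder_neqE_nat)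
  define d where "d = j - i"
  have d: "d > 0" "j = i + d" using ij(1) by (auto simp: d_def)
  have step: "x [^] (n + d) = x [^] n" if n: "n \<ge> i" for n
  proof -
    obtain l where l: "n = i + l" using le_Suc_ex[OF n] by (elim exE)
    have "x [^] (n + d) = x [^] (j + l)" by (simp add: l d(2) ac_simps)
    also have "\<dots> = x [^] j \<otimes> x [^] l" using x by (simp add: nat_pow_mult)
    also have "\<dots> = x [^] (i + l)" unfolding ij(2)[symmetric] using x by (simp add: nat_pow_mult)
    also have "\<dots> = x [^] n" by (simp add: l)
    finally show ?thesis .
  qed
  have steps: "x [^] (n + t * d) = x [^] n" if "n \<ge> i" for n t
  proof (induction t)
    case (Suc t)
    then show ?case using step[of "n + t * d"] that by (simp add: add_ac)
  qed simp
  define k where "k = (i + 1) * d"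
  have "i + 1 \<le> k" using d(1) mult_le_mono2[of 1 d "i + 1"] by (simp add: k_def)
  then have k: "k \<ge> i" "k > 0" by auto
  have "x [^] k \<otimes> x [^] k = x [^] (k + (i + 1) * d)" using x by (simp add: nat_pow_mult k_def)
  also have "\<dots> = x [^] k" by (rule steps[OF k(1)])
  finally have "idem (x [^] k)" using x by (simp add: idem_def)
  then show thesis using k(2) that by blast
qed

lemma one_minus_power:
  assumes x: "x \<in> carrier R"
  obtains s where "s \<in> carrier R" "(\<one> \<ominus> x) \<otimes> s = \<one> \<ominus> x [^] (k::nat)"
proof -
  have "\<exists>s\<in>carrier R. (\<one> \<ominus> x) \<otimes> s = \<one> \<ominus> x [^] k"
  proof (induction k)
    case 0
    show ?case using x by (intro bexI[of _ \<zero>]) (auto simp: a_minus_def r_neg)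
  next
    case (Suc k)
    then obtain s where s: "s \<in> carrier R" "(\<one> \<ominus> x) \<otimes> s = \<one> \<ominus> x [^] k" by blast
    define y where "y = x [^] k"
    have y: "y \<in> carrier R" using x by (simp add: y_def)
    have "(\<one> \<ominus> x) \<otimes> (s \<oplus> y) = (\<one> \<ominus> x) \<otimes> s \<oplus> (y \<ominus> y \<otimes> x)" using x s(1) y by algebra
    also have "\<dots> = (\<one> \<ominus> y) \<oplus> (y \<ominus> y \<otimes> x)" using s(2) by (simp add: y_def)
    also have "\<dots> = \<one> \<ominus> y \<otimes> x" using x y by algebra
    finally show ?case using s(1) y by (auto simp: y_def)
  qed
  then show thesis using that by blast
qed

definition primitive :: "'a \<Rightarrow> bool" where
  "primitive e \<longleftrightarrow> idem e \<and> e \<noteq> \<zero> \<and> (\<forall>g. idem g \<longrightarrow> g \<in> corner e \<longrightarrow> g = \<zero> \<or> g = e)"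

definition inv_in :: "'a \<Rightarrow> 'a \<Rightarrow> bool" where
  "inv_in e x \<longleftrightarrow> (\<exists>y\<in>carrier R. x \<otimes> y = e)"

text \<open>Some power of \<open>x\<close> is an idempotent of the corner and hence \<open>e\<close>
  or 0. In the first case \<open>x\<close> divides \<open>e\<close>; in the second a finite
  geometric series inverts \<open>e \<ominus> x\<close>.\<close>

lemma primitive_local:
  assumes e: "primitive e" and x: "x \<in> corner e"
  shows "inv_in e x \<or> inv_in e (e \<ominus> x)"
proof -
  have ec: "e \<in> carrier R" "idem e" using e by (auto simp: primitive_def)
  have xc: "x \<in> carrier R" "e \<otimes> x = x" using x by (auto simp: corner_def)
  obtain k :: nat where k: "k > 0" "idem (x [^] k)" using power_idem[OF xc(1)] .
  then obtain l where l: "k = Suc l" using gr0_implies_Suc by blast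
  have xk: "x [^] k = x \<otimes> x [^] l" using xc(1) m_comm by (simp add: l)
  then have "x [^] k \<in> corner e" using corner_mult[OF ec(1) x, of "x [^] l"] xc(1) by simp
  then consider "x [^] k = \<zero>" | "x [^] k = e" using e k(2) unfolding primitive_def by blast
  then show ?thesis
  proof cases
    case 1
    obtain s where s: "s \<in> carrier R" "(\<one> \<ominus> x) \<otimes> s = \<one> \<ominus> x [^] k" using one_minus_power[OF xc(1)] .
    have "(e \<ominus> x) \<otimes> s = e \<otimes> ((\<one> \<ominus> x) \<otimes> s)"
    proof -
      have "e \<otimes> ((\<one> \<ominus> x) \<otimes> s) = (e \<ominus> e \<otimes> x) \<otimes> s" using ec(1) xc(1) s(1) by algebra
      then show ?thesis using xc(2) by simp
    qed
    also have "\<dots> = e" using s(2) 1 ec(1) by (simp add: a_minus_def)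
    finally show ?thesis using s(1) by (auto simp: inv_in_def)
  next
    case 2
    then show ?thesis using xk xc(1) by (auto simp: inv_in_def)
  qed
qed

lemma inv_in_one: "x \<in> carrier R \<Longrightarrow> inv_in \<one> x \<longleftrightarrow> x \<in> Units R"
  unfolding inv_in_def using unitI by (auto intro: bexI[of _ "inv x"])

text \<open>If \<open>x \<oplus> y\<close> is a unit, scaling gives two elements with sum 1, one of
  which must be a unit. So the non-units form an ideal, and it contains every proper ideal.\<close>

lemma local_ringI:
  assumes "\<one> \<noteq> \<zero>" "\<And>x. x \<in> carrier R \<Longrightarrow> x \<in> Units R \<or> \<one> \<ominus> x \<in> Units R"
  shows "local_ring R"
proof -
  define M where "M = {x. nonunit x}"
  have Mc: "M \<subseteq> carrier R" by (auto simp: M_def nonunit_def)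
  have "\<zero> \<in> M" using nonunitI[of \<zero> \<one>] assms(1) by (simp add: M_def)
  have ideal: "ideal M R"
  proof (rule idealI)
    show "ring R" by (rule ring_axioms)
    show "subgroup M (add_monoid R)"
    proof (rule add.subgroupI)
      show "M \<subseteq> carrier R" by (rule Mc)
      show "M \<noteq> {}" using \<open>\<zero> \<in> M\<close> by auto
      fix x assume x: "x \<in> M"
      then have "nonunit (x \<otimes> \<ominus> \<one>)" by (intro nonunit_mult) (auto simp: M_def)
      then show "\<ominus> x \<in> M" using x Mc by (auto simp: M_def r_minus)
      fix y assume y: "y \<in> M"
      have xy: "x \<in> carrier R" "y \<in> carrier R" using x y Mc by auto
      show "x \<oplus> y \<in> M"
      proof (rule ccontr)
        assume "x \<oplus> y \<notin> M"
        then have u: "x \<oplus> y \<in> Units R" using xy by (auto simp: M_def nonunit_def)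
        define w where "w = inv (x \<oplus> y)"
        have w: "w \<in> carrier R" "(x \<oplus> y) \<otimes> w = \<one>" using u by (auto simp: w_def)
        have "x \<otimes> w \<notin> Units R" "y \<otimes> w \<notin> Units R"
          using nonunit_mult[of x w] nonunit_mult[of y w] x y w(1) by (auto simp: M_def nonunit_def)
        moreover have "\<one> \<ominus> x \<otimes> w = y \<otimes> w"
        proof -
          have "(x \<oplus> y) \<otimes> w \<ominus> x \<otimes> w = y \<otimes> w" using xy w(1) by algebra
          then show ?thesis unfolding w(2) .
        qed
        ultimately show False using assms(2)[of "x \<otimes> w"] xy w(1) by auto
      qed
    qed
    show "x \<otimes> a \<in> M" "a \<otimes> x \<in> M" if "a \<in> M" "x \<in> carrier R" for a x
      using nonunit_mult[of a x] that Mc m_comm[of a x] by (auto simp: M_def)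
  qed
  have proper: "J \<subseteq> M" if J: "ideal J R" "J \<noteq> carrier R" for J
  proof
    fix x assume x: "x \<in> J"
    interpret J: ideal J R by (rule J(1))
    have xc: "x \<in> carrier R" using x by (rule J.Icarr)
    show "x \<in> M"
    proof (rule ccontr)
      assume "x \<notin> M"
      then have u: "x \<in> Units R" using xc by (auto simp: M_def nonunit_def)
      then have "x \<otimes> inv x \<in> J" using x by (intro J.I_r_closed) auto
      then have "\<one> \<in> J" using u by simp
      then show False using J.one_imp_carrier J(2) by blast
    qed
  qed
  have M1: "M \<noteq> carrier R" using Units_one_closed by (auto simp: M_def nonunit_def)
  have "maximalideal M R"
  proof (rule maximalidealI[OF ideal])
    show "carrier R \<noteq> M" using M1 by simp
    show "J = M \<or> J = carrier R" if "ideal J R" "M \<subseteq> J" "J \<subseteq> carrier R" for J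
      using proper[OF that(1)] that(2) by blast
  qed
  moreover have "J = M" if "maximalideal J R" for J
  proof -
    interpret J: maximalideal J R by (rule that)
    have "J \<subseteq> M" using proper[OF J.is_ideal] J.I_notcarr by simp
    then show ?thesis using J.I_maximal[OF ideal _ Mc] M1 by blast
  qed
  ultimately show ?thesis unfolding local_ring_def using ring_axioms by blast
qed

lemma corner_one: "corner \<one> = carrier R"
  by (auto simp: corner_def)

lemma non_local_idem:
  assumes "\<one> \<noteq> \<zero>" "\<not> local_ring R"
  obtains e where "idem e" "e \<noteq> \<zero>" "e \<noteq> \<one>"
proof -
  have "\<not> primitive \<one>"
  proof
    assume "primitive \<one>"
    then have "x \<in> Units R \<or> \<one> \<ominus> x \<in> Units R" if "x \<in> carrier R" for x
      using primitive_local[of \<one> x] that inv_in_one by (auto simp: corner_one)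
    then show False using local_ringI assms by blast
  qed
  then show thesis using that assms(1) by (auto simp: primitive_def idem_def)
qed

end

lemma card_even_involution:
  assumes "finite A" "\<And>x. x \<in> A \<Longrightarrow> f x \<in> A" "\<And>x. x \<in> A \<Longrightarrow> f (f x) = x" "\<And>x. x \<in> A \<Longrightarrow> f x \<noteq> x"
  shows "even (card A)"
  using assms
proof (induction A rule: finite_psubset_induct)
  case (psubset A)
  show ?case
  proof (cases "A = {}")
    case False
    then obtain a where a: "a \<in> A" by blast
    let ?B = "A - {a, f a}"
    have "even (card ?B)"
    proof (rule psubset.IH)
      show "?B \<subset> A" using a by blast
      fix x assume x: "x \<in> ?B"
      have "f x \<noteq> a" using x psubset.prems(2)[of x] by auto
      moreover have "f x \<noteq> f a" using x a psubset.prems(2)[of x] psubset.prems(2)[of a] by auto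
      ultimately show "f x \<in> ?B" using x psubset.prems(1)[of x] by auto
      show "f (f x) = x" "f x \<noteq> x" using x psubset.prems by auto
    qed
    moreover have "card ?B = card A - card {a, f a}"
      using a psubset.prems(1)[OF a] by (intro card_Diff_subset) auto
    moreover have "card {a, f a} = 2" using psubset.prems(3)[OF a] by simp
    moreover have "card {a, f a} \<le> card A"
      using a psubset.prems(1)[OF a] psubset.hyps by (intro card_mono) auto
    ultimately show ?thesis by simp
  qed simp
qed

section \<open>Corners of prime order, cardinalities, and the order six\<close>

context finite_cring
begin

definition fieldlike :: "'a \<Rightarrow> bool" where
  "fieldlike e \<longleftrightarrow> (\<forall>a\<in>corner e. a \<noteq> \<zero> \<longrightarrow> inv_in e a)"

text \<open>The multiples of a nonzero \<open>a\<close> form a nonzero subgroup of a group of prime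
  order and therefore contain \<open>e\<close>.\<close>

lemma prime_fieldlike:
  assumes e: "idem e" and p: "prime (card (corner e))"
  shows "fieldlike e"
  unfolding fieldlike_def
proof (intro ballI impI)
  fix a assume a: "a \<in> corner e" "a \<noteq> \<zero>"
  have ac: "a \<in> carrier R" using a(1) by (rule corner_closed)
  define S where "S = (\<lambda>x. a \<otimes> x) ` carrier R"
  have S: "S \<subseteq> corner e" using corner_mult[OF _ a(1)] e by (auto simp: S_def)
  have "card S dvd card (corner e)"
    unfolding S_def
    by (rule subgroup_card_dvd[OF corner_subgroup multiples_subgroup]) (use e ac S S_def in auto)
  moreover have "card S \<noteq> 1"
  proof
    assume "card S = 1"
    then obtain u where u: "S = {u}" by (rule card_1_singletonE)
    have "a \<otimes> \<one> \<in> S" "a \<otimes> \<zero> \<in> S" unfolding S_def by blast+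
    then show False using u a(2) ac by simp
  qed
  ultimately have "card S = card (corner e)" using p by (auto simp: prime_nat_iff)
  then have "S = corner e" using S by (intro card_subset_eq) auto
  then have "e \<in> S" using e by simp
  then show "inv_in e a" unfolding S_def inv_in_def by auto
qed

lemma corner_inter:
  assumes "e \<in> carrier R" "f \<in> carrier R" "e \<otimes> f = \<zero>" "x \<in> corner e" "x \<in> corner f"
  shows "x = \<zero>"
proof -
  have x: "x \<in> carrier R" "e \<otimes> x = x" "f \<otimes> x = x" using assms by (auto simp: corner_def)
  have "(e \<otimes> f) \<otimes> x = e \<otimes> (f \<otimes> x)" using assms(1,2) x(1) by (simp add: m_assoc)
  then show ?thesis using x assms(3) by simp
qed

lemma card_fibre:
  assumes e: "idem e" and S: "S \<subseteq> corner e"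
  shows "card {x \<in> carrier R. e \<otimes> x \<in> S} = card S * card (corner (\<one> \<ominus> e))"
proof -
  define f where "f = \<one> \<ominus> e"
  have ef: "idem f" "e \<otimes> f = \<zero>" "f \<otimes> e = \<zero>" "e \<oplus> f = \<one>"
    using complement[OF e] by (auto simp: f_def)
  have c: "e \<in> carrier R" "f \<in> carrier R" using e ef(1) by auto
  have 1: "e \<otimes> (s \<oplus> t) = s" "f \<otimes> (s \<oplus> t) = t" if s: "s \<in> corner e" and t: "t \<in> corner f" for s t
  proof -
    have sc: "s \<in> carrier R" "t \<in> carrier R" using s t by (auto simp: corner_closed)
    have st: "e \<otimes> s = s" "f \<otimes> t = t" using s t by (auto simp: corner_def)
    have "e \<otimes> t = (e \<otimes> f) \<otimes> t" using c sc st by (simp add: m_assoc)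
    then have et: "e \<otimes> t = \<zero>" using ef sc by simp
    have "f \<otimes> s = (f \<otimes> e) \<otimes> s" using c sc st by (simp add: m_assoc)
    then have fs: "f \<otimes> s = \<zero>" using ef sc by simp
    show "e \<otimes> (s \<oplus> t) = s" "f \<otimes> (s \<oplus> t) = t" using c sc st et fs by (simp_all add: r_distr)
  qed
  have 2: "e \<otimes> x \<oplus> f \<otimes> x = x" if "x \<in> carrier R" for x
    using that c ef(4) by (simp flip: l_distr)
  have "bij_betw (\<lambda>x. (e \<otimes> x, f \<otimes> x)) {x \<in> carrier R. e \<otimes> x \<in> S} (S \<times> corner f)"
  proof (rule bij_betw_byWitness[where f' = "\<lambda>(s, t). s \<oplus> t"])
    show "\<forall>x\<in>{x \<in> carrier R. e \<otimes> x \<in> S}. (case (e \<otimes> x, f \<otimes> x) of (s, t) \<Rightarrow> s \<oplus> t) = x"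
      using 2 by simp
    show "\<forall>p\<in>S \<times> corner f. (e \<otimes> (case p of (s, t) \<Rightarrow> s \<oplus> t), f \<otimes> (case p of (s, t) \<Rightarrow> s \<oplus> t)) = p"
      using 1 S by force
    show "(\<lambda>x. (e \<otimes> x, f \<otimes> x)) ` {x \<in> carrier R. e \<otimes> x \<in> S} \<subseteq> S \<times> corner f"
      using ef(1) by auto
    show "(\<lambda>(s, t). s \<oplus> t) ` (S \<times> corner f) \<subseteq> {x \<in> carrier R. e \<otimes> x \<in> S}"
    proof
      fix y assume "y \<in> (\<lambda>(s, t). s \<oplus> t) ` (S \<times> corner f)"
      then obtain s t where st: "s \<in> S" "t \<in> corner f" "y = s \<oplus> t" by auto
      have "s \<in> corner e" using st(1) S by auto
      then show "y \<in> {x \<in> carrier R. e \<otimes> x \<in> S}"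
        using 1(1)[OF _ st(2)] st by (simp add: corner_closed)
    qed
  qed
  from bij_betw_same_card[OF this] show ?thesis by (simp add: card_cartesian_product f_def)
qed

lemma card_corners:
  assumes "idem e" shows "card (carrier R) = card (corner e) * card (corner (\<one> \<ominus> e))"
proof -
  have "{x \<in> carrier R. e \<otimes> x \<in> corner e} = carrier R" using assms by auto
  then show ?thesis using card_fibre[OF assms subset_refl] by simp
qed

lemma corner_pow_card:
  assumes e: "idem e" shows "add_pow R (card (corner e)) e = \<zero>"
proof -
  have ec: "e \<in> carrier R" using e by simp
  let ?G = "add_monoid R\<lparr>carrier := corner e\<rparr>"
  interpret A: group ?G
    by (rule subgroup.subgroup_is_group[OF corner_subgroup[OF ec] a_group])
  have "e [^]\<^bsub>?G\<^esub> order ?G = \<one>\<^bsub>?G\<^esub>"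
    by (rule A.pow_order_eq_1) (use e in simp)
  moreover have "e [^]\<^bsub>?G\<^esub> n = add_pow R n e" for n :: nat
    using ec by (induction n) auto
  ultimately show ?thesis by (simp add: order_def)
qed

lemma corner_six:
  assumes e: "idem e" and c6: "card (corner e) = 6"
  shows "e \<oplus> e \<oplus> (e \<oplus> e) \<oplus> (e \<oplus> e) = \<zero>"
proof -
  have ec: "e \<in> carrier R" using e by simp
  have "card (corner e) = Suc (Suc (Suc (Suc (Suc (Suc 0)))))" using c6 by simp
  then have "add_pow R (Suc (Suc (Suc (Suc (Suc (Suc 0)))))) e = \<zero>" using corner_pow_card[OF e] by metis
  then show ?thesis using ec by (simp add: a_assoc)
qed

text \<open>The order of the corner annihilates \<open>e\<close>, and 9 is 3 modulo 6, so three
  times \<open>e\<close> is idempotent and equals \<open>e\<close> or 0. In the first case twice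
  \<open>e\<close> is 0, and two elements generate a subgroup of order 4 in a group of order 6. In
  the second case negation has no fixed point except 0, so the five nonzero elements would fall into
  pairs.\<close>

lemma primitive_card_not_6:
  assumes p: "primitive e" shows "card (corner e) \<noteq> 6"
proof
  assume c6: "card (corner e) = 6"
  have e: "idem e" "e \<in> carrier R" "e \<otimes> e = e" "e \<noteq> \<zero>" using p by (auto simp: primitive_def idem_def)
  define t where "t = e \<oplus> e"
  have t: "t \<in> carrier R" "t \<in> corner e" using e by (auto simp: t_def)
  have six: "t \<oplus> t \<oplus> t = \<zero>" using corner_six[OF e(1) c6] by (simp add: t_def)
  have te: "t \<otimes> e = t" "e \<otimes> t = t" using e by (simp_all add: t_def l_distr r_distr)
  have tt: "t \<otimes> t = t \<oplus> t" using e te by (simp add: t_def l_distr)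
  define d where "d = t \<oplus> e"
  have dc: "d \<in> corner e" using e t by (simp add: d_def)
  have "d \<otimes> d = (t \<oplus> t \<oplus> t) \<oplus> (t \<oplus> e)" 
    using e t te tt by (simp add: d_def l_distr r_distr a_ac)
  then have "d \<otimes> d = d" using six e t by (simp add: d_def)
  then have "idem d" using dc by (simp add: idem_def corner_closed)
  then consider "d = \<zero>" | "d = e" using p dc unfolding primitive_def by blast
  then show False
  proof cases
    case 2
    then have t0: "t = \<zero>" using e t by (simp add: d_def)
    have dbl: "x \<oplus> x = \<zero>" if "x \<in> corner e" for x
    proof -
      have x: "x \<in> carrier R" "e \<otimes> x = x" using that by (auto simp: corner_def)
      have "t \<otimes> x = x \<oplus> x" using e x by (simp add: t_def l_distr)
      then show ?thesis using t0 x by simp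
    qed
    have "\<not> corner e \<subseteq> {\<zero>, e}"
    proof
      assume "corner e \<subseteq> {\<zero>, e}"
      then have "card (corner e) \<le> card {\<zero>, e}" by (intro card_mono) auto
      also have "\<dots> \<le> 2" by (simp add: card_insert_if)
      finally show False using c6 by simp
    qed
    then obtain x where x: "x \<in> corner e" "x \<noteq> \<zero>" "x \<noteq> e" by blast
    have xc: "x \<in> carrier R" using x by (simp add: corner_closed)
    have ee: "e \<oplus> e = \<zero>" "x \<oplus> x = \<zero>" using dbl e x by auto
    define H where "H = {\<zero>, e, x, e \<oplus> x}"
    have ex: "e \<oplus> x \<noteq> \<zero>"
    proof
      assume "e \<oplus> x = \<zero>"
      then have "x \<oplus> e = e \<oplus> e" using ee e xc a_comm[of e x] by simp
      then show False using x xc e add.right_cancel[of e x e] by simp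
    qed
    have c4: "card H = 4" using x e xc ex by (auto simp: H_def)
    have neg: "\<ominus> y = y" if "y \<in> corner e" for y
      using dbl[OF that] that minus_equality[of y y] by (simp add: corner_closed)
    have Hc: "H \<subseteq> corner e" using x e by (auto simp: H_def)
    have "subgroup H (add_monoid R)"
    proof (rule add.subgroupI)
      show "H \<subseteq> carrier R" using Hc corner_closed by blast
      show "H \<noteq> {}" by (simp add: H_def)
      fix y assume y: "y \<in> H"
      then show "\<ominus> y \<in> H" using neg Hc by auto
      fix z assume z: "z \<in> H"
      have a: "e \<oplus> (e \<oplus> x) = x" "x \<oplus> (e \<oplus> x) = e" "x \<oplus> e = e \<oplus> x" "e \<oplus> x \<oplus> x = e" "e \<oplus> x \<oplus> e = x"
        "e \<oplus> x \<oplus> (e \<oplus> x) = \<zero>"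
      proof -
        have "e \<oplus> (e \<oplus> x) = (e \<oplus> e) \<oplus> x" using e xc by (simp add: a_assoc)
        then show 1: "e \<oplus> (e \<oplus> x) = x" using ee xc by simp
        show 2: "x \<oplus> e = e \<oplus> x" using e xc by (simp add: a_comm)
        have "e \<oplus> x \<oplus> x = e \<oplus> (x \<oplus> x)" using e xc by (simp add: a_assoc)
        then show 3: "e \<oplus> x \<oplus> x = e" using ee e by simp
        show "x \<oplus> (e \<oplus> x) = e" using 3 e xc a_comm[of x "e \<oplus> x"] by simp
        show "e \<oplus> x \<oplus> e = x" using 1 e xc a_comm[of "e \<oplus> x" e] by simp
        show "e \<oplus> x \<oplus> (e \<oplus> x) = \<zero>" using dbl[of "e \<oplus> x"] e x by simp
      qed
      have "y = \<zero> \<or> y = e \<or> y = x \<or> y = e \<oplus> x" "z = \<zero> \<or> z = e \<or> z = x \<or> z = e \<oplus> x"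
        using y z by (auto simp: H_def)
      then show "y \<oplus> z \<in> H"
        by (elim disjE) (use a ee e xc in \<open>simp_all add: H_def\<close>)
    qed
    then have "card H dvd card (corner e)" using subgroup_card_dvd[OF corner_subgroup] e Hc by blast
    then show False using c4 c6 by simp
  next
    case 1
    then have e3: "t \<oplus> e = \<zero>" by (simp add: d_def)
    have trip: "x \<oplus> x \<oplus> x = \<zero>" if "x \<in> corner e" for x
    proof -
      have x: "x \<in> carrier R" "e \<otimes> x = x" using that by (auto simp: corner_def)
      have "(t \<oplus> e) \<otimes> x = x \<oplus> x \<oplus> x" using e x by (simp add: t_def l_distr)
      then show ?thesis using e3 x by simp
    qed
    have neg: "\<ominus> y \<noteq> y" if "y \<in> corner e - {\<zero>}" for y
    proof
      assume "\<ominus> y = y"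
      moreover have yc: "y \<in> carrier R" using that corner_closed by blast
      ultimately have "y \<oplus> y = \<zero>" using r_neg[of y] by simp
      then show False using trip[of y] that yc by simp
    qed
    have "even (card (corner e - {\<zero>}))"
    proof (rule card_even_involution)
      show "finite (corner e - {\<zero>})" by simp
      show "\<ominus> y \<in> corner e - {\<zero>}" "\<ominus> (\<ominus> y) = y" if "y \<in> corner e - {\<zero>}" for y
        using that e corner_closed[of y] by (auto simp: add.inv_eq_1_iff)
    qed (rule neg)
    then show False using c6 e by simp
  qed
qed

end

section \<open>Graphs covered by two cliques\<close>

lemma doubleton_edges_of_iff: "{u, v} \<in> edges_of P \<longleftrightarrow> u < v \<and> P u v \<or> v < u \<and> P v (u :: nat)"
  unfolding edges_of_def by (auto simp: doubleton_eq_iff)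

lemma edges_of_subgraph:
  assumes "graph_embeds_in V E X" "inj_on f {..<N}" "f ` {..<N} \<subseteq> V"
    and "\<And>u v. u < v \<Longrightarrow> P u v \<Longrightarrow> v < N \<and> {f u, f v} \<in> E"
  shows "graph_embeds_in {..<N} (edges_of P) X"
proof (rule graph_embeds_in_subgraph[OF assms(1-3)])
  fix e assume "e \<in> edges_of P"
  then obtain u v where uv: "e = {u, v}" "u < v" "P u v" unfolding edges_of_def by (elim CollectE exE conjE)
  then show "e \<subseteq> {..<N} \<and> f ` e \<in> E" using assms(4)[OF uv(2,3)] by auto
qed

lemma clique_not_in_N2:
  assumes "7 \<le> card C" "C \<subseteq> V" "\<And>x y. x \<in> C \<Longrightarrow> y \<in> C \<Longrightarrow> x \<noteq> y \<Longrightarrow> {x, y} \<in> E"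
  shows "\<not> graph_embeds_in V E (nonorientable_surface 2)"
proof
  assume *: "graph_embeds_in V E (nonorientable_surface 2)"
  have "finite C" using assms(1) by (intro card_ge_0_finite) simp
  then obtain f where f: "f ` {..<7::nat} \<subseteq> C" "inj_on f {..<7::nat}"
    using card_le_inj[of "{..<7::nat}" C] assms(1) by auto
  have "graph_embeds_in {..<7} (edges_of K7) (nonorientable_surface 2)"
  proof (rule edges_of_subgraph[OF * f(2)])
    show "f ` {..<7} \<subseteq> V" using f(1) assms(2) by simp
    fix u v :: nat assume uv: "u < v" "K7 u v"
    then have "u \<in> {..<7}" "v \<in> {..<7}" "u \<noteq> v" by (auto simp: K7_def)
    then have "f u \<noteq> f v" "f u \<in> C" "f v \<in> C" using f by (auto dest: inj_onD)
    then show "v < 7 \<and> {f u, f v} \<in> E" using assms(3) \<open>v \<in> {..<7}\<close> by simp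
  qed
  then show False using K7_not_in_N2 by simp
qed

definition edges_within :: "'a set \<Rightarrow> 'a set \<Rightarrow> 'a set set \<Rightarrow> bool" where
  "edges_within P Q E \<longleftrightarrow> (\<forall>e\<in>E. \<exists>x y. e = {x, y} \<and> x \<noteq> y \<and> ({x, y} \<subseteq> P \<or> {x, y} \<subseteq> Q))"

lemma glue_injections:
  assumes "finite P" "finite Q" "finite I" "finite J" "finite K"
    and c: "card (P \<inter> Q) \<le> card I" "card (P - Q) \<le> card J" "card (Q - P) \<le> card K"
    and d: "I \<inter> J = {}" "I \<inter> K = {}" "J \<inter> K = {}"
  obtains f where "inj_on f (P \<union> Q)" "f ` (P \<inter> Q) \<subseteq> I" "f ` (P - Q) \<subseteq> J" "f ` (Q - P) \<subseteq> K"
proof -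
  obtain a where a: "a ` (P \<inter> Q) \<subseteq> I" "inj_on a (P \<inter> Q)" using card_le_inj[OF _ _ c(1)] assms by auto
  obtain b where b: "b ` (P - Q) \<subseteq> J" "inj_on b (P - Q)" using card_le_inj[OF _ _ c(2)] assms by auto
  obtain k where k: "k ` (Q - P) \<subseteq> K" "inj_on k (Q - P)" using card_le_inj[OF _ _ c(3)] assms by auto
  define f where "f x = (if x \<in> P then if x \<in> Q then a x else b x else k x)" for x
  have f: "f ` (P \<inter> Q) \<subseteq> I" "f ` (P - Q) \<subseteq> J" "f ` (Q - P) \<subseteq> K"
    using a(1) b(1) k(1) by (auto simp: f_def)
  have inj: "inj_on f (P \<inter> Q)" "inj_on f (P - Q)" "inj_on f (Q - P)"
    using a(2) b(2) k(2) by (auto simp: f_def inj_on_def)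
  have "inj_on f ((P \<inter> Q) \<union> (P - Q))"
    unfolding inj_on_Un using inj f(1,2) d(1) by blast
  then have "inj_on f (((P \<inter> Q) \<union> (P - Q)) \<union> (Q - P))"
    unfolding inj_on_Un[of _ "(P \<inter> Q) \<union> (P - Q)"] using inj(3) f d(2,3) by blast
  moreover have "((P \<inter> Q) \<union> (P - Q)) \<union> (Q - P) = P \<union> Q" by blast
  ultimately show thesis using f that by simp
qed

lemma two_cliques_in_N1:
  assumes fin: "finite P" "finite Q" and E: "edges_within P Q E"
    and c: "card P \<le> 6 \<and> card Q \<le> 4 \<and> card (P \<inter> Q) = 2 \<or> card P \<le> 5 \<and> card Q \<le> 4 \<and> card (P \<inter> Q) = 1"
  shows "graph_embeds_in (P \<union> Q) E (nonorientable_surface 1)"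
proof -
  have d: "card (P - Q) = card P - card (P \<inter> Q)" "card (Q - P) = card Q - card (P \<inter> Q)"
    using fin by (auto simp: card_Diff_subset_Int Int_commute)
  \<comment> \<open>The cliques go to \<open>{0..5}\<close> and \<open>{0, 1, 6, 7}\<close>. If they
    share only one element, the vertex 1 is left to the second clique.\<close>
  define I J K where "I = (if card (P \<inter> Q) = 2 then {0, 1} else {0::nat})" and "J = {2, 3, 4, 5::nat}"
    and "K = (if card (P \<inter> Q) = 2 then {6, 7} else {1, 6, 7::nat})"
  obtain f where f: "inj_on f (P \<union> Q)" "f ` (P \<inter> Q) \<subseteq> I" "f ` (P - Q) \<subseteq> J" "f ` (Q - P) \<subseteq> K"
  proof (rule glue_injections[of P Q I J K])
    show "finite P" "finite Q" by fact+
    show "finite I" "finite J" "finite K" by (auto simp: I_def J_def K_def)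
    show "card (P \<inter> Q) \<le> card I" "card (P - Q) \<le> card J" "card (Q - P) \<le> card K"
      using c d by (auto simp: I_def J_def K_def)
    show "I \<inter> J = {}" "I \<inter> K = {}" "J \<inter> K = {}" by (auto simp: I_def J_def K_def)
  qed
  have fP: "f x \<in> {0..5}" if x: "x \<in> P" for x
  proof -
    have "f x \<in> I \<union> J" using f(2,3) x by blast
    then show ?thesis by (auto simp: I_def J_def split: if_splits)
  qed
  have fQ: "f x \<in> {0, 1, 6, 7}" if x: "x \<in> Q" for x
  proof -
    have "f x \<in> I \<union> K" using f(2,4) x by blast
    then show ?thesis by (auto simp: I_def K_def split: if_splits)
  qed
  show ?thesis
  proof (rule graph_embeds_in_subgraph[OF G8_in_N1 f(1)])
    show "f ` (P \<union> Q) \<subseteq> {..<8}" using fP fQ by force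
    fix e assume "e \<in> E"
    then obtain x y where e: "e = {x, y}" "x \<noteq> y" "{x, y} \<subseteq> P \<or> {x, y} \<subseteq> Q"
      using E unfolding edges_within_def by blast
    then have ne: "f x \<noteq> f y" using inj_onD[OF f(1), of x y] by auto
    have "{f x, f y} \<in> edges_of G8"
      using e(3)
    proof
      assume "{x, y} \<subseteq> P"
      then have "f x \<in> {0..5}" "f y \<in> {0..5}" using fP by auto
      then show ?thesis using ne by (auto simp: doubleton_edges_of_iff G8_def)
    next
      assume "{x, y} \<subseteq> Q"
      then have "f x \<in> {0, 1, 6, 7}" "f y \<in> {0, 1, 6, 7}" using fQ by auto
      then show ?thesis using ne by (auto simp: doubleton_edges_of_iff G8_def)
    qed
    then show "e \<subseteq> P \<union> Q \<and> f ` e \<in> edges_of G8" using e by auto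
  qed
qed

lemma two_K5:
  assumes c: "card P = 5" "card Q = 5" "card (P \<inter> Q) = 1" and E: "edges_within P Q E"
    and clique: "\<And>x y. x \<noteq> y \<Longrightarrow> {x, y} \<subseteq> P \<or> {x, y} \<subseteq> Q \<Longrightarrow> {x, y} \<in> E"
  shows "graph_embeds_in (P \<union> Q) E (nonorientable_surface 2)"
    and "\<not> graph_embeds_in (P \<union> Q) E (nonorientable_surface 1)"
    and "\<not> graph_embeds_in (P \<union> Q) E (nonorientable_surface 0)"
proof -
  have fin: "finite P" "finite Q" using c by (auto intro: card_ge_0_finite)
  have d: "card (P - Q) = 4" "card (Q - P) = 4"
    using fin c by (auto simp: card_Diff_subset_Int Int_commute)
  obtain f :: "'a \<Rightarrow> nat" where f: "inj_on f (P \<union> Q)" "f ` (P \<inter> Q) \<subseteq> {0}" "f ` (P - Q) \<subseteq> {1..4}" "f ` (Q - P) \<subseteq> {5..8}"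
    by (rule glue_injections[of P Q "{0::nat}" "{1..4}" "{5..8}"]) (use fin c d in auto)
  have f9: "f ` (P \<union> Q) \<subseteq> {..<9}" using f(2-4) by fastforce
  have "card (P \<union> Q) = 9" using card_Un_Int[OF fin] c by simp
  then have "card (f ` (P \<union> Q)) = card {..<9::nat}" using card_image[OF f(1)] by simp
  then have onto: "f ` (P \<union> Q) = {..<9}" using f9 by (intro card_subset_eq) auto
  have fP: "f x < 5" if x: "x \<in> P" for x
  proof -
    have "f x \<in> {0} \<union> {1..4}" using f(2,3) x by blast
    then show ?thesis by auto
  qed
  have fQ: "f x < 9 \<and> (f x = 0 \<or> 5 \<le> f x)" if x: "x \<in> Q" for x
  proof -
    have "f x \<in> {0} \<union> {5..8}" using f(2,4) x by blast
    then show ?thesis by auto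
  qed
  show "graph_embeds_in (P \<union> Q) E (nonorientable_surface 2)"
  proof (rule graph_embeds_in_subgraph[OF K5K5_in_N2 f(1) f9])
    fix e assume "e \<in> E"
    then obtain x y where e: "e = {x, y}" "x \<noteq> y" "{x, y} \<subseteq> P \<or> {x, y} \<subseteq> Q"
      using E unfolding edges_within_def by blast
    then have ne: "f x \<noteq> f y" using inj_onD[OF f(1), of x y] by auto
    have "{f x, f y} \<in> edges_of K5K5"
      using e(3)
    proof
      assume "{x, y} \<subseteq> P"
      then show ?thesis using ne fP[of x] fP[of y] by (auto simp: doubleton_edges_of_iff K5K5_def)
    next
      assume "{x, y} \<subseteq> Q"
      then show ?thesis using ne fQ[of x] fQ[of y] by (auto simp: doubleton_edges_of_iff K5K5_def)
    qed
    then show "e \<subseteq> P \<union> Q \<and> f ` e \<in> edges_of K5K5" using e by auto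
  qed
  \<comment> \<open>The cardinalities are exact, so \<open>f\<close> is onto, and its inverse finds
    the graph \<open>K5K5\<close> inside the given one.\<close>
  define g where "g = inv_into (P \<union> Q) f"
  have g: "inj_on g {..<9}" "g ` {..<9} \<subseteq> P \<union> Q"
    using inj_on_inv_into[of "{..<9}" f "P \<union> Q"] inv_into_into[of _ f "P \<union> Q"] onto by (auto simp: g_def)
  have gPQ: "g u \<in> P \<union> Q" if "u < 9" for u using g(2) that by blast
  have fg: "f (g u) = u" if "u < 9" for u using that f_inv_into_f[of u f "P \<union> Q"] onto by (simp add: g_def)
  have gP: "g u \<in> P" if u: "u < 5" for u
  proof (rule ccontr)
    assume "g u \<notin> P"
    then have "g u \<in> Q - P" using gPQ[of u] u by auto
    then have "f (g u) \<in> {5..8}" using f(4) by blast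
    then show False using fg[of u] u by simp
  qed
  have gQ: "g u \<in> Q" if u: "u = 0 \<or> 5 \<le> u" "u < 9" for u
  proof (rule ccontr)
    assume "g u \<notin> Q"
    then have "g u \<in> P - Q" using gPQ[of u] u by auto
    then have "f (g u) \<in> {1..4}" using f(3) by blast
    then show False using fg[of u] u by simp
  qed
  have sub: "graph_embeds_in {..<9} (edges_of K5K5) X" if X: "graph_embeds_in (P \<union> Q) E X" for X
  proof (rule edges_of_subgraph[OF X g])
    fix u v :: nat assume uv: "u < v" "K5K5 u v"
    then have v: "v < 9" by (auto simp: K5K5_def)
    then have "g u \<noteq> g v" using uv(1) inj_onD[OF g(1), of u v] by auto
    moreover have "{g u, g v} \<subseteq> P \<or> {g u, g v} \<subseteq> Q"
      using uv v gP[of u] gP[of v] gQ[of u] gQ[of v] by (auto simp: K5K5_def)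
    ultimately show "v < 9 \<and> {g u, g v} \<in> E" using v clique by simp
  qed
  show "\<not> graph_embeds_in (P \<union> Q) E (nonorientable_surface 1)"
    using sub K5K5_not_in_N1 by blast
  show "\<not> graph_embeds_in (P \<union> Q) E (nonorientable_surface 0)"
    using sub K5K5_not_in_N0 by blast
qed

lemma crosscap_eq_2_iff:
  "crosscap V E = 2 \<longleftrightarrow> graph_embeds_in V E (nonorientable_surface 2) \<and>
     \<not> graph_embeds_in V E (nonorientable_surface 1) \<and> \<not> graph_embeds_in V E (nonorientable_surface 0)"
proof -
  let ?P = "\<lambda>k. graph_embeds_in V E (nonorientable_surface k)"
  define S where "S = {enat k | k. ?P k}"
  have S: "enat k \<in> S \<longleftrightarrow> ?P k" for k by (auto simp: S_def)
  have two: "(2 :: enat) = enat 2" by (simp add: numeral_eq_enat)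
  have "Inf S = enat 2 \<longleftrightarrow> enat 2 \<in> S \<and> enat 1 \<notin> S \<and> enat 0 \<notin> S"
  proof
    assume i: "Inf S = enat 2"
    then have "S \<noteq> {}" by (auto simp: Inf_enat_def split: if_splits)
    then obtain s where "s \<in> S" by blast
    then have "(LEAST x. x \<in> S) \<in> S" by (rule LeastI)
    then have "Inf S \<in> S" using \<open>S \<noteq> {}\<close> by (simp add: Inf_enat_def)
    moreover have "enat k \<notin> S" if k: "k < 2" for k
    proof
      assume "enat k \<in> S"
      then have "Inf S \<le> enat k" by (rule Inf_lower)
      then show False using i k by simp
    qed
    ultimately show "enat 2 \<in> S \<and> enat 1 \<notin> S \<and> enat 0 \<notin> S" using i by auto
  next
    assume *: "enat 2 \<in> S \<and> enat 1 \<notin> S \<and> enat 0 \<notin> S"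
    show "Inf S = enat 2"
    proof (rule antisym)
      show "Inf S \<le> enat 2" using * by (intro Inf_lower) simp
      show "enat 2 \<le> Inf S"
      proof (rule Inf_greatest)
        fix s assume s: "s \<in> S"
        then obtain k where k: "s = enat k" by (auto simp: S_def)
        then have "k \<noteq> 0" "k \<noteq> 1" using * s unfolding k by metis+
        then show "enat 2 \<le> s" by (simp add: k)
      qed
    qed
  qed
  then show ?thesis unfolding crosscap_def two S_def[symmetric] S by simp
qed

section \<open>The upper ideal relation graph of a non-local ring\<close>

context finite_cring
begin

lemma nonunit_multiple: "nonunit z \<Longrightarrow> multiple_of z x \<Longrightarrow> nonunit x"
  unfolding multiple_of_def using nonunit_mult by auto

lemma multiples_not_in_N2:
  assumes "nonunit z" "7 \<le> card C" "\<And>x. x \<in> C \<Longrightarrow> multiple_of z x"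
  shows "\<not> graph_embeds_in (uir_vertices R) (uir_edges R) (nonorientable_surface 2)"
proof (rule clique_not_in_N2[OF assms(2)])
  show "C \<subseteq> uir_vertices R" using nonunit_multiple[OF assms(1)] assms(3) by (auto simp: uir_vertices_iff)
  show "{x, y} \<in> uir_edges R" if "x \<in> C" "y \<in> C" "x \<noteq> y" for x y
    using edgeI[OF that(3) assms(1)] assms(3) that by simp
qed

text \<open>With a third element \<open>k\<close> of the corner of \<open>h\<close>, the common
  triangle is 0, \<open>h\<close>, \<open>k\<close>. Adding \<open>e\<close> or \<open>g\<close> to
  it completes the two cliques, which lie in the ideals of \<open>e \<oplus> h\<close> and
  \<open>g \<oplus> h\<close>. The ideal of \<open>e \<oplus> g\<close> gives the further edge, from
  \<open>e\<close> to \<open>g\<close>. Each of the three generators is annihilated by the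
  idempotent that it omits.\<close>

lemma three_idempotents_not_in_N2:
  assumes idem: "idem e" "idem g" "idem h" and nz: "e \<noteq> \<zero>" "g \<noteq> \<zero>" "h \<noteq> \<zero>"
    and orth: "e \<otimes> g = \<zero>" "e \<otimes> h = \<zero>" "g \<otimes> h = \<zero>" and big: "3 \<le> card (corner h)"
  shows "\<not> graph_embeds_in (uir_vertices R) (uir_edges R) (nonorientable_surface 2)"
proof
  assume *: "graph_embeds_in (uir_vertices R) (uir_edges R) (nonorientable_surface 2)"
  have c: "e \<in> carrier R" "g \<in> carrier R" "h \<in> carrier R" using idem by auto
  have sq: "e \<otimes> e = e" "g \<otimes> g = g" "h \<otimes> h = h" using idem by (auto simp: idem_def)
  have orth': "g \<otimes> e = \<zero>" "h \<otimes> e = \<zero>" "h \<otimes> g = \<zero>" using orth c m_comm by metis+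
  have "\<not> corner h \<subseteq> {\<zero>, h}"
  proof
    assume "corner h \<subseteq> {\<zero>, h}"
    then have "card (corner h) \<le> card {\<zero>, h}" by (intro card_mono) auto
    also have "\<dots> \<le> 2" by (simp add: card_insert_if)
    finally show False using big by simp
  qed
  then obtain k where k: "k \<in> corner h" "k \<noteq> \<zero>" "k \<noteq> h" by blast
  have kc: "k \<in> carrier R" "h \<otimes> k = k" using k(1) by (auto simp: corner_def)
  have "e \<otimes> k = (e \<otimes> h) \<otimes> k" "g \<otimes> k = (g \<otimes> h) \<otimes> k" using c kc by (simp_all add: m_assoc)
  then have k0: "e \<otimes> k = \<zero>" "g \<otimes> k = \<zero>" unfolding orth using kc(1) by simp_all
  define f where "f = nth [\<zero>, h, k, e, e \<oplus> h, e \<oplus> k, g, g \<oplus> h, g \<oplus> k]"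
  \<comment> \<open>A left inverse of \<open>f\<close>: the components at \<open>e\<close> and
    \<open>g\<close> tell the blocks of three apart, and the component at \<open>h\<close> tells the
    position in a block.\<close>
  define idx where "idx y = (if e \<otimes> y = \<zero> then if g \<otimes> y = \<zero> then 0 else 6 else 3) +
      (if h \<otimes> y = \<zero> then 0 else if h \<otimes> y = h then 1 else 2 :: nat)" for y
  have nine: "u = 0 \<or> u = 1 \<or> u = 2 \<or> u = 3 \<or> u = 4 \<or> u = 5 \<or> u = 6 \<or> u = 7 \<or> u = 8" if "u < 9" for u :: nat
    using that by linarith
  note ring_simps = c sq orth orth' kc k0 k nz r_distr l_distr
  have idx: "idx (f u) = u" if "u < 9" for u
    using nine[OF that] by (elim disjE) (simp_all add: f_def idx_def ring_simps)
  have inj: "inj_on f {..<9}" by (rule inj_on_inverseI[of _ idx]) (simp add: idx)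
  have eh: "f u \<in> corner (e \<oplus> h)" if "u < 6" for u
  proof -
    have "u < 9" using that by simp
    then show ?thesis by (rule nine[THEN rev_mp]) (use that in \<open>auto simp: f_def corner_def ring_simps\<close>)
  qed
  have gh: "f u \<in> corner (g \<oplus> h)" if "u < 3 \<or> 6 \<le> u" "u < 9" for u
    using nine[OF that(2)] that by (elim disjE) (simp_all add: f_def corner_def ring_simps)
  have eg: "f 3 \<in> corner (e \<oplus> g)" "f 6 \<in> corner (e \<oplus> g)"
    by (simp_all add: f_def corner_def ring_simps)
  have nu: "nonunit (e \<oplus> h)" "nonunit (g \<oplus> h)" "nonunit (e \<oplus> g)"
    using nonunitI[of "e \<oplus> h" g] nonunitI[of "g \<oplus> h" e] nonunitI[of "e \<oplus> g" h] by (simp_all add: ring_simps)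
  have edge: "{f u, f v} \<in> uir_edges R" if "f u \<in> corner z" "f v \<in> corner z" "nonunit z" "u < v" "v < 9" for u v z
  proof (rule edgeI[OF _ that(3)])
    show "f u \<noteq> f v" using inj_onD[OF inj, of u v] that(4,5) by auto
  qed (use that corner_multiple in auto)
  have "graph_embeds_in {..<9} (edges_of K6K6) (nonorientable_surface 2)"
  proof (rule edges_of_subgraph[OF * inj])
    show "f ` {..<9} \<subseteq> uir_vertices R"
    proof (rule image_subsetI)
      fix u :: nat assume "u \<in> {..<9}"
      then have "u < 6 \<or> 6 \<le> u \<and> u < 9" by auto
      then show "f u \<in> uir_vertices R"
        using nonunit_multiple[OF nu(1) corner_multiple, OF eh] nonunit_multiple[OF nu(2) corner_multiple, OF gh]
        by (auto simp: uir_vertices_iff)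
    qed
    fix u v :: nat assume uv: "u < v" "K6K6 u v"
    then consider "v < 6" | "u < 3 \<or> 6 \<le> u" "6 \<le> v" "v < 9" | "u = 3" "v = 6" by (auto simp: K6K6_def)
    then show "v < 9 \<and> {f u, f v} \<in> uir_edges R"
    proof cases
      case 1
      then show ?thesis using edge[OF eh eh nu(1)] uv(1) by simp
    next
      case 2
      then show ?thesis using edge[OF gh gh nu(2)] uv(1) by simp
    next
      case 3
      then show ?thesis using edge[OF eg nu(3)] by simp
    qed
  qed
  then show False using K6K6_not_in_N2 by simp
qed

lemma three_small_corners_in_N1:
  assumes idem: "idem e" "idem g" "idem h"
    and one: "e \<oplus> g \<oplus> h = \<one>" and small: "corner e = {\<zero>, e}" "corner g = {\<zero>, g}" "corner h = {\<zero>, h}"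
  shows "graph_embeds_in (uir_vertices R) (uir_edges R) (nonorientable_surface 1)"
proof -
  have c: "e \<in> carrier R" "g \<in> carrier R" "h \<in> carrier R" using idem by auto
  have dec: "e \<otimes> x \<oplus> g \<otimes> x \<oplus> h \<otimes> x = x" if "x \<in> carrier R" for x
    using that c one by (simp flip: l_distr)
  have vals: "e \<otimes> x = (if e \<otimes> x = \<zero> then \<zero> else e)" "g \<otimes> x = (if g \<otimes> x = \<zero> then \<zero> else g)"
    "h \<otimes> x = (if h \<otimes> x = \<zero> then \<zero> else h)" if x: "x \<in> carrier R" for x
    using mult_in_corner[OF idem(1) x] mult_in_corner[OF idem(2) x] mult_in_corner[OF idem(3) x]
    unfolding small by auto
  have eq: "x = y" if "x \<in> carrier R" "y \<in> carrier R" "(e \<otimes> x = \<zero>) = (e \<otimes> y = \<zero>)" "(g \<otimes> x = \<zero>) = (g \<otimes> y = \<zero>)"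
    "(h \<otimes> x = \<zero>) = (h \<otimes> y = \<zero>)" for x y
  proof -
    have "e \<otimes> x = e \<otimes> y" "g \<otimes> x = g \<otimes> y" "h \<otimes> x = h \<otimes> y" using vals[OF that(1)] vals[OF that(2)] that(3-5) by metis+
    then have "e \<otimes> x \<oplus> g \<otimes> x \<oplus> h \<otimes> x = e \<otimes> y \<oplus> g \<otimes> y \<oplus> h \<otimes> y" by simp
    then show ?thesis unfolding dec[OF that(1)] dec[OF that(2)] .
  qed
  have miss: "e \<otimes> x = \<zero> \<or> g \<otimes> x = \<zero> \<or> h \<otimes> x = \<zero>" if x: "nonunit x" for x
  proof (rule ccontr)
    assume *: "\<not> ?thesis"
    have xc: "x \<in> carrier R" "x \<notin> Units R" using x by (auto simp: nonunit_def)
    have "e \<otimes> x = e" "g \<otimes> x = g" "h \<otimes> x = h" using vals[OF xc(1)] * by metis+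
    then have "x = \<one>" using dec[OF xc(1)] one by simp
    then show False using xc by simp
  qed
  \<comment> \<open>The non-units whose component at \<open>e\<close> or at \<open>g\<close> is 0
    get numbers up to 5. Those whose component at \<open>h\<close> is 0 get 0, 1, 2 or 6.\<close>
  define idx :: "'a \<Rightarrow> nat" where "idx x = (if e \<otimes> x \<noteq> \<zero> then if g \<otimes> x \<noteq> \<zero> then 6 else if h \<otimes> x \<noteq> \<zero> then 4 else 1
      else if g \<otimes> x \<noteq> \<zero> then if h \<otimes> x \<noteq> \<zero> then 5 else 2 else if h \<otimes> x \<noteq> \<zero> then 3 else 0)" for x
  have inj: "inj_on idx (uir_vertices R)"
  proof (rule inj_onI)
    fix x y assume "x \<in> uir_vertices R" "y \<in> uir_vertices R" and i: "idx x = idx y"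
    then have n: "nonunit x" "nonunit y" by (auto simp: uir_vertices_iff)
    show "x = y"
    proof (rule eq)
      show "x \<in> carrier R" "y \<in> carrier R" using n by (auto simp: nonunit_def)
      show "(e \<otimes> x = \<zero>) = (e \<otimes> y = \<zero>)" "(g \<otimes> x = \<zero>) = (g \<otimes> y = \<zero>)" "(h \<otimes> x = \<zero>) = (h \<otimes> y = \<zero>)"
        using i miss[OF n(1)] miss[OF n(2)] by (auto simp: idx_def split: if_splits)
    qed
  qed
  show ?thesis
  proof (rule graph_embeds_in_subgraph[OF G8_in_N1 inj])
    show "idx ` uir_vertices R \<subseteq> {..<8}" by (auto simp: idx_def)
    fix E assume "E \<in> uir_edges R"
    then obtain x y z where E: "E = {x, y}" and xy: "x \<noteq> y" "nonunit x" "nonunit y"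
      and z: "nonunit z" "multiple_of z x" "multiple_of z y" unfolding uir_edges_iff by (elim exE conjE)
    have zc: "z \<in> carrier R" using z(1) by (simp add: nonunit_def)
    have inh: "i \<otimes> x = \<zero> \<and> i \<otimes> y = \<zero>" if i: "i \<in> carrier R" "i \<otimes> z = \<zero>" for i
    proof -
      have "i \<otimes> w = \<zero>" if w: "multiple_of z w" for w
      proof -
        obtain a where a: "a \<in> carrier R" "w = z \<otimes> a" using w unfolding multiple_of_def by (elim bexE)
        then have "i \<otimes> w = (i \<otimes> z) \<otimes> a" using i(1) zc by (simp add: m_assoc)
        then show ?thesis using i(2) a(1) by simp
      qed
      then show ?thesis using z by simp
    qed
    have ne: "idx x \<noteq> idx y" using inj_onD[OF inj, of x y] xy by (auto simp: uir_vertices_iff)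
    consider "e \<otimes> x = \<zero>" "e \<otimes> y = \<zero>" | "g \<otimes> x = \<zero>" "g \<otimes> y = \<zero>" | "h \<otimes> x = \<zero>" "h \<otimes> y = \<zero>"
      using miss[OF z(1)] inh c by blast
    then have "{idx x, idx y} \<subseteq> {..5} \<or> {idx x, idx y} \<subseteq> {0, 1, 2, 6}"
      by cases (auto simp: idx_def)
    then have "{idx x, idx y} \<in> edges_of G8"
      using ne by (auto simp: doubleton_edges_of_iff G8_def)
    then show "E \<subseteq> uir_vertices R \<and> idx ` E \<in> edges_of G8"
      using E xy by (auto simp: uir_vertices_iff)
  qed
qed

text \<open>Either alternative excludes the crosscap 2. All rings except those with two corners of
  order five are ruled out in this form.\<close>

definition N1_or_not_N2 :: bool where
  "N1_or_not_N2 \<longleftrightarrow> graph_embeds_in (uir_vertices R) (uir_edges R) (nonorientable_surface 1) \<or>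
     \<not> graph_embeds_in (uir_vertices R) (uir_edges R) (nonorientable_surface 2)"

lemma corner_ge2:
  assumes "idem e" "e \<noteq> \<zero>" shows "2 \<le> card (corner e)"
    and "card (corner e) < 3 \<Longrightarrow> corner e = {\<zero>, e}"
proof -
  have s: "{\<zero>, e} \<subseteq> corner e" using assms by simp
  have c: "card {\<zero>, e} = 2" using assms(2) by simp
  show 1: "2 \<le> card (corner e)" using card_mono[OF finite_corner s] c by simp
  show "card (corner e) < 3 \<Longrightarrow> corner e = {\<zero>, e}" using card_subset_eq[OF finite_corner s] 1 c by simp
qed

lemma three_idempotents:
  assumes idem: "idem e" "idem g" "idem h" and nz: "e \<noteq> \<zero>" "g \<noteq> \<zero>" "h \<noteq> \<zero>"
    and orth: "e \<otimes> g = \<zero>" "e \<otimes> h = \<zero>" "g \<otimes> h = \<zero>" and one: "e \<oplus> g \<oplus> h = \<one>"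
  shows N1_or_not_N2
proof -
  have orth': "g \<otimes> e = \<zero>" "h \<otimes> e = \<zero>" "h \<otimes> g = \<zero>" using orth idem m_comm idem_closed by metis+
  consider "3 \<le> card (corner e)" | "3 \<le> card (corner g)" | "3 \<le> card (corner h)"
    | "card (corner e) < 3" "card (corner g) < 3" "card (corner h) < 3" by linarith
  then show ?thesis
  proof cases
    case 1
    then show ?thesis
      using three_idempotents_not_in_N2[of g h e] idem nz orth orth' by (simp add: N1_or_not_N2_def)
  next
    case 2
    then show ?thesis
      using three_idempotents_not_in_N2[of e h g] idem nz orth orth' by (simp add: N1_or_not_N2_def)
  next
    case 3
    then show ?thesis
      using three_idempotents_not_in_N2[of e g h] idem nz orth orth' by (simp add: N1_or_not_N2_def)
  next
    case 4
    then show ?thesis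
      using three_small_corners_in_N1[OF idem one] corner_ge2(2) idem nz by (simp add: N1_or_not_N2_def)
  qed
qed

lemma not_primitive:
  assumes e: "idem e" "e \<noteq> \<zero>" "e \<noteq> \<one>" "\<not> primitive e"
  shows N1_or_not_N2
proof -
  obtain g where g: "idem g" "g \<in> corner e" "g \<noteq> \<zero>" "g \<noteq> e" using e by (auto simp: primitive_def)
  define f where "f = \<one> \<ominus> e"
  have f: "idem f" "e \<otimes> f = \<zero>" "e \<oplus> f = \<one>" using complement[OF e(1)] by (auto simp: f_def)
  have c: "e \<in> carrier R" "f \<in> carrier R" "g \<in> carrier R" using e f g by auto
  have sq: "e \<otimes> e = e" "g \<otimes> g = g" "e \<otimes> g = g" "g \<otimes> e = g"
    using e g m_comm[of g e] c by (auto simp: idem_def corner_def)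
  have 1: "(e \<ominus> g) \<otimes> (e \<ominus> g) = e \<ominus> g"
  proof -
    have "(e \<ominus> g) \<otimes> (e \<ominus> g) = e \<otimes> e \<ominus> e \<otimes> g \<ominus> (e \<otimes> g \<ominus> g \<otimes> g)" using c by algebra
    then show ?thesis using sq c by (simp add: a_minus_def r_neg)
  qed
  have "g \<otimes> (e \<ominus> g) = g \<otimes> e \<ominus> g \<otimes> g" using c by algebra
  then have 2: "g \<otimes> (e \<ominus> g) = \<zero>" using sq c by (simp add: a_minus_def r_neg)
  have "g \<otimes> f = (e \<otimes> f) \<otimes> g" using sq c by (metis m_assoc m_comm)
  then have 3: "g \<otimes> f = \<zero>" using f c by simp
  have "(e \<ominus> g) \<otimes> f = e \<otimes> f \<ominus> g \<otimes> f" using c by algebra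
  then have 4: "(e \<ominus> g) \<otimes> f = \<zero>" using f 3 c by (simp add: a_minus_def)
  have 5: "g \<oplus> (e \<ominus> g) = e" using c by algebra
  have 6: "e \<ominus> g \<noteq> \<zero>" using 5 g(4) c by auto
  have 7: "f \<noteq> \<zero>" using f(3) e(3) c by auto
  show ?thesis
    by (rule three_idempotents[of g "e \<ominus> g" f]) (use 1 2 3 4 5 6 7 f g c in \<open>auto simp: idem_def\<close>)
qed

section \<open>Elements that are not invertible at an idempotent\<close>

definition nonunits_at :: "'a \<Rightarrow> 'a set" where
  "nonunits_at e = {x \<in> carrier R. \<not> inv_in e (e \<otimes> x)}"

lemma nonunits_at_multiple:
  assumes "e \<in> carrier R" "z \<in> nonunits_at e" "multiple_of z x"
  shows "x \<in> nonunits_at e"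
proof -
  have z: "z \<in> carrier R" "\<not> inv_in e (e \<otimes> z)" using assms(2) by (auto simp: nonunits_at_def)
  obtain a where a: "a \<in> carrier R" "x = z \<otimes> a" using assms(3) unfolding multiple_of_def by (elim bexE)
  have "\<not> inv_in e (e \<otimes> x)"
  proof
    assume "inv_in e (e \<otimes> x)"
    then obtain y where y: "y \<in> carrier R" "(e \<otimes> x) \<otimes> y = e" unfolding inv_in_def by (elim bexE)
    then have "(e \<otimes> z) \<otimes> (a \<otimes> y) = e" using assms(1) z(1) a by (simp add: m_assoc)
    then show False using z(2) a(1) y(1) by (auto simp: inv_in_def)
  qed
  then show ?thesis using a z(1) by (simp add: nonunits_at_def)
qed

lemma nonunit_iff:
  assumes e: "idem e"
  shows "nonunit z \<longleftrightarrow> z \<in> nonunits_at e \<or> z \<in> nonunits_at (\<one> \<ominus> e)"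
proof -
  define f where "f = \<one> \<ominus> e"
  have f: "idem f" "e \<oplus> f = \<one>" using complement[OF e] by (auto simp: f_def)
  have c: "e \<in> carrier R" "f \<in> carrier R" using e f by auto
  have "z \<in> nonunits_at e \<or> z \<in> nonunits_at f" if n: "nonunit z"
  proof (rule ccontr)
    assume *: "\<not> ?thesis"
    have z: "z \<in> carrier R" "z \<notin> Units R" using n by (auto simp: nonunit_def)
    then have "inv_in e (e \<otimes> z)" "inv_in f (f \<otimes> z)" using * by (auto simp: nonunits_at_def)
    then obtain y w where yw: "y \<in> carrier R" "w \<in> carrier R" "(e \<otimes> z) \<otimes> y = e" "(f \<otimes> z) \<otimes> w = f"
      unfolding inv_in_def by (elim bexE)
    have "z \<otimes> (e \<otimes> y \<oplus> f \<otimes> w) = (e \<otimes> z) \<otimes> y \<oplus> (f \<otimes> z) \<otimes> w" using c z(1) yw(1,2) by algebra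
    then have "z \<otimes> (e \<otimes> y \<oplus> f \<otimes> w) = \<one>" using yw f by simp
    then show False using unitI[OF z(1), of "e \<otimes> y \<oplus> f \<otimes> w"] z(2) c yw by simp
  qed
  moreover have "nonunit z" if e: "e \<in> carrier R" and n: "z \<in> nonunits_at e" for e
  proof -
    have z: "z \<in> carrier R" "\<not> inv_in e (e \<otimes> z)" using n by (auto simp: nonunits_at_def)
    have "z \<notin> Units R"
    proof
      assume u: "z \<in> Units R"
      then have "(e \<otimes> z) \<otimes> inv z = e" using e z(1) by (simp add: m_assoc)
      then show False using z(2) u by (auto simp: inv_in_def)
    qed
    then show ?thesis using z(1) by (simp add: nonunit_def)
  qed
  ultimately show ?thesis using c f_def by blast
qed

lemma uir_vertices_eq:
  "idem e \<Longrightarrow> uir_vertices R = nonunits_at e \<union> nonunits_at (\<one> \<ominus> e)"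
  using nonunit_iff uir_vertices_iff by blast

lemma edges_within_nonunits_at:
  assumes e: "idem e"
  shows "edges_within (nonunits_at e) (nonunits_at (\<one> \<ominus> e)) (uir_edges R)"
  unfolding edges_within_def
proof
  fix E assume "E \<in> uir_edges R"
  then obtain x y z where E: "E = {x, y}" and xy: "x \<noteq> y"
    and z: "nonunit z" "multiple_of z x" "multiple_of z y" unfolding uir_edges_iff by (elim exE conjE)
  have "{x, y} \<subseteq> nonunits_at e \<or> {x, y} \<subseteq> nonunits_at (\<one> \<ominus> e)"
    using nonunit_iff[OF e, of z] z nonunits_at_multiple[of e z] nonunits_at_multiple[of "\<one> \<ominus> e" z] e by auto
  then show "\<exists>x y. E = {x, y} \<and> x \<noteq> y \<and> ({x, y} \<subseteq> nonunits_at e \<or> {x, y} \<subseteq> nonunits_at (\<one> \<ominus> e))"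
    using E xy by (intro exI conjI)
qed

lemma fieldlike_nonunits_at:
  assumes e: "idem e" "e \<noteq> \<zero>" "fieldlike e"
  shows "nonunits_at e = corner (\<one> \<ominus> e)"
proof -
  have c: "e \<in> carrier R" using e by simp
  have "inv_in e (e \<otimes> x) \<longleftrightarrow> e \<otimes> x \<noteq> \<zero>" if x: "x \<in> carrier R" for x
  proof
    assume "inv_in e (e \<otimes> x)"
    then obtain y where "y \<in> carrier R" "(e \<otimes> x) \<otimes> y = e" unfolding inv_in_def by (elim bexE)
    then show "e \<otimes> x \<noteq> \<zero>" using e(2) by auto
  next
    assume "e \<otimes> x \<noteq> \<zero>"
    then show "inv_in e (e \<otimes> x)" using e mult_in_corner[OF e(1) x] by (simp add: fieldlike_def)
  qed
  moreover have "(\<one> \<ominus> e) \<otimes> x = x \<longleftrightarrow> e \<otimes> x = \<zero>" if x: "x \<in> carrier R" for x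
  proof -
    have 1: "(\<one> \<ominus> e) \<otimes> x = x \<ominus> e \<otimes> x" using c x by algebra
    have 2: "e \<otimes> x = x \<ominus> (x \<ominus> e \<otimes> x)" using c x by algebra
    show ?thesis unfolding 1 using 2 c x by (auto simp: a_minus_def r_neg)
  qed
  ultimately show ?thesis by (auto simp: nonunits_at_def corner_def)
qed

lemma complement_complement: "e \<in> carrier R \<Longrightarrow> \<one> \<ominus> (\<one> \<ominus> e) = e"
  by algebra

text \<open>The corner consists of 0, \<open>a\<close>, \<open>e\<close> and
  \<open>e \<ominus> a\<close>, and only the first two are not invertible in it. The elements with
  component 0 or \<open>a\<close> are the multiples of \<open>a \<oplus> f\<close>, so they form a
  clique that is twice as large as the corner of \<open>f\<close>. If that corner has at least four
  elements, the clique is too large. If it has two or three, it is a field, and the cliques have at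
  most six and exactly four vertices and share 0 and \<open>a\<close>, so they fit into
  \<open>G8\<close>.\<close>

lemma corner_4_nonfield:
  assumes e: "primitive e" "card (corner e) = 4" and a: "a \<in> corner e" "a \<noteq> \<zero>" "\<not> inv_in e a"
    and e1: "e \<noteq> \<one>"
  shows N1_or_not_N2
proof -
  have ei: "idem e" "e \<noteq> \<zero>" using e(1) by (auto simp: primitive_def)
  define f where "f = \<one> \<ominus> e"
  have f: "idem f" "e \<otimes> f = \<zero>" "f \<otimes> e = \<zero>" "e \<oplus> f = \<one>" "\<one> \<ominus> f = e"
    using complement[OF ei(1)] complement_complement[of e] ei by (auto simp: f_def)
  have c: "e \<in> carrier R" "f \<in> carrier R" "a \<in> carrier R" using ei f corner_closed[OF a(1)] by auto
  have f0: "f \<noteq> \<zero>" using f(4) e1 c by auto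
  have ee: "e \<otimes> e = e" "f \<otimes> f = f" "e \<otimes> a = a" using ei f a by (auto simp: idem_def corner_def)
  have inv_e: "inv_in e e" using ee c by (auto simp: inv_in_def)
  have inv_ea: "inv_in e (e \<ominus> a)" using primitive_local[OF e(1) a(1)] a(3) by simp
  have not0: "\<not> inv_in e \<zero>" using ei(2) by (auto simp: inv_in_def)
  have ne: "e \<noteq> a" "e \<ominus> a \<noteq> \<zero>" "e \<ominus> a \<noteq> a" using inv_e inv_ea a(3) not0 by metis+
  have "e \<ominus> a \<noteq> e"
  proof
    assume "e \<ominus> a = e"
    moreover have "e \<ominus> (e \<ominus> a) = a" using c by algebra
    ultimately show False using a(2) c by (simp add: a_minus_def r_neg)
  qed
  then have "card {\<zero>, a, e, e \<ominus> a} = 4" using ne ei(2) a(2) by auto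
  moreover have "{\<zero>, a, e, e \<ominus> a} \<subseteq> corner e" using ei c a by (auto simp: a_minus_def)
  ultimately have corner: "{\<zero>, a, e, e \<ominus> a} = corner e" using e(2) by (intro card_subset_eq) auto
  define P where "P = {x \<in> carrier R. e \<otimes> x \<in> {\<zero>, a}}"
  have nonunits_P: "nonunits_at e = P"
  proof -
    have "inv_in e (e \<otimes> x) \<longleftrightarrow> e \<otimes> x \<notin> {\<zero>, a}" if x: "x \<in> carrier R" for x
      using mult_in_corner[OF ei(1) x] inv_e inv_ea not0 a(3) ne unfolding corner[symmetric] by auto
    then show ?thesis by (auto simp: nonunits_at_def P_def)
  qed
  have "card P = card {\<zero>, a} * card (corner f)"
    unfolding P_def f_def by (rule card_fibre[OF ei(1)]) (use a ei in auto)
  then have card_P: "card P = 2 * card (corner f)" using a(2) by auto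
  show ?thesis
  proof (cases "card (corner f) < 4")
    case False
    define z where "z = a \<oplus> f"
    have "f \<otimes> a = (f \<otimes> e) \<otimes> a" using c ee by (simp add: m_assoc)
    then have fa: "f \<otimes> a = \<zero>" unfolding f using c by simp
    then have af: "a \<otimes> f = \<zero>" using c m_comm by simp
    have ae: "a \<otimes> e = a" using ee c m_comm by simp
    have z: "z \<in> carrier R" "e \<otimes> z = a" using c ee f by (auto simp: z_def r_distr)
    then have "nonunit z" using nonunit_iff[OF ei(1), of z] a(3) by (simp add: nonunits_at_def)
    then have "\<not> graph_embeds_in (uir_vertices R) (uir_edges R) (nonorientable_surface 2)"
    proof (rule multiples_not_in_N2)
      show "7 \<le> card P" using card_P False by simp
      fix x assume x: "x \<in> P"
      then have xc: "x \<in> carrier R" "e \<otimes> x = \<zero> \<or> e \<otimes> x = a" by (auto simp: P_def)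
      have "(e \<oplus> f) \<otimes> x = e \<otimes> x \<oplus> f \<otimes> x" using c xc by (simp add: l_distr)
      then have dec: "x = e \<otimes> x \<oplus> f \<otimes> x" using f(4) xc(1) by simp
      from xc(2) show "multiple_of z x"
      proof
        assume "e \<otimes> x = \<zero>"
        moreover have "z \<otimes> (f \<otimes> x) = a \<otimes> f \<otimes> x \<oplus> f \<otimes> f \<otimes> x"
          using c xc(1) by (simp add: z_def l_distr m_assoc)
        ultimately have "z \<otimes> (f \<otimes> x) = x" using dec af ee c xc(1) by simp
        then show ?thesis unfolding multiple_of_def using c xc(1) by (metis m_closed)
      next
        assume ex: "e \<otimes> x = a"
        have "z \<otimes> (e \<oplus> f \<otimes> x) = (a \<otimes> e \<oplus> f \<otimes> e) \<oplus> (a \<otimes> f \<otimes> x \<oplus> f \<otimes> f \<otimes> x)"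
          using c xc(1) by (simp add: z_def l_distr r_distr m_assoc)
        also have "\<dots> = e \<otimes> x \<oplus> f \<otimes> x" using ae f(3) af ee ex c xc(1) by simp
        finally have "z \<otimes> (e \<oplus> f \<otimes> x) = x" using dec by simp
        then show ?thesis unfolding multiple_of_def using c xc(1) by (metis m_closed a_closed)
      qed
    qed
    then show ?thesis by (simp add: N1_or_not_N2_def)
  next
    case True
    then have "card (corner f) = 2 \<or> card (corner f) = 3" using corner_ge2(1)[OF f(1) f0] by linarith
    then have "prime (card (corner f))" by auto
    then have "nonunits_at f = corner e" using fieldlike_nonunits_at[OF f(1) f0] prime_fieldlike[OF f(1)] f(5) by simp
    moreover have "graph_embeds_in (nonunits_at e \<union> nonunits_at f) (uir_edges R) (nonorientable_surface 1)"
    proof (rule two_cliques_in_N1)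
      have *: "nonunits_at f = corner e" by fact
      show "finite (nonunits_at e)" unfolding nonunits_P P_def using finite_carrier by simp
      show "finite (nonunits_at f)" unfolding * by simp
      show "edges_within (nonunits_at e) (nonunits_at f) (uir_edges R)"
        unfolding f_def by (rule edges_within_nonunits_at[OF ei(1)])
      have "P \<inter> corner e = {\<zero>, a}" using a c by (auto simp: P_def corner_def)
      then have "card (nonunits_at e \<inter> nonunits_at f) = 2" unfolding * nonunits_P using a(2) by auto
      moreover have "card (nonunits_at e) \<le> 6" unfolding nonunits_P using card_P True by simp
      ultimately show "card (nonunits_at e) \<le> 6 \<and> card (nonunits_at f) \<le> 4 \<and> card (nonunits_at e \<inter> nonunits_at f) = 2 \<or>
          card (nonunits_at e) \<le> 5 \<and> card (nonunits_at f) \<le> 4 \<and> card (nonunits_at e \<inter> nonunits_at f) = 1"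
        using * e(2) by simp
    qed
    ultimately show ?thesis using uir_vertices_eq[OF ei(1)] by (simp add: N1_or_not_N2_def f_def)
  qed
qed

lemma edges_within_commute: "edges_within P Q E \<longleftrightarrow> edges_within Q P E"
  unfolding edges_within_def by (simp add: disj_commute)

text \<open>A corner other than the whole ring is a clique and so has fewer than seven elements.
  Being primitive it does not have six, and if it were not a field it would have four. Two fields
  with at most five elements, one of them with at most four, give a subgraph of
  \<open>G8\<close>.\<close>

lemma N1_or_not_N2_or_5_5:
  assumes e: "idem e" "e \<noteq> \<zero>" "e \<noteq> \<one>" and no: "\<not> N1_or_not_N2"
  shows "card (corner e) = 5" "card (corner (\<one> \<ominus> e)) = 5"
proof -
  define f where "f = \<one> \<ominus> e"
  have f: "idem f" "e \<otimes> f = \<zero>" "f \<otimes> e = \<zero>" "e \<oplus> f = \<one>" "\<one> \<ominus> f = e"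
    using complement[OF e(1)] complement_complement[of e] e by (auto simp: f_def)
  have c: "e \<in> carrier R" "f \<in> carrier R" using e f by auto
  have f01: "f \<noteq> \<zero>" "f \<noteq> \<one>" using f(4,5) e c by (auto simp: a_minus_def r_neg)
  \<comment> \<open>The element \<open>h\<close> serves as a witness that \<open>g\<close> is not a
    unit. The fact is used for \<open>e\<close> and for its complement.\<close>
  have small: "card (corner g) \<le> 5 \<and> fieldlike g"
    if g: "idem g" "g \<noteq> \<zero>" "g \<noteq> \<one>" and h: "h \<in> carrier R" "g \<otimes> h = \<zero>" "h \<noteq> \<zero>" for g h
  proof -
    have prim: "primitive g" using not_primitive[OF g] no by blast
    have "nonunit g" using nonunitI[of g h] g h by simp
    then have "card (corner g) < 7"
      using multiples_not_in_N2[of g "corner g"] corner_multiple no by (force simp: N1_or_not_N2_def)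
    then have c5: "card (corner g) \<le> 5" using primitive_card_not_6[OF prim] by linarith
    have "fieldlike g"
    proof (rule ccontr)
      assume nf: "\<not> fieldlike g"
      then obtain a where a: "a \<in> corner g" "a \<noteq> \<zero>" "\<not> inv_in g a" by (auto simp: fieldlike_def)
      have "\<not> prime (card (corner g))" using prime_fieldlike[OF g(1)] nf by blast
      moreover have "prime (2::nat)" "prime (3::nat)" "prime (5::nat)" by simp_all
      ultimately have "card (corner g) \<noteq> 2" "card (corner g) \<noteq> 3" "card (corner g) \<noteq> 5" by metis+
      then have "card (corner g) = 4" using c5 corner_ge2(1)[OF g(1,2)] by linarith
      then show False using corner_4_nonfield[OF prim _ a g(3)] no by blast
    qed
    then show ?thesis using c5 by simp
  qed
  have es: "card (corner e) \<le> 5" "fieldlike e" using small[OF e c(2) f(2) f01(1)] by auto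
  have fs: "card (corner f) \<le> 5" "fieldlike f" using small[OF f(1) f01 c(1) f(3) e(2)] by auto
  have V: "uir_vertices R = corner f \<union> corner e"
    using uir_vertices_eq[OF e(1)] fieldlike_nonunits_at[OF e(1,2) es(2)] fieldlike_nonunits_at[OF f(1) f01(1) fs(2)] f(5)
    by (simp add: f_def)
  have E: "edges_within (corner f) (corner e) (uir_edges R)"
    using edges_within_nonunits_at[OF e(1)] fieldlike_nonunits_at[OF e(1,2) es(2)] fieldlike_nonunits_at[OF f(1) f01(1) fs(2)] f(5)
    by (simp add: f_def)
  have "corner f \<inter> corner e = {\<zero>}" using corner_inter[OF c f(2)] c by auto
  then have I: "card (corner f \<inter> corner e) = 1" by simp
  have "\<not> graph_embeds_in (corner f \<union> corner e) (uir_edges R) (nonorientable_surface 1)"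
    using no V by (simp add: N1_or_not_N2_def)
  then have "\<not> card (corner e) \<le> 4" "\<not> card (corner f) \<le> 4"
    using two_cliques_in_N1[OF finite_corner finite_corner E] I fs(1) es(1)
      two_cliques_in_N1[OF finite_corner finite_corner E[THEN edges_within_commute[THEN iffD1]]]
    by (auto simp: Int_commute Un_commute)
  then show "card (corner e) = 5" "card (corner (\<one> \<ominus> e)) = 5" using es fs f_def by auto
qed

lemma crosscap_corners_5_5:
  assumes e: "idem e" and c5: "card (corner e) = 5" "card (corner (\<one> \<ominus> e)) = 5"
  shows "crosscap (uir_vertices R) (uir_edges R) = 2"
proof -
  define f where "f = \<one> \<ominus> e"
  have f: "idem f" "e \<otimes> f = \<zero>" "f \<otimes> e = \<zero>" "e \<oplus> f = \<one>" "\<one> \<ominus> f = e"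
    using complement[OF e] complement_complement[of e] e by (auto simp: f_def)
  have c: "e \<in> carrier R" "f \<in> carrier R" using e f by auto
  have "corner \<zero> = {\<zero>}" by (auto simp: corner_def)
  then have nz: "e \<noteq> \<zero>" "f \<noteq> \<zero>" using c5 f_def by auto
  have "prime (5::nat)" by simp
  then have fl: "fieldlike e" "fieldlike f" using prime_fieldlike e f(1) c5 f_def by auto
  have V: "uir_vertices R = corner f \<union> corner e"
    using uir_vertices_eq[OF e] fieldlike_nonunits_at[OF e nz(1) fl(1)] fieldlike_nonunits_at[OF f(1) nz(2) fl(2)] f(5)
    by (simp add: f_def)
  have E: "edges_within (corner f) (corner e) (uir_edges R)"
    using edges_within_nonunits_at[OF e] fieldlike_nonunits_at[OF e nz(1) fl(1)] fieldlike_nonunits_at[OF f(1) nz(2) fl(2)] f(5)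
    by (simp add: f_def)
  have "corner f \<inter> corner e = {\<zero>}" using corner_inter[OF c f(2)] c by auto
  then have I: "card (corner f \<inter> corner e) = 1" by simp
  have nu: "nonunit e" "nonunit f" using nonunitI[of e f] nonunitI[of f e] c f nz by auto
  have clique: "{x, y} \<in> uir_edges R" if "x \<noteq> y" "{x, y} \<subseteq> corner f \<or> {x, y} \<subseteq> corner e" for x y
    using that(2) edgeI[OF that(1) nu(1)] edgeI[OF that(1) nu(2)] corner_multiple by auto
  show ?thesis
    unfolding crosscap_eq_2_iff V
    using two_K5[OF _ _ I E clique] c5 f_def by simp
qed

end

section \<open>Corners of prime order as residue rings of the integers\<close>

lemma ZFact_ZMod:
  "carrier (ZFact n) = range (ZMod n)"
  "ZMod n a \<otimes>\<^bsub>ZFact n\<^esub> ZMod n b = ZMod n (a * b)"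
  "ZMod n a \<oplus>\<^bsub>ZFact n\<^esub> ZMod n b = ZMod n (a + b)"
  "\<one>\<^bsub>ZFact n\<^esub> = ZMod n 1"
proof -
  interpret I: ideal "Idl\<^bsub>\<Z>\<^esub> {n}" \<Z> by (rule int.genideal_ideal) simp
  show "carrier (ZFact n) = range (ZMod n)"
    by (auto simp: ZFact_def FactRing_def A_RCOSETS_def' a_r_coset_def' ZMod_def)
  show "ZMod n a \<otimes>\<^bsub>ZFact n\<^esub> ZMod n b = ZMod n (a * b)"
    using I.rcoset_mult_add[of a b] by (simp add: ZFact_def FactRing_def ZMod_def)
  show "ZMod n a \<oplus>\<^bsub>ZFact n\<^esub> ZMod n b = ZMod n (a + b)"
    using I.a_rcos_sum[of a b] by (simp add: ZFact_def FactRing_def ZMod_def)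
  show "\<one>\<^bsub>ZFact n\<^esub> = ZMod n 1" by (simp add: ZFact_def FactRing_def ZMod_def)
qed

lemma card_ZFact:
  assumes "n > 0" shows "card (carrier (ZFact n)) = nat n"
proof -
  have "range (ZMod n) = ZMod n ` {0..<n}"
  proof
    show "range (ZMod n) \<subseteq> ZMod n ` {0..<n}"
    proof (rule image_subsetI)
      fix a show "ZMod n a \<in> ZMod n ` {0..<n}"
        using ZMod_mod[of n a] assms by (intro image_eqI[of _ _ "a mod n"]) auto
    qed
  qed auto
  moreover have "inj_on (ZMod n) {0..<n}" by (auto simp: inj_on_def ZMod_eq_mod)
  ultimately show ?thesis using ZFact_ZMod(1)[of n] by (simp add: card_image)
qed

context finite_cring
begin

lemma int_multiple_in_corner: "idem e \<Longrightarrow> add_pow R (i :: int) e \<in> corner e"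
  using add_pow_rdistr_int[of e e i] by (simp add: corner_def idem_def)

text \<open>The order of the corner annihilates \<open>e\<close>. If an integer prime to it did so
  too, Bezout's identity would give \<open>e = \<zero>\<close>.\<close>

lemma int_multiple_eq_iff:
  assumes e: "idem e" and p: "prime (card (corner e))"
  shows "add_pow R (i :: int) e = add_pow R j e \<longleftrightarrow> i mod int (card (corner e)) = j mod int (card (corner e))"
proof -
  define q where "q = int (card (corner e))"
  have ec: "e \<in> carrier R" using e by simp
  have e0: "e \<noteq> \<zero>"
  proof
    assume "e = \<zero>"
    then have "corner e = {\<zero>}" by (auto simp: corner_def)
    then show False using p by simp
  qed
  have q0: "add_pow R q e = \<zero>"
    using corner_pow_card[OF e] add_pow_int_ge[of q R e] by (simp add: q_def)
  have mult: "add_pow R (q * k) e = \<zero>" for k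
    using add.int_pow_pow[OF ec, of k q] q0 by simp
  have zero: "add_pow R k e = \<zero> \<longleftrightarrow> q dvd k" for k
  proof
    assume k: "add_pow R k e = \<zero>"
    show "q dvd k"
    proof (rule ccontr)
      assume "\<not> q dvd k"
      then have "coprime q k" using p by (intro prime_imp_coprime) (auto simp: q_def)
      then obtain a b where ab: "q * a + k * b = 1" using bezout_int[of q k] by (metis coprime_imp_gcd_eq_1 mult.commute)
      have kb: "add_pow R (k * b) e = \<zero>" using add.int_pow_pow[OF ec, of b k] unfolding k by simp
      have "e = add_pow R (q * a + k * b) e" using ab ec by simp
      also have "\<dots> = add_pow R (q * a) e \<oplus> add_pow R (k * b) e" by (rule add.int_pow_mult[OF ec])
      also have "\<dots> = \<zero>" using mult kb by simp
      finally show False using e0 by simp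
    qed
  next
    assume "q dvd k" then show "add_pow R k e = \<zero>" using mult by auto
  qed
  have "add_pow R i e = add_pow R j e \<oplus> add_pow R (i - j) e" using add.int_pow_mult[OF ec, of j "i - j"] by simp
  then have "add_pow R i e = add_pow R j e \<longleftrightarrow> add_pow R (i - j) e = \<zero>" using ec by simp
  then show ?thesis using zero by (simp add: mod_eq_dvd_iff q_def)
qed

lemma corner_int_multiples:
  assumes e: "idem e" and p: "prime (card (corner e))" and x: "x \<in> corner e"
  obtains i :: int where "add_pow R i e = x"
proof -
  define q where "q = int (card (corner e))"
  have "inj_on (\<lambda>i. add_pow R i e) {0..<q}"
    by (auto simp: inj_on_def int_multiple_eq_iff[OF e p] q_def)
  then have "card ((\<lambda>i. add_pow R i e) ` {0..<q}) = card (corner e)" by (simp add: card_image q_def)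
  moreover have "(\<lambda>i. add_pow R i e) ` {0..<q} \<subseteq> corner e" using int_multiple_in_corner[OF e] by auto
  ultimately have "(\<lambda>i. add_pow R i e) ` {0..<q} = corner e" by (intro card_subset_eq) auto
  then obtain i :: int where "x = add_pow R i e" using x by blast
  then show thesis using that[of i] by simp
qed

text \<open>A corner of prime order is generated additively by \<open>e\<close>, so the component of
  \<open>x\<close> is an integer multiple of \<open>e\<close>. By \<open>residue_eq_iff\<close> the
  class of the multiplier does not depend on the choice.\<close>

definition residue :: "'a \<Rightarrow> 'a \<Rightarrow> int set" where
  "residue e x = ZMod (int (card (corner e))) (SOME i. add_pow R i e = e \<otimes> x)"

lemma residue_eq_iff:
  assumes e: "idem e" and p: "prime (card (corner e))" and x: "x \<in> carrier R"
  shows "residue e x = ZMod (int (card (corner e))) i \<longleftrightarrow> add_pow R i e = e \<otimes> x"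
proof -
  obtain j :: int where "add_pow R j e = e \<otimes> x" using corner_int_multiples[OF e p mult_in_corner[OF e x]] .
  then have "add_pow R (SOME i::int. add_pow R i e = e \<otimes> x) e = e \<otimes> x" by (rule someI)
  then show ?thesis
    unfolding residue_def ZMod_eq_mod using int_multiple_eq_iff[OF e p] by metis
qed

lemma residue_ring_hom:
  assumes e: "idem e" and p: "prime (card (corner e))"
  shows "residue e \<in> ring_hom R (ZFact (int (card (corner e))))"
proof -
  let ?q = "int (card (corner e))"
  have ec: "e \<in> carrier R" "e \<otimes> e = e" using e by (auto simp: idem_def)
  note res = residue_eq_iff[OF e p]
  show ?thesis
  proof (rule ring_hom_memI)
    show "residue e x \<in> carrier (ZFact ?q)" if "x \<in> carrier R" for x
      unfolding ZFact_ZMod(1) residue_def by simp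
    fix x y assume xy: "x \<in> carrier R" "y \<in> carrier R"
    obtain i :: int where i: "add_pow R i e = e \<otimes> x" using corner_int_multiples[OF e p mult_in_corner[OF e xy(1)]] .
    obtain j :: int where j: "add_pow R j e = e \<otimes> y" using corner_int_multiples[OF e p mult_in_corner[OF e xy(2)]] .
    have r: "residue e x = ZMod ?q i" "residue e y = ZMod ?q j" using res xy i j by auto
    have "add_pow R (i + j) e = e \<otimes> (x \<oplus> y)" using add.int_pow_mult[OF ec(1), of i j] i j xy ec by (simp add: r_distr)
    then show "residue e (x \<oplus> y) = residue e x \<oplus>\<^bsub>ZFact ?q\<^esub> residue e y"
      using res[of "x \<oplus> y"] xy by (simp add: r ZFact_ZMod)
    have "add_pow R (j * i) e = add_pow R i (add_pow R j e)" using add.int_pow_pow[OF ec(1), of i j] by simp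
    also have "\<dots> = add_pow R i e \<otimes> add_pow R j e"
      using add_pow_ldistr_int[of e "add_pow R j e" i] int_multiple_in_corner[OF e, of j] by (simp add: corner_def ec)
    also have "\<dots> = (e \<otimes> e) \<otimes> (x \<otimes> y)" unfolding i j using xy ec(1) by (simp add: m_ac)
    finally have "add_pow R (i * j) e = e \<otimes> (x \<otimes> y)" using ec by (simp add: mult.commute)
    then show "residue e (x \<otimes> y) = residue e x \<otimes>\<^bsub>ZFact ?q\<^esub> residue e y"
      using res[of "x \<otimes> y"] xy by (simp add: r ZFact_ZMod)
  next
    have "add_pow R (1 :: int) e = e \<otimes> \<one>" using ec by simp
    then show "residue e \<one> = \<one>\<^bsub>ZFact ?q\<^esub>" using res[of \<one> 1] by (simp add: ZFact_ZMod)
  qed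
qed

lemma residue_inj:
  assumes e: "idem e" and p: "prime (card (corner e))" and "x \<in> carrier R" "y \<in> carrier R" "residue e x = residue e y"
  shows "e \<otimes> x = e \<otimes> y"
proof -
  obtain i :: int where i: "add_pow R i e = e \<otimes> x" using corner_int_multiples[OF e p mult_in_corner[OF e assms(3)]] .
  then have "residue e y = ZMod (int (card (corner e))) i" using residue_eq_iff[OF e p assms(3)] assms(5) by simp
  then show ?thesis using residue_eq_iff[OF e p assms(4)] i by simp
qed

lemma prime_corners_iso:
  assumes e: "idem e" and p: "prime (card (corner e))" "prime (card (corner (\<one> \<ominus> e)))"
  shows "R \<simeq> RDirProd (ZFact (int (card (corner e)))) (ZFact (int (card (corner (\<one> \<ominus> e)))))"
proof -
  define f where "f = \<one> \<ominus> e"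
  have f: "idem f" "e \<oplus> f = \<one>" using complement[OF e] by (auto simp: f_def)
  have c: "e \<in> carrier R" "f \<in> carrier R" using e f by auto
  have pf: "prime (card (corner f))" using p by (simp add: f_def)
  let ?S = "ZFact (int (card (corner e)))" and ?T = "ZFact (int (card (corner f)))"
  let ?h = "\<lambda>x. (residue e x, residue f x)"
  note he = residue_ring_hom[OF e p(1)] and hf = residue_ring_hom[OF f(1) pf]
  have inj: "inj_on ?h (carrier R)"
  proof (rule inj_onI)
    fix x y assume xy: "x \<in> carrier R" "y \<in> carrier R" "?h x = ?h y"
    then have "e \<otimes> x = e \<otimes> y" "f \<otimes> x = f \<otimes> y" using residue_inj[OF e p(1) xy(1,2)] residue_inj[OF f(1) pf xy(1,2)] by auto
    then have "(e \<oplus> f) \<otimes> x = (e \<oplus> f) \<otimes> y" using c xy by (simp add: l_distr)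
    then show "x = y" using f(2) xy by simp
  qed
  have sub: "?h ` carrier R \<subseteq> carrier ?S \<times> carrier ?T"
    using ring_hom_closed[OF he] ring_hom_closed[OF hf] by auto
  have cS: "card (carrier ?S) = card (corner e)" "card (carrier ?T) = card (corner f)"
    using card_ZFact[of "int (card (corner e))"] card_ZFact[of "int (card (corner f))"] p(1) pf by (auto simp: prime_gt_0_nat)
  have "card (?h ` carrier R) = card (carrier ?S \<times> carrier ?T)"
    unfolding card_image[OF inj] card_cartesian_product cS using card_corners[OF e] by (simp add: f_def)
  moreover have "finite (carrier ?S)" "finite (carrier ?T)"
    using cS p(1) pf by (auto intro!: card_ge_0_finite simp: prime_gt_0_nat)
  ultimately have "?h ` carrier R = carrier ?S \<times> carrier ?T" using sub by (intro card_subset_eq) auto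
  then have "?h \<in> ring_iso R (RDirProd ?S ?T)"
    using inj ring_hom_memE[OF he] ring_hom_memE[OF hf]
    by (intro ring_iso_memI) (auto simp: RDirProd_def DirProd_def monoid.defs bij_betw_def)
  then show ?thesis unfolding is_ring_iso_def f_def by blast
qed

text \<open>In the second direction the isomorphism is used only to count 25 elements: a non-local
  ring of this order splits into two corners of order five. So the graph need not be carried along
  the isomorphism.\<close>

lemma crosscap_2_iff:
  assumes "\<not> local_ring R"
  shows "crosscap (uir_vertices R) (uir_edges R) = 2 \<longleftrightarrow> R \<simeq> RDirProd (ZFact 5) (ZFact 5)"
proof
  assume *: "crosscap (uir_vertices R) (uir_edges R) = 2"
  then have no: "\<not> N1_or_not_N2" by (simp add: crosscap_eq_2_iff N1_or_not_N2_def)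
  \<comment> \<open>The zero ring has no maximal ideal and thus counts as non-local. Its only
    element is a unit, so its graph is empty and embeds everywhere.\<close>
  have "\<one> \<noteq> \<zero>"
  proof
    assume "\<one> = \<zero>"
    then have "carrier R = {\<zero>}" by (rule one_zeroD)
    then have "uir_vertices R = {}" using Units_one_closed \<open>\<one> = \<zero>\<close> by (auto simp: uir_vertices_def)
    then have "uir_vertices R = {}" "uir_edges R = {}" by (auto simp: uir_edges_def)
    then have "graph_embeds_in (uir_vertices R) (uir_edges R) (nonorientable_surface 1)"
      by (intro graph_embeds_in_subgraph[OF G8_in_N1, of "\<lambda>_. 0"]) auto
    then show False using no by (simp add: N1_or_not_N2_def)
  qed
  then obtain e where e: "idem e" "e \<noteq> \<zero>" "e \<noteq> \<one>" using non_local_idem[OF _ assms] by blast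
  then show "R \<simeq> RDirProd (ZFact 5) (ZFact 5)"
    using prime_corners_iso[OF e(1)] N1_or_not_N2_or_5_5[OF e no] by simp
next
  assume "R \<simeq> RDirProd (ZFact 5) (ZFact 5)"
  then obtain h where "h \<in> ring_iso R (RDirProd (ZFact 5) (ZFact 5))" by (auto simp: is_ring_iso_def)
  from bij_betw_same_card[OF ring_iso_memE(5)[OF this]] have c25: "card (carrier R) = 5 ^ 2"
    by (simp add: RDirProd_carrier card_cartesian_product card_ZFact)
  have "\<one> \<noteq> \<zero>"
  proof
    assume "\<one> = \<zero>"
    then have "carrier R = {\<zero>}" by (rule one_zeroD)
    then show False using c25 by simp
  qed
  then obtain e where e: "idem e" "e \<noteq> \<zero>" "e \<noteq> \<one>" using non_local_idem[OF _ assms] by blast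
  define f where "f = \<one> \<ominus> e"
  have f: "idem f" "e \<oplus> f = \<one>" using complement[OF e(1)] by (auto simp: f_def)
  have f0: "f \<noteq> \<zero>" using f(2) e by auto
  have prod: "card (corner e) * card (corner f) = 5 ^ 2" using card_corners[OF e(1)] c25 by (simp add: f_def)
  have big: "2 \<le> card (corner e)" "2 \<le> card (corner f)" using corner_ge2(1) e f f0 by auto
  have "card (corner e) dvd 5 ^ 2" using prod by (metis dvd_triv_left)
  then obtain i where i: "i \<le> 2" "card (corner e) = 5 ^ i"
    using divides_primepow_nat[of 5 "card (corner e)" 2] by auto
  then consider "i = 0" | "i = 1" | "i = 2" by linarith
  then have "card (corner e) = 5 \<and> card (corner f) = 5"
    by cases (use i prod big in auto)
  then show "crosscap (uir_vertices R) (uir_edges R) = 2"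
    using crosscap_corners_5_5[OF e(1)] by (simp add: f_def)
qed

end

theorem theorem4p10:
  fixes R :: "('a, 'm) ring_scheme"
  assumes "cring R"
    and "finite (carrier R)"
    and "\<not> local_ring R"
  shows "crosscap (uir_vertices R) (uir_edges R) = 2
           \<longleftrightarrow> R \<simeq> RDirProd (ZFact 5) (ZFact 5)"
proof -
  interpret finite_cring R using assms(1,2) by (simp add: finite_cring_def finite_cring_axioms_def)
  show ?thesis using crosscap_2_iff[OF assms(3)] .
qed

end
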